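(* Let $\mathbb{K}$ be a field of characteristic $0$, let $N\geq 2$ and $s\geq 1$ be integers, let $R=\mathbb{K}[x_0,\ldots,x_N]$, and let $I=\bigcap_{i=1}^s I(P_i)\subset R$ be the ideal of $s$ very general points $P_1,\ldots,P_s$ in $\mathbb{P}^N_{\mathbb{K}}$. Set $$\beta=\frac{2(N-1)\left(\alpha(I)+N-1\right)}{(N-2)N}+1 \quad\text{if } N\geq 4,\qquad \beta=1\quad\text{if } N=2,3.$$ Then for every integer $m\geq \beta$ one has $$I^{(Nm-N+1)}\subseteq I^m.$$
   Context: For a point $P\in\mathbb{P}^N_{\mathbb{K}}$, $I(P)\subset R$ is the ideal generated by all homogeneous polynomials vanishing at $P$. For $I=\bigcap_{i=1}^s I(P_i)$ with distinct points $P_i$, the $m$-th symbolic power is $I^{(m)}=\bigcap_{i=1}^s I(P_i)^m$, while $I^m$ is the ordinary power. For a nonzero homogeneous ideal $J$, $\alpha(J)$ is the least degree of a nonzero element of $J$. For $\underline{\lambda}=(\lambda_{ij})_{1\le i\le s,\,0\le j\le N}\in\mathbb{A}^{s(N+1)}_{\mathbb{K}}$, put $P_i(\underline{\lambda})=[\lambda_{i0}:\lambda_{i1}:\cdots:\lambda_{iN}]\in\mathbb{P}^N_{\mathbb{K}}$. A statement holds for $s$ very general points in $\mathbb{P}^N_{\mathbb{K}}$ if there are countably many dense Zariski-open subsets $U_1,U_2,\ldots$ of $\mathbb{A}^{s(N+1)}_{\mathbb{K}}$ (depending on $N$ and $s$ only) such that for every $\underline{\lambda}\in W=\bigcap_{k=1}^\infty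 U_k$ the $P_i(\underline{\lambda})$ are well-defined, distinct points and the statement holds for $P_i=P_i(\underline{\lambda})$, $i=1,\ldots,s$. *)

theory Defs
  imports
    "HOL-Algebra.Ideal_Product"
    "HOL-Library.Poly_Mapping"
    "HOL-Analysis.Abstract_Topology"
begin

section \<open>Polynomials in a set of variables\<close>

text \<open>A monomial is its finitely supported exponent function; a polynomial is a finitely
  supported coefficient function on monomials, with the convolution product of
  \<^theory>\<open>HOL-Library.Poly_Mapping\<close>.\<close>

type_synonym ('i, 'k) mpoly = "('i \<Rightarrow>\<^sub>0 nat) \<Rightarrow>\<^sub>0 'k"

definition poly_vars :: "('i, 'k::zero) mpoly \<Rightarrow> 'i set"
  where "poly_vars f = (\<Union>t \<in> Poly_Mapping.keys f. Poly_Mapping.keys t)"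

definition monom_degree :: "('i \<Rightarrow>\<^sub>0 nat) \<Rightarrow> nat"
  where "monom_degree t = (\<Sum>i \<in> Poly_Mapping.keys t. Poly_Mapping.lookup t i)"

text \<open>The total degree; a junk value for the zero polynomial.\<close>

definition total_degree :: "('i, 'k::zero) mpoly \<Rightarrow> nat"
  where "total_degree f = Max (monom_degree ` Poly_Mapping.keys f)"

definition homogeneous :: "('i, 'k::zero) mpoly \<Rightarrow> bool"
  where "homogeneous f \<longleftrightarrow> (\<exists>d. \<forall>t \<in> Poly_Mapping.keys f. monom_degree t = d)"

definition monom_eval :: "('i \<Rightarrow>\<^sub>0 nat) \<Rightarrow> ('i \<Rightarrow> 'k::comm_semiring_1) \<Rightarrow> 'k"
  where "monom_eval t v = (\<Prod>i \<in> Poly_Mapping.keys t. v i ^ Poly_Mapping.lookup t i)"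

definition poly_eval :: "('i, 'k::comm_semiring_1) mpoly \<Rightarrow> ('i \<Rightarrow> 'k) \<Rightarrow> 'k"
  where "poly_eval f v = (\<Sum>t \<in> Poly_Mapping.keys f. Poly_Mapping.lookup f t * monom_eval t v)"

definition poly_ring :: "'i set \<Rightarrow> ('i, 'k::comm_ring_1) mpoly ring"
  where "poly_ring A =
    \<lparr>carrier = {f. poly_vars f \<subseteq> A}, mult = (*), one = 1, zero = 0, add = (+)\<rparr>"

lemma poly_ring_simps [simp]:
  "carrier (poly_ring A) = {f. poly_vars f \<subseteq> A}"
  "mult (poly_ring A) = (*)" "one (poly_ring A) = 1"
  "zero (poly_ring A) = 0" "add (poly_ring A) = (+)"
  by (simp_all add: poly_ring_def)

lemma poly_vars_0 [simp]: "poly_vars 0 = {}"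
  by (simp add: poly_vars_def)

lemma poly_vars_1 [simp]: "poly_vars (1 :: ('i, 'k::zero_neq_one) mpoly) = {}"
  by (simp add: poly_vars_def)

lemma poly_vars_uminus [simp]:
  fixes f :: "('i, 'k::ab_group_add) mpoly"
  shows "poly_vars (- f) = poly_vars f"
proof -
  have "Poly_Mapping.keys (- f) = Poly_Mapping.keys f"
    by (auto simp: in_keys_iff)
  then show ?thesis by (simp add: poly_vars_def)
qed

lemma poly_vars_add:
  fixes f g :: "('i, 'k::monoid_add) mpoly"
  shows "poly_vars (f + g) \<subseteq> poly_vars f \<union> poly_vars g"
  using Poly_Mapping.keys_add[of f g] by (auto simp: poly_vars_def)

lemma poly_vars_mult:
  fixes f g :: "('i, 'k::semiring_0) mpoly"
  shows "poly_vars (f * g) \<subseteq> poly_vars f \<union> poly_vars g"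
proof
  fix i assume "i \<in> poly_vars (f * g)"
  then obtain t where t: "t \<in> Poly_Mapping.keys (f * g)" "i \<in> Poly_Mapping.keys t"
    by (auto simp: poly_vars_def)
  then obtain a b where ab: "t = a + b" "a \<in> Poly_Mapping.keys f" "b \<in> Poly_Mapping.keys g"
    using Poly_Mapping.keys_mult[of f g] by blast
  then have "i \<in> Poly_Mapping.keys a \<union> Poly_Mapping.keys b"
    using t Poly_Mapping.keys_add[of a b] by blast
  then show "i \<in> poly_vars f \<union> poly_vars g"
    using ab by (auto simp: poly_vars_def)
qed

lemma cring_poly_ring: "cring (poly_ring A :: ('i, 'k::comm_ring_1) mpoly ring)"
proof (rule cringI)
  show "abelian_group (poly_ring A :: ('i, 'k) mpoly ring)"
  proof (rule abelian_groupI)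
    fix x y :: "('i, 'k) mpoly"
    assume "x \<in> carrier (poly_ring A)" "y \<in> carrier (poly_ring A)"
    then show "x \<oplus>\<^bsub>poly_ring A\<^esub> y \<in> carrier (poly_ring A)"
      using poly_vars_add[of x y] by auto
  next
    fix x :: "('i, 'k) mpoly"
    assume "x \<in> carrier (poly_ring A)"
    then show "\<exists>y\<in>carrier (poly_ring A). y \<oplus>\<^bsub>poly_ring A\<^esub> x = \<zero>\<^bsub>poly_ring A\<^esub>"
      by (intro bexI[of _ "- x"]) auto
  qed (simp_all add: ac_simps)
  show "comm_monoid (poly_ring A :: ('i, 'k) mpoly ring)"
  proof (rule comm_monoidI)
    fix x y :: "('i, 'k) mpoly"
    assume "x \<in> carrier (poly_ring A)" "y \<in> carrier (poly_ring A)"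
    then show "x \<otimes>\<^bsub>poly_ring A\<^esub> y \<in> carrier (poly_ring A)"
      using poly_vars_mult[of x y] by auto
  qed (simp_all add: ac_simps)
qed (simp add: distrib_right)

lemma poly_eval_superset:
  assumes "finite S" "Poly_Mapping.keys f \<subseteq> S"
  shows "poly_eval f v = (\<Sum>t \<in> S. Poly_Mapping.lookup f t * monom_eval t v)"
  unfolding poly_eval_def
  by (rule sum.mono_neutral_left) (use assms in \<open>auto simp: in_keys_iff\<close>)

lemma poly_eval_0 [simp]: "poly_eval 0 v = 0"
  by (simp add: poly_eval_def)

lemma poly_eval_1 [simp]: "poly_eval 1 v = 1"
  by (simp add: poly_eval_def monom_eval_def)

lemma poly_eval_add: "poly_eval (f + g) v = poly_eval f v + poly_eval g v"
proof -
  let ?S = "Poly_Mapping.keys f \<union> Poly_Mapping.keys g"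
  have "poly_eval h v = (\<Sum>t \<in> ?S. Poly_Mapping.lookup h t * monom_eval t v)"
    if "h \<in> {f, g, f + g}" for h
    by (rule poly_eval_superset) (use that Poly_Mapping.keys_add[of f g] in auto)
  then show ?thesis
    by (simp add: lookup_add distrib_right sum.distrib)
qed

lemma poly_eval_sum: "poly_eval (\<Sum>x \<in> S. F x) v = (\<Sum>x \<in> S. poly_eval (F x) v)"
  by (induction S rule: infinite_finite_induct) (simp_all add: poly_eval_add)

lemma poly_eval_single: "poly_eval (Poly_Mapping.single t c) v = c * monom_eval t v"
  by (simp add: poly_eval_superset[of "{t}"])

lemma monom_eval_add: "monom_eval (s + t) v = monom_eval s v * monom_eval t v"
proof -
  let ?S = "Poly_Mapping.keys s \<union> Poly_Mapping.keys t"
  have "monom_eval h v = (\<Prod>i \<in> ?S. v i ^ Poly_Mapping.lookup h i)"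
    if "h \<in> {s, t, s + t}" for h
    unfolding monom_eval_def
    by (rule prod.mono_neutral_left)
       (use that Poly_Mapping.keys_add[of s t] in \<open>auto simp: in_keys_iff\<close>)
  then show ?thesis
    by (simp add: lookup_add power_add prod.distrib)
qed

lemma poly_eq_sum_single:
  "f = (\<Sum>t \<in> Poly_Mapping.keys f. Poly_Mapping.single t (Poly_Mapping.lookup f t))"
proof (rule poly_mapping_eqI)
  fix k
  have "(\<Sum>t \<in> Poly_Mapping.keys f. Poly_Mapping.lookup f t when t = k)
      = (\<Sum>t \<in> Poly_Mapping.keys f. if t = k then Poly_Mapping.lookup f k else 0)"
    by (rule sum.cong) (auto simp: when_def)
  then show "Poly_Mapping.lookup f k = Poly_Mapping.lookup
      (\<Sum>t \<in> Poly_Mapping.keys f. Poly_Mapping.single t (Poly_Mapping.lookup f t)) k"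
    by (simp add: lookup_sum lookup_single in_keys_iff)
qed

lemma poly_eval_mult: "poly_eval (f * g) v = poly_eval f v * poly_eval g v"
proof -
  have "f * g = (\<Sum>s \<in> Poly_Mapping.keys f. Poly_Mapping.single s (Poly_Mapping.lookup f s)) *
      (\<Sum>t \<in> Poly_Mapping.keys g. Poly_Mapping.single t (Poly_Mapping.lookup g t))"
    by (rule arg_cong2[OF poly_eq_sum_single poly_eq_sum_single])
  also have "\<dots> = (\<Sum>s \<in> Poly_Mapping.keys f. \<Sum>t \<in> Poly_Mapping.keys g.
      Poly_Mapping.single (s + t) (Poly_Mapping.lookup f s * Poly_Mapping.lookup g t))"
    by (simp only: sum_product mult_single)
  finally have "poly_eval (f * g) v = (\<Sum>s \<in> Poly_Mapping.keys f. \<Sum>t \<in> Poly_Mapping.keys g.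
      (Poly_Mapping.lookup f s * Poly_Mapping.lookup g t) * (monom_eval s v * monom_eval t v))"
    by (simp only: poly_eval_sum poly_eval_single monom_eval_add)
  then have "poly_eval (f * g) v = (\<Sum>s \<in> Poly_Mapping.keys f. \<Sum>t \<in> Poly_Mapping.keys g.
      (Poly_Mapping.lookup f s * monom_eval s v) * (Poly_Mapping.lookup g t * monom_eval t v))"
    by (simp only: ac_simps)
  then show ?thesis
    by (simp add: poly_eval_def sum_product)
qed

section \<open>Affine space and its Zariski topology\<close>

text \<open>The \<open>\<K>\<close>-points of affine space with coordinates indexed by \<open>A\<close>; as usual for
  \<^const>\<open>PiE\<close>, functions are made unique by being \<^const>\<open>undefined\<close> outside \<open>A\<close>.\<close>

definition affine_space :: "'i set \<Rightarrow> ('i \<Rightarrow> 'k) set"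
  where "affine_space A = (A \<rightarrow>\<^sub>E UNIV)"

definition zero_locus :: "'i set \<Rightarrow> ('i, 'k::comm_ring_1) mpoly set \<Rightarrow> ('i \<Rightarrow> 'k) set"
  where "zero_locus A F = {v \<in> affine_space A. \<forall>f \<in> F. poly_eval f v = 0}"

definition zariski :: "'i set \<Rightarrow> ('i \<Rightarrow> 'k::idom) topology"
  where "zariski A = topology (\<lambda>U. \<exists>F \<subseteq> carrier (poly_ring A). U = affine_space A - zero_locus A F)"

lemma openin_zariski:
  "openin (zariski A :: ('i \<Rightarrow> 'k::idom) topology) U \<longleftrightarrow>
    (\<exists>F \<subseteq> carrier (poly_ring A). U = affine_space A - zero_locus A F)"
proof -
  let ?P = "\<lambda>U :: ('i \<Rightarrow> 'k) set.
    \<exists>F \<subseteq> carrier (poly_ring A). U = affine_space A - zero_locus A F"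
  have "istopology ?P"
    unfolding istopology_def
  proof (intro conjI allI impI)
    fix S T assume "?P S" "?P T"
    then obtain F G where F: "F \<subseteq> carrier (poly_ring A)" "S = affine_space A - zero_locus A F"
      and G: "G \<subseteq> carrier (poly_ring A)" "T = affine_space A - zero_locus A G"
      by blast
    let ?H = "{f * g |f g. f \<in> F \<and> g \<in> G}"
    have "?H \<subseteq> carrier (poly_ring A)"
    proof
      fix h assume "h \<in> ?H"
      then obtain f g where "h = f * g" "f \<in> F" "g \<in> G" by blast
      then show "h \<in> carrier (poly_ring A)"
        using F(1) G(1) poly_vars_mult[of f g] unfolding poly_ring_simps by blast
    qed
    moreover have "S \<inter> T = affine_space A - zero_locus A ?H"
    proof (rule Set.set_eqI)
      fix v
      have "(\<forall>h \<in> ?H. poly_eval h v = 0) \<longleftrightarrow> (\<forall>f \<in> F. \<forall>g \<in> G. poly_eval (f * g) v = 0)"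
        by blast
      also have "\<dots> \<longleftrightarrow> (\<forall>f \<in> F. poly_eval f v = 0) \<or> (\<forall>g \<in> G. poly_eval g v = 0)"
        by (auto simp: poly_eval_mult)
      finally show "v \<in> S \<inter> T \<longleftrightarrow> v \<in> affine_space A - zero_locus A ?H"
        unfolding F(2) G(2) zero_locus_def by blast
    qed
    ultimately show "?P (S \<inter> T)" by blast
  next
    fix \<K> assume "\<forall>K \<in> \<K>. ?P K"
    then obtain F where F: "\<And>K. K \<in> \<K> \<Longrightarrow> F K \<subseteq> carrier (poly_ring A)"
      "\<And>K. K \<in> \<K> \<Longrightarrow> K = affine_space A - zero_locus A (F K)"
      by metis
    have "\<Union>\<K> = (\<Union>K \<in> \<K>. affine_space A - zero_locus A (F K))"
      using F(2) by auto
    also have "\<dots> = affine_space A - zero_locus A (\<Union>K \<in> \<K>. F K)"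
      by (auto simp: zero_locus_def)
    finally show "?P (\<Union>\<K>)"
      using F(1) by (intro exI[of _ "\<Union>K \<in> \<K>. F K"]) blast
  qed
  then show ?thesis
    by (simp add: zariski_def)
qed

lemma topspace_zariski [simp]: "topspace (zariski A :: ('i \<Rightarrow> 'k::idom) topology) = affine_space A"
proof
  show "topspace (zariski A :: ('i \<Rightarrow> 'k) topology) \<subseteq> affine_space A"
    unfolding topspace_def by (auto simp: openin_zariski)
  have "openin (zariski A :: ('i \<Rightarrow> 'k) topology) (affine_space A)"
    unfolding openin_zariski
    by (intro exI[of _ "{1}"]) (auto simp: zero_locus_def)
  then show "affine_space A \<subseteq> topspace (zariski A :: ('i \<Rightarrow> 'k) topology)"
    by (rule openin_subset)
qed

definition zariski_dense_open :: "'i set \<Rightarrow> ('i \<Rightarrow> 'k::idom) set \<Rightarrow> bool"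
  where "zariski_dense_open A U \<longleftrightarrow>
    openin (zariski A) U \<and> zariski A closure_of U = topspace (zariski A)"

section \<open>Projective space and ideals of points\<close>

text \<open>A point of \<open>\<P>\<^sup>N\<close> is the set of all its (nonzero) vectors of homogeneous coordinates
  indexed by \<open>{..N}\<close>.\<close>

definition proj_rel :: "nat \<Rightarrow> ((nat \<Rightarrow> 'k::field) \<times> (nat \<Rightarrow> 'k)) set"
  where "proj_rel N = {(v, w). v \<in> affine_space {..N} \<and> w \<in> affine_space {..N} \<and>
    (\<exists>j\<le>N. v j \<noteq> 0) \<and> (\<exists>c. c \<noteq> 0 \<and> (\<forall>j\<le>N. w j = c * v j))}"

definition proj_space :: "nat \<Rightarrow> (nat \<Rightarrow> 'k::field) set set"
  where "proj_space N = {v \<in> affine_space {..N}. \<exists>j\<le>N. v j \<noteq> 0} // proj_rel N"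

lemma equiv_proj_rel:
  "equiv {v \<in> affine_space {..N}. \<exists>j\<le>N. v j \<noteq> 0} (proj_rel N :: ((nat \<Rightarrow> 'k::field) \<times> _) set)"
proof (rule equivI)
  show "refl_on {v \<in> affine_space {..N}. \<exists>j\<le>N. v j \<noteq> 0} (proj_rel N :: ((nat \<Rightarrow> 'k) \<times> _) set)"
  proof (rule refl_onI)
    fix v :: "nat \<Rightarrow> 'k"
    assume v: "v \<in> {v \<in> affine_space {..N}. \<exists>j\<le>N. v j \<noteq> 0}"
    have "(1 :: 'k) \<noteq> 0 \<and> (\<forall>j\<le>N. v j = 1 * v j)" by simp
    then have "\<exists>c. c \<noteq> 0 \<and> (\<forall>j\<le>N. v j = c * v j)" by blast
    then show "(v, v) \<in> proj_rel N" using v by (simp add: proj_rel_def)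
  qed
  show "proj_rel N \<subseteq> {v \<in> affine_space {..N}. \<exists>j\<le>N. v j \<noteq> 0} \<times>
      {v \<in> affine_space {..N}. \<exists>j\<le>N. v j \<noteq> (0 :: 'k)}"
    by (auto simp: proj_rel_def)
  show "sym (proj_rel N :: ((nat \<Rightarrow> 'k) \<times> _) set)"
  proof (rule symI)
    fix v w :: "nat \<Rightarrow> 'k"
    assume vw: "(v, w) \<in> proj_rel N"
    then obtain c where c: "c \<noteq> 0" "\<forall>j\<le>N. w j = c * v j" by (auto simp: proj_rel_def)
    then have "\<forall>j\<le>N. v j = inverse c * w j" by simp
    then have "\<exists>c. c \<noteq> 0 \<and> (\<forall>j\<le>N. v j = c * w j)" using c(1) nonzero_imp_inverse_nonzero by blast
    then show "(w, v) \<in> proj_rel N" using vw c by (auto simp: proj_rel_def)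
  qed
  show "trans (proj_rel N :: ((nat \<Rightarrow> 'k) \<times> _) set)"
  proof (rule transI)
    fix u v w :: "nat \<Rightarrow> 'k"
    assume uv: "(u, v) \<in> proj_rel N" and vw: "(v, w) \<in> proj_rel N"
    then obtain c d where "c \<noteq> 0" "\<forall>j\<le>N. v j = c * u j" "d \<noteq> 0" "\<forall>j\<le>N. w j = d * v j"
      by (auto simp: proj_rel_def)
    then have "d * c \<noteq> 0 \<and> (\<forall>j\<le>N. w j = (d * c) * u j)" by simp
    then have "\<exists>c. c \<noteq> 0 \<and> (\<forall>j\<le>N. w j = c * u j)" by blast
    then show "(u, w) \<in> proj_rel N" using uv vw by (simp add: proj_rel_def)
  qed
qed

text \<open>\<open>[v\<^sub>0 : \<dots> : v\<^sub>N]\<close>; it is the empty set, hence not in \<^const>\<open>proj_space\<close>, if all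
  \<open>v\<^sub>j\<close> vanish.\<close>

definition proj_point :: "nat \<Rightarrow> (nat \<Rightarrow> 'k::field) \<Rightarrow> (nat \<Rightarrow> 'k) set"
  where "proj_point N v = proj_rel N `` {restrict v {..N}}"

lemma proj_point_in_proj_space_iff:
  "proj_point N v \<in> proj_space N \<longleftrightarrow> (\<exists>j\<le>N. v j \<noteq> 0)"
proof
  assume "\<exists>j\<le>N. v j \<noteq> 0"
  then show "proj_point N v \<in> proj_space N"
    unfolding proj_point_def proj_space_def
    by (intro quotientI) (auto simp: affine_space_def)
next
  assume "proj_point N v \<in> proj_space N"
  then have "proj_point N v \<noteq> {}"
    unfolding proj_space_def using equiv_proj_rel in_quotient_imp_non_empty by blast
  then show "\<exists>j\<le>N. v j \<noteq> 0" by (auto simp: proj_point_def proj_rel_def)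
qed

abbreviation hom_coord_ring :: "nat \<Rightarrow> (nat, 'k::field) mpoly ring"
  where "hom_coord_ring N \<equiv> poly_ring {..N}"

definition point_ideal :: "nat \<Rightarrow> (nat \<Rightarrow> 'k::field) set \<Rightarrow> (nat, 'k) mpoly set"
  where "point_ideal N P = genideal (hom_coord_ring N)
    {f \<in> carrier (hom_coord_ring N). homogeneous f \<and> (\<forall>v \<in> P. poly_eval f v = 0)}"

text \<open>Powers of ideals are taken in the multiplicative monoid \<^const>\<open>ideals_set\<close>.\<close>

definition ideal_power :: "nat \<Rightarrow> (nat, 'k::field) mpoly set \<Rightarrow> nat \<Rightarrow> (nat, 'k) mpoly set"
  where "ideal_power N J m = J [^]\<^bsub>ideals_set (hom_coord_ring N)\<^esub> m"

definition points_ideal :: "nat \<Rightarrow> nat \<Rightarrow> (nat \<Rightarrow> (nat \<Rightarrow> 'k::field) set) \<Rightarrow> (nat, 'k) mpoly set"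
  where "points_ideal N s P = (\<Inter>i<s. point_ideal N (P i))"

definition symbolic_power ::
    "nat \<Rightarrow> nat \<Rightarrow> (nat \<Rightarrow> (nat \<Rightarrow> 'k::field) set) \<Rightarrow> nat \<Rightarrow> (nat, 'k) mpoly set"
  where "symbolic_power N s P m = (\<Inter>i<s. ideal_power N (point_ideal N (P i)) m)"

definition alpha :: "(nat, 'k::zero) mpoly set \<Rightarrow> nat"
  where "alpha J = (LEAST d. \<exists>f \<in> J. f \<noteq> 0 \<and> total_degree f = d)"

section \<open>Very general points\<close>

text \<open>The points \<open>P\<^sub>1, \<dots>, P\<^sub>s\<close> are numbered from \<open>0\<close>, so the parameters
  \<open>\<lambda>\<close> live in the affine space with coordinates indexed by \<open>{..<s} \<times> {..N}\<close>.\<close>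

definition param_point :: "nat \<Rightarrow> (nat \<times> nat \<Rightarrow> 'k::field) \<Rightarrow> nat \<Rightarrow> (nat \<Rightarrow> 'k) set"
  where "param_point N l i = proj_point N (\<lambda>j. l (i, j))"

definition very_general_points ::
    "nat \<Rightarrow> nat \<Rightarrow> ((nat \<Rightarrow> (nat \<Rightarrow> 'k::field) set) \<Rightarrow> bool) \<Rightarrow> bool"
  where "very_general_points N s Q \<longleftrightarrow>
    (\<exists>U :: nat \<Rightarrow> (nat \<times> nat \<Rightarrow> 'k) set.
      (\<forall>k. zariski_dense_open ({..<s} \<times> {..N}) (U k)) \<and>
      (\<forall>l \<in> (\<Inter>k. U k).
        (\<forall>i<s. param_point N l i \<in> proj_space N) \<and>
        inj_on (param_point N l) {..<s} \<and>
        Q (param_point N l)))"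

definition beta :: "nat \<Rightarrow> nat \<Rightarrow> real"
  where "beta N a = (if N \<ge> 4
    then 2 * (real N - 1) * (real a + real N - 1) / ((real N - 2) * real N) + 1
    else 1)"

end

theory Submission
  imports Defs "HOL-Computational_Algebra.Polynomial"
begin

text \<open>Let \<open>e\<close> be least with \<open>s \<le> (e + N) choose N\<close>. General points impose independent conditions on
  forms of degree \<open>e\<close>, so for each point there is a form \<open>F\<^sub>p\<close> of degree \<open>e\<close> that is \<open>1\<close> at this point and
  \<open>0\<close> at the others. Expanding modulo these separators shows that every form of degree at least
  \<open>m (e + 1)\<close> that vanishes to order \<open>m\<close> at all points lies in \<open>I\<^sup>m\<close>. Moreover \<open>e \<le> \<alpha>(I)\<close>. Hence it
  suffices that no nonzero form of degree less than \<open>m (e + 1)\<close> vanishes to order \<open>N m - N + 1\<close> at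
  the points.

  By semicontinuity it is enough to find special points, at most \<open>s\<close> of them, such that a form of degree \<open>d\<close>
  vanishing there to order \<open>t\<close> is zero if \<open>d < c t\<close>, for a sufficiently large \<open>c\<close>. For \<open>N \<ge> 4\<close> a simplicial grid with
  \<open>c = (e - 1 + N) / N\<close> does this. For \<open>N = 2\<close> one uses points on a smooth plane curve germ, all of them
  tending to a point where the germ has high contact with a curve of degree at most \<open>3\<close>, and for
  \<open>N = 3\<close> parallel copies of such a planar configuration. Two points in the plane are treated by hand.\<close>

section \<open>Polynomial functions and orders of vanishing\<close>

text \<open>The size of \<open>c\<close> is dictated by \<open>m = 2\<close>, since for
  \<open>m = 1\<close> both sides are the ideal itself. Degrees below \<open>m (e + 1)\<close> are
  excluded at order \<open>N m - N + 1\<close> for all \<open>m \<ge> 2\<close> as soon as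
  \<open>c = 2 (e + 1) / (N + 1)\<close> is reached. The grid constant
  \<open>(e - 1 + N) / N\<close> is smaller for large \<open>e\<close>. It works once
  \<open>(N - 1) (e + N - 1) < m N (N - 2)\<close>, which is where the linear growth of \<beta> in
  \<alpha>(I) comes from. For \<open>N = 2\<close> the right side is 0, and for \<open>N = 3\<close>
  the value \<beta> = 1 does not let \<open>m\<close> grow with \<open>e\<close>, so both need a
  better configuration. There is little room in the plane: a dimension count limits \<open>c\<close>
  by \<open>sqrt s\<close>, which for the least \<open>s\<close> is about \<open>0.71 e\<close>,
  while \<open>0.67 e\<close> is required. Points on a curve come close to \<open>sqrt s\<close> if
  the degree \<delta> and the contact order \<open>r\<close> are chosen with
  \<open>r / \<delta>\<close> near \<open>sqrt s\<close>; rounding spoils this for a few small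
  \<open>e\<close>, which get their own parameters.\<close>

lemma poly_eqI_fun:
  fixes p q :: "'k::field_char_0 poly"
  assumes "\<And>x. poly p x = poly q x"
  shows "p = q"
  using assms poly_eq_poly_eq_iff[of p q] by blast

lemma poly_eqI_cofinite:
  fixes p q :: "'k::field_char_0 poly"
  assumes "\<And>x. x \<noteq> a \<Longrightarrow> poly p x = poly q x"
  shows "p = q"
proof -
  have "[:-a, 1:] * p = [:-a, 1:] * q"
  proof (rule poly_eqI_fun)
    fix x
    show "poly ([:-a, 1:] * p) x = poly ([:-a, 1:] * q) x"
      using assms[of x] by (cases "x = a") simp_all
  qed
  moreover have "[:-a, 1:] \<noteq> 0" by simp
  ultimately show ?thesis using mult_left_cancel by blast
qed

text \<open>Polynomials are handled as functions because restriction to a hyperplane, translation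
  and passage to an arc are then plain substitutions. In characteristic 0 nothing is lost, as a
  polynomial is determined by its values.\<close>

inductive polyfn :: "((nat \<Rightarrow> 'k::comm_ring_1) \<Rightarrow> 'k) \<Rightarrow> bool" where
  const: "polyfn (\<lambda>v. c)"
| var: "polyfn (\<lambda>v. v i)"
| add: "polyfn f \<Longrightarrow> polyfn g \<Longrightarrow> polyfn (\<lambda>v. f v + g v)"
| mult: "polyfn f \<Longrightarrow> polyfn g \<Longrightarrow> polyfn (\<lambda>v. f v * g v)"

lemma polyfn_diff:
  assumes "polyfn f" "polyfn g"
  shows "polyfn (\<lambda>v. f v - g v)"
proof -
  have "polyfn (\<lambda>v. f v + (-1) * g v)"
    by (intro polyfn.add polyfn.mult polyfn.const assms)
  then show ?thesis by simp
qed

lemma polyfn_power: "polyfn f \<Longrightarrow> polyfn (\<lambda>v. f v ^ n)"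
  by (induction n) (auto intro: polyfn.intros)

lemma polyfn_sum:
  "(\<And>a. a \<in> A \<Longrightarrow> polyfn (f a)) \<Longrightarrow> polyfn (\<lambda>v. \<Sum>a\<in>A. f a v)"
  by (induction A rule: infinite_finite_induct) (auto intro: polyfn.intros)

lemma polyfn_prod:
  "(\<And>a. a \<in> A \<Longrightarrow> polyfn (f a)) \<Longrightarrow> polyfn (\<lambda>v. \<Prod>a\<in>A. f a v)"
  by (induction A rule: infinite_finite_induct) (auto intro: polyfn.intros)

text \<open>In \<open>'k poly poly\<close> the outer variable is the parameter \<open>y\<close> of a
  family of arcs and the inner one is the arc parameter \<open>x\<close>;
  \<open>poly (w i) [:y:]\<close> belongs to the member at \<open>y\<close>.\<close>

lemma polyfn_arc_family:
  fixes w :: "nat \<Rightarrow> 'k::comm_ring_1 poly poly"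
  assumes "polyfn f"
  shows "\<exists>P. \<forall>x y. f (\<lambda>i. poly (poly (w i) [:y:]) x) = poly (poly P [:y:]) x"
  using assms
proof induction
  case (const c)
  show ?case by (rule exI[of _ "[:[:c:]:]"]) simp
next
  case (var i)
  show ?case by (rule exI[of _ "w i"]) simp
next
  case (add f g)
  then obtain P Q where "\<forall>x y. f (\<lambda>i. poly (poly (w i) [:y:]) x) = poly (poly P [:y:]) x"
    "\<forall>x y. g (\<lambda>i. poly (poly (w i) [:y:]) x) = poly (poly Q [:y:]) x" by blast
  then show ?case by (intro exI[of _ "P + Q"]) simp
next
  case (mult f g)
  then obtain P Q where "\<forall>x y. f (\<lambda>i. poly (poly (w i) [:y:]) x) = poly (poly P [:y:]) x"
    "\<forall>x y. g (\<lambda>i. poly (poly (w i) [:y:]) x) = poly (poly Q [:y:]) x" by blast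
  then show ?case by (intro exI[of _ "P * Q"]) simp
qed

lemma polyfn_arc:
  fixes u :: "nat \<Rightarrow> 'k::comm_ring_1 poly"
  assumes "polyfn f"
  shows "\<exists>q. \<forall>x. f (\<lambda>i. poly (u i) x) = poly q x"
proof -
  obtain P where P: "\<And>x y. f (\<lambda>i. poly (poly [:u i:] [:y:]) x) = poly (poly P [:y:]) x"
    using polyfn_arc_family[OF assms, of "\<lambda>i. [:u i:]"] by blast
  have "\<forall>x. f (\<lambda>i. poly (u i) x) = poly (poly P [:0:]) x"
    using P[where y = 0] by (simp only: poly_pCons poly_0 mult_zero_right add_0_right) blast
  then show ?thesis by blast
qed

text \<open>A polynomial with nonzero constant term is a unit among power series.\<close>

lemma monom_dvd_cancel_unit:
  fixes p q :: "'k::field poly"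
  assumes "monom 1 t dvd p * q" "coeff p 0 \<noteq> 0"
  shows "monom 1 t dvd q"
  unfolding monom_1_dvd_iff'
proof (intro allI impI)
  fix k assume "k < t"
  then show "coeff q k = 0"
  proof (induction k rule: less_induct)
    case (less k)
    have "0 = (\<Sum>i\<le>k. coeff p i * coeff q (k - i))"
      using assms(1) less.prems by (simp add: monom_1_dvd_iff' coeff_mult)
    also have "\<dots> = (\<Sum>i\<le>k. if i = 0 then coeff p 0 * coeff q k else 0)"
      by (rule sum.cong) (use less in auto)
    finally show ?case using assms(2) by simp
  qed
qed

text \<open>Order of vanishing, tested on all polynomial arcs through the point.\<close>

definition vanish :: "nat \<Rightarrow> (nat \<Rightarrow> 'k::comm_ring_1) \<Rightarrow> ((nat \<Rightarrow> 'k) \<Rightarrow> 'k) \<Rightarrow> bool"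
  where "vanish t p f \<longleftrightarrow> (\<forall>u. (\<forall>i. poly (u i) 0 = p i) \<longrightarrow>
    (\<exists>q. \<forall>x. f (\<lambda>i. poly (u i) x) = x ^ t * poly q x))"

lemma vanishD:
  assumes "vanish t p f" "\<And>i. poly (u i) 0 = p i"
  obtains q where "\<And>x. f (\<lambda>i. poly (u i) x) = x ^ t * poly q x"
  using assms unfolding vanish_def by blast

lemma vanish_0: "polyfn f \<Longrightarrow> vanish 0 p f"
  unfolding vanish_def using polyfn_arc by fastforce

lemma vanish_zero [simp]: "vanish t p (\<lambda>v. 0)"
  unfolding vanish_def by (metis mult_zero_right poly_0)

lemma vanish_mono:
  assumes "vanish t p f" "s \<le> t"
  shows "vanish s p f"
  unfolding vanish_def
proof (intro allI impI)
  fix u assume "\<forall>i. poly (u i) 0 = p i"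
  then obtain q where q: "\<And>x. f (\<lambda>i. poly (u i) x) = x ^ t * poly q x"
    using vanishD[OF assms(1)] by blast
  have "x ^ t = x ^ s * x ^ (t - s)" for x :: 'a
    using assms(2) by (simp flip: power_add)
  then show "\<exists>q. \<forall>x. f (\<lambda>i. poly (u i) x) = x ^ s * poly q x"
    by (intro exI[of _ "monom 1 (t - s) * q"]) (simp add: q poly_monom)
qed

lemma vanish_add:
  assumes "vanish t p f" "vanish t p g"
  shows "vanish t p (\<lambda>v. f v + g v)"
  unfolding vanish_def
proof (intro allI impI)
  fix u assume u: "\<forall>i. poly (u i) 0 = p i"
  obtain q where q: "\<And>x. f (\<lambda>i. poly (u i) x) = x ^ t * poly q x"
    using vanishD[OF assms(1)] u by blast
  obtain r where r: "\<And>x. g (\<lambda>i. poly (u i) x) = x ^ t * poly r x"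
    using vanishD[OF assms(2)] u by blast
  show "\<exists>q. \<forall>x. f (\<lambda>i. poly (u i) x) + g (\<lambda>i. poly (u i) x) = x ^ t * poly q x"
    by (intro exI[of _ "q + r"]) (simp add: q r algebra_simps)
qed

lemma vanish_mult:
  assumes "vanish s p f" "vanish t p g"
  shows "vanish (s + t) p (\<lambda>v. f v * g v)"
  unfolding vanish_def
proof (intro allI impI)
  fix u assume u: "\<forall>i. poly (u i) 0 = p i"
  obtain q where q: "\<And>x. f (\<lambda>i. poly (u i) x) = x ^ s * poly q x"
    using vanishD[OF assms(1)] u by blast
  obtain r where r: "\<And>x. g (\<lambda>i. poly (u i) x) = x ^ t * poly r x"
    using vanishD[OF assms(2)] u by blast
  show "\<exists>q. \<forall>x. f (\<lambda>i. poly (u i) x) * g (\<lambda>i. poly (u i) x) = x ^ (s + t) * poly q x"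
    by (intro exI[of _ "q * r"]) (simp add: q r algebra_simps power_add)
qed

lemma vanish_mult_left:
  assumes "polyfn g" "vanish t p f"
  shows "vanish t p (\<lambda>v. g v * f v)"
  using vanish_mult[OF vanish_0[OF assms(1)] assms(2)] by simp

lemma vanish_diff:
  assumes "vanish t p f" "vanish t p g"
  shows "vanish t p (\<lambda>v. f v - g v)"
  using vanish_add[OF assms(1) vanish_mult_left[OF polyfn.const[of "-1"] assms(2)]] by simp

lemma vanish_sum:
  "(\<And>a. a \<in> A \<Longrightarrow> vanish t p (f a)) \<Longrightarrow> vanish t p (\<lambda>v. \<Sum>a\<in>A. f a v)"
  by (induction A rule: infinite_finite_induct) (auto intro: vanish_add)

lemma vanish_imp_zero:
  assumes "vanish t p f" "t > 0"
  shows "f p = 0"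
proof -
  obtain q where "\<And>x. f (\<lambda>i. poly [:p i:] x) = x ^ t * poly q x"
    using vanishD[OF assms(1), of "\<lambda>i. [:p i:]"] by auto
  from this[of 0] show ?thesis using assms(2) by (simp add: zero_power)
qed

lemma vanish_1I:
  fixes f :: "(nat \<Rightarrow> 'k::field_char_0) \<Rightarrow> 'k"
  assumes "polyfn f" "f p = 0"
  shows "vanish 1 p f"
  unfolding vanish_def
proof (intro allI impI)
  fix u assume u: "\<forall>i. poly (u i) 0 = p i"
  obtain q where q: "\<And>x. f (\<lambda>i. poly (u i) x) = poly q x"
    using polyfn_arc[OF assms(1)] by blast
  have "poly q 0 = 0" using q[of 0] u assms(2) by simp
  then obtain r where "q = [:-0,1:] * r" unfolding poly_eq_0_iff_dvd by (rule dvdE)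
  then show "\<exists>q. \<forall>x. f (\<lambda>i. poly (u i) x) = x ^ 1 * poly q x"
    using q by auto
qed

lemma vanish_cancel_unit:
  fixes f :: "(nat \<Rightarrow> 'k::field_char_0) \<Rightarrow> 'k"
  assumes "polyfn f" "polyfn g" "g p \<noteq> 0" "vanish t p (\<lambda>v. g v * f v)"
  shows "vanish t p f"
  unfolding vanish_def
proof (intro allI impI)
  fix u assume u: "\<forall>i. poly (u i) 0 = p i"
  obtain q where q: "\<And>x. f (\<lambda>i. poly (u i) x) = poly q x"
    using polyfn_arc[OF assms(1)] by blast
  obtain r where r: "\<And>x. g (\<lambda>i. poly (u i) x) = poly r x"
    using polyfn_arc[OF assms(2)] by blast
  obtain h where h: "\<And>x. g (\<lambda>i. poly (u i) x) * f (\<lambda>i. poly (u i) x) = x ^ t * poly h x"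
    using vanishD[OF assms(4)] u by blast
  have r0: "poly r 0 \<noteq> 0" using r[of 0] u assms(3) by simp
  have eq: "r * q = monom 1 t * h"
    by (rule poly_eqI_fun) (simp add: h flip: q r, simp add: poly_monom)
  have "monom 1 t dvd q"
    by (rule monom_dvd_cancel_unit[of t r]) (use eq r0 in \<open>simp_all add: poly_0_coeff_0\<close>)
  then obtain s where "q = monom 1 t * s" by (rule dvdE)
  then show "\<exists>q. \<forall>x. f (\<lambda>i. poly (u i) x) = x ^ t * poly q x"
    using q by (auto simp: poly_monom)
qed

text \<open>An arc may have higher contact with the hyperplane \<open>v j = c\<close> or lie in it. Almost all members
  of the pencil of arcs obtained by tilting the \<open>j\<close>-th coordinate are transversal to it.\<close>

lemma vanish_cancel_coord:
  fixes f :: "(nat \<Rightarrow> 'k::field_char_0) \<Rightarrow> 'k"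
  assumes f: "polyfn f" and van: "vanish (Suc t) p (\<lambda>v. (v j - c) * f v)" and pj: "p j = c"
  shows "vanish t p f"
  unfolding vanish_def
proof (intro allI impI)
  fix u assume u: "\<forall>i. poly (u i) 0 = p i"
  define w where "w = (\<lambda>i. if i = j then [:u j, [:0, 1:]:] else [:u i:])"
  obtain P where P: "\<And>x y. f (\<lambda>i. poly (poly (w i) [:y:]) x) = poly (poly P [:y:]) x"
    using polyfn_arc_family[OF f, of w] by blast
  have "poly (u j - [:c:]) 0 = 0" using u pj by simp
  then obtain r where r: "u j - [:c:] = [:-0,1:] * r"
    unfolding poly_eq_0_iff_dvd by (rule dvdE)
  have wu: "poly (poly (w i) [:y:]) 0 = p i" for i y
    using u by (simp add: w_def)
  have low: "coeff (poly P [:y:]) k = 0" if k: "k < t" and y: "y \<noteq> - poly r 0" for k y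
  proof -
    obtain h where h: "\<And>x. (poly (poly (w j) [:y:]) x - c) * f (\<lambda>i. poly (poly (w i) [:y:]) x)
        = x ^ Suc t * poly h x"
      using vanishD[OF van, of "\<lambda>i. poly (w i) [:y:]"] wu by blast
    have wj: "poly (poly (w j) [:y:]) x - c = x * poly (r + [:y:]) x" for x
    proof -
      have "poly (u j - [:c:]) x = x * poly r x" unfolding r by simp
      then show ?thesis by (simp add: w_def algebra_simps)
    qed
    have "[:0,1:] * ((r + [:y:]) * poly P [:y:]) = [:0,1:] * (monom 1 t * h)"
    proof (rule poly_eqI_fun)
      fix x
      show "poly ([:0,1:] * ((r + [:y:]) * poly P [:y:])) x = poly ([:0,1:] * (monom 1 t * h)) x"
        using h[of x] unfolding P wj by (simp add: poly_monom algebra_simps)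
    qed
    then have eq: "(r + [:y:]) * poly P [:y:] = monom 1 t * h" by (subst (asm) mult_left_cancel) auto
    have r0: "coeff (r + [:y:]) 0 \<noteq> 0"
      using y by (simp add: poly_0_coeff_0) (metis add_eq_0_iff minus_equation_iff)
    have "monom 1 t dvd poly P [:y:]"
      by (rule monom_dvd_cancel_unit[of t "r + [:y:]"]) (use eq r0 in simp_all)
    then show ?thesis using k by (simp add: monom_1_dvd_iff')
  qed
  \<comment> \<open>Each coefficient of order below \<open>t\<close> is polynomial in the tilt
    \<open>y\<close> and vanishes for all \<open>y\<close> but one, hence also for
    \<open>y = 0\<close>, which is the given arc.\<close>
  have cpoly: "\<exists>q. \<forall>y. coeff (poly P [:y:]) k = poly q y" for k
  proof (induction P)
    case 0
    then show ?case by (intro exI[of _ 0]) simp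
  next
    case (pCons a P)
    then obtain q where q: "\<And>y. coeff (poly P [:y:]) k = poly q y" by blast
    then show ?case
      by (intro exI[of _ "[:coeff a k:] + [:0,1:] * q"]) simp
  qed
  have "coeff (poly P [:0:]) k = 0" if k: "k < t" for k
  proof -
    obtain q where q: "\<And>y. coeff (poly P [:y:]) k = poly q y" using cpoly by blast
    have "q = 0"
      by (rule poly_eqI_cofinite[of "- poly r 0"]) (use low[OF k] q in auto)
    then show ?thesis using q[of 0] by simp
  qed
  then have "monom 1 t dvd poly P [:0:]" by (simp add: monom_1_dvd_iff')
  then obtain s where s: "poly P [:0:] = monom 1 t * s" by (rule dvdE)
  have "f (\<lambda>i. poly (u i) x) = x ^ t * poly s x" for x
  proof -
    have "(\<lambda>i. poly (poly (w i) [:0:]) x) = (\<lambda>i. poly (u i) x)"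
      by (auto simp: w_def)
    then show ?thesis using P[of 0 x] s by (simp add: poly_monom)
  qed
  then show "\<exists>q. \<forall>x. f (\<lambda>i. poly (u i) x) = x ^ t * poly q x" by blast
qed

section \<open>Configurations without forms of low degree\<close>

text \<open>The variables are \<open>v 0, ..., v (N - 1)\<close>. With \<open>Suc N\<close>
  variables the new coordinate is \<open>v N\<close>, so a configuration in dimension
  \<open>N\<close> is placed in the hyperplane \<open>v N = c\<close> by a function update.\<close>

inductive poly_deg_le :: "nat \<Rightarrow> nat \<Rightarrow> ((nat \<Rightarrow> 'k::comm_ring_1) \<Rightarrow> 'k) \<Rightarrow> bool" for N where
  const: "poly_deg_le N d (\<lambda>v. c)"
| add: "poly_deg_le N d f \<Longrightarrow> poly_deg_le N d g \<Longrightarrow> poly_deg_le N d (\<lambda>v. f v + g v)"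
| mult: "i < N \<Longrightarrow> poly_deg_le N d f \<Longrightarrow> poly_deg_le N (Suc d) (\<lambda>v. v i * f v)"

lemma poly_deg_le_polyfn: "poly_deg_le N d f \<Longrightarrow> polyfn f"
  by (induction rule: poly_deg_le.induct) (auto intro: polyfn.intros)

lemma poly_deg_le_mono_N: "poly_deg_le N d f \<Longrightarrow> N \<le> M \<Longrightarrow> poly_deg_le M d f"
  by (induction rule: poly_deg_le.induct) (auto intro: poly_deg_le.intros)

lemma poly_deg_le_Suc: "poly_deg_le N d f \<Longrightarrow> poly_deg_le N (Suc d) f"
  by (induction rule: poly_deg_le.induct) (auto intro: poly_deg_le.intros)

lemma poly_deg_le_mono: "d \<le> e \<Longrightarrow> poly_deg_le N d f \<Longrightarrow> poly_deg_le N e f"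
  by (induction rule: dec_induct) (auto intro: poly_deg_le_Suc)

lemma poly_deg_le_cmult: "poly_deg_le N d f \<Longrightarrow> poly_deg_le N d (\<lambda>v. c * f v)"
proof (induction rule: poly_deg_le.induct)
  case (const d a)
  then show ?case by (rule poly_deg_le.const)
next
  case (add d f g)
  then show ?case using poly_deg_le.add by (fastforce simp: distrib_left)
next
  case (mult i d f)
  then have "poly_deg_le N (Suc d) (\<lambda>v. v i * (c * f v))"
    by (intro poly_deg_le.mult) auto
  then show ?case by (simp add: mult.left_commute)
qed

lemma poly_deg_le_0: "poly_deg_le N 0 f \<Longrightarrow> f v = f w"
  by (induction "0::nat" f rule: poly_deg_le.induct) auto

lemma poly_deg_le_no_vars: "poly_deg_le 0 d f \<Longrightarrow> f v = f w"
  by (induction "d" f rule: poly_deg_le.induct) auto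

lemma poly_deg_le_cong:
  "poly_deg_le N d f \<Longrightarrow> (\<And>i. i < N \<Longrightarrow> v i = w i) \<Longrightarrow> f v = f w"
  by (induction rule: poly_deg_le.induct) metis+

lemma poly_deg_le_translate:
  "poly_deg_le N d f \<Longrightarrow> poly_deg_le N d (\<lambda>v. f (\<lambda>i. v i + a i))"
proof (induction rule: poly_deg_le.induct)
  case (mult i d f)
  have "poly_deg_le N (Suc d) (\<lambda>v. v i * f (\<lambda>i. v i + a i) + a i * f (\<lambda>i. v i + a i))"
    by (intro poly_deg_le.intros(2,3) mult poly_deg_le_cmult poly_deg_le_Suc)
  then show ?case by (simp add: distrib_right)
qed (auto intro: poly_deg_le.intros)

lemma poly_deg_le_subst:
  "poly_deg_le (Suc N) d f \<Longrightarrow> poly_deg_le N d (\<lambda>v. f (v(N := c)))"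
proof (induction "d" f rule: poly_deg_le.induct)
  case (mult i d f)
  show ?case
  proof (cases "i = N")
    case True
    then show ?thesis
      using poly_deg_le_cmult[OF poly_deg_le_Suc[OF mult.IH], of c] by simp
  next
    case False
    then show ?thesis
      using poly_deg_le.mult[of i N, OF _ mult.IH] mult.hyps(1) by simp
  qed
qed (auto intro: poly_deg_le.intros)

text \<open>Division by the linear polynomial \<open>v N - c\<close>. Since \<open>d - 1\<close> is
  truncated, the degree bound alone would admit a constant quotient for \<open>d = 0\<close>; the
  last conjunct excludes it, and the induction relies on this when multiplying by a
  variable.\<close>

lemma poly_deg_le_factor:
  "poly_deg_le (Suc N) d f \<Longrightarrow>
    \<exists>g. (\<forall>v. f v = f (v(N := c)) + (v N - c) * g v) \<and> poly_deg_le (Suc N) (d - 1) g \<and>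
      (d = 0 \<longrightarrow> g = (\<lambda>v. 0))"
proof (induction "d" f rule: poly_deg_le.induct)
  case (const d a)
  show ?case by (intro exI[of _ "\<lambda>v. 0"]) (auto intro: poly_deg_le.const)
next
  case (add d f g)
  obtain f' where f': "\<And>v. f v = f (v(N := c)) + (v N - c) * f' v"
    "poly_deg_le (Suc N) (d - 1) f'" "d = 0 \<longrightarrow> f' = (\<lambda>v. 0)"
    using add.IH(1) by (elim exE conjE) (rule that, erule spec)
  obtain g' where g': "\<And>v. g v = g (v(N := c)) + (v N - c) * g' v"
    "poly_deg_le (Suc N) (d - 1) g'" "d = 0 \<longrightarrow> g' = (\<lambda>v. 0)"
    using add.IH(2) by (elim exE conjE) (rule that, erule spec)
  have eq: "f v + g v = f (v(N := c)) + g (v(N := c)) + (v N - c) * (f' v + g' v)" for v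
    using f'(1)[of v] g'(1)[of v] by (simp add: algebra_simps)
  show ?case
    by (intro exI[of _ "\<lambda>v. f' v + g' v"] conjI allI, rule eq)
      (use poly_deg_le.add[OF f'(2) g'(2)] f'(3) g'(3) in auto)
next
  case (mult i d f)
  obtain g where g: "\<And>v. f v = f (v(N := c)) + (v N - c) * g v"
    "poly_deg_le (Suc N) (d - 1) g" "d = 0 \<longrightarrow> g = (\<lambda>v. 0)"
    using mult.IH by (elim exE conjE) (rule that, erule spec)
  show ?case
  proof (cases "i = N")
    case True
    have "poly_deg_le (Suc N) d g"
      by (rule poly_deg_le_mono[OF _ g(2)]) simp
    then have "poly_deg_le (Suc N) d (\<lambda>v. f v + c * g v)"
      by (intro poly_deg_le.add poly_deg_le_cmult mult.hyps)
    moreover have eq: "v i * f v = (v(N := c)) i * f (v(N := c)) + (v N - c) * (f v + c * g v)" for v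
    proof -
      have A: "f (v(N := c)) = f v - (v N - c) * g v"
        using g(1)[of v] by (simp add: algebra_simps)
      show ?thesis unfolding A using True by (simp add: algebra_simps)
    qed
    ultimately show ?thesis
      by (intro exI[of _ "\<lambda>v. f v + c * g v"] conjI allI, intro eq) simp_all
  next
    case False
    have "poly_deg_le (Suc N) d (\<lambda>v. v i * g v)"
    proof (cases d)
      case 0
      then show ?thesis using g(3) by (simp add: poly_deg_le.const)
    next
      case (Suc d')
      then show ?thesis using poly_deg_le.mult[OF mult.hyps(1) g(2)] by simp
    qed
    moreover have eq: "v i * f v = (v(N := c)) i * f (v(N := c)) + (v N - c) * (v i * g v)" for v
    proof -
      have A: "f (v(N := c)) = f v - (v N - c) * g v"
        using g(1)[of v] by (simp add: algebra_simps)
      show ?thesis unfolding A using False by (simp add: algebra_simps)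
    qed
    ultimately show ?thesis
      by (intro exI[of _ "\<lambda>v. v i * g v"] conjI allI, intro eq) simp_all
  qed
qed

lemma poly_deg_le_divide:
  assumes "poly_deg_le (Suc N) d f" "\<And>v. f (v(N := c)) = 0"
  obtains g where "f = (\<lambda>v. (v N - c) * g v)" "poly_deg_le (Suc N) (d - 1) g"
    "d = 0 \<longrightarrow> f = (\<lambda>v. 0)"
proof -
  obtain g where g: "\<And>v. f v = f (v(N := c)) + (v N - c) * g v"
    "poly_deg_le (Suc N) (d - 1) g" "d = 0 \<longrightarrow> g = (\<lambda>v. 0)"
    using poly_deg_le_factor[OF assms(1), of c] by (elim exE conjE) (rule that, erule spec)
  have f: "f = (\<lambda>v. (v N - c) * g v)"
    using g(1) assms(2) by (metis add_0)
  show thesis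
    by (rule that[OF f g(2)]) (use f g(3) in simp)
qed

lemma vanish_translate:
  assumes "vanish t (\<lambda>i. p i + a i) f"
  shows "vanish t p (\<lambda>v. f (\<lambda>i. v i + a i))"
  unfolding vanish_def
proof (intro allI impI)
  fix u assume "\<forall>i. poly (u i) 0 = p i"
  then show "\<exists>q. \<forall>x. f (\<lambda>i. poly (u i) x + a i) = x ^ t * poly q x"
    using assms[unfolded vanish_def, rule_format, of "\<lambda>i. u i + [:a i:]"] by simp
qed

lemma vanish_subst:
  assumes "vanish t (p(N := c)) f"
  shows "vanish t p (\<lambda>v. f (v(N := c)))"
  unfolding vanish_def
proof (intro allI impI)
  fix u assume "\<forall>i. poly (u i) 0 = p i"
  then have "\<forall>i. poly ((u(N := [:c:])) i) 0 = (p(N := c)) i" by simp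
  moreover have "(\<lambda>i. poly ((u(N := [:c:])) i) x) = (\<lambda>i. poly (u i) x)(N := c)" for x
    by auto
  ultimately show "\<exists>q. \<forall>x. f ((\<lambda>i. poly (u i) x)(N := c)) = x ^ t * poly q x"
    using assms[unfolded vanish_def, rule_format, of "u(N := [:c:])"] by simp
qed

text \<open>The set of points may depend on a bound for the multiplicities. Hence avoiding the zeros
  of finitely many polynomials suffices to choose it, whether or not the field is countable.\<close>

definition forces_zero :: "nat \<Rightarrow> real \<Rightarrow> nat \<Rightarrow> nat \<Rightarrow> (nat \<Rightarrow> nat \<Rightarrow> 'k::field_char_0) \<Rightarrow> bool"
  where "forces_zero N c n T P \<longleftrightarrow> (\<forall>t d f v. t \<le> T \<longrightarrow> real d < c * real t \<longrightarrow>
    poly_deg_le N d f \<longrightarrow> (\<forall>i<n. vanish t (P i) f) \<longrightarrow> f v = 0)"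

text \<open>The infimum of \<open>d / t\<close> over nonzero forms of degree \<open>d\<close>
  vanishing to order \<open>t\<close> at given points is their Waldschmidt constant. The points may
  coincide and indices from \<open>n\<close> on are free, so a configuration of fewer points also
  serves.\<close>

definition waldschmidt_ge :: "'k::field_char_0 itself \<Rightarrow> nat \<Rightarrow> real \<Rightarrow> nat \<Rightarrow> bool"
  where "waldschmidt_ge _ N c n \<longleftrightarrow> (\<forall>T. \<exists>P :: nat \<Rightarrow> nat \<Rightarrow> 'k. forces_zero N c n T P)"

lemmas forces_zeroD = forces_zero_def[THEN iffD1, rule_format]

lemma forces_zeroI:
  "(\<And>t d f v. t \<le> T \<Longrightarrow> real d < c * real t \<Longrightarrow> poly_deg_le N d f \<Longrightarrow>
    \<forall>i<n. vanish t (P i) f \<Longrightarrow> f v = 0) \<Longrightarrow> forces_zero N c n T P"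
  by (simp add: forces_zero_def)

lemma waldschmidt_ge_mono:
  assumes "waldschmidt_ge TYPE('k::field_char_0) N c n" "c' \<le> c" "n \<le> n'"
  shows "waldschmidt_ge TYPE('k) N c' n'"
proof -
  have "real d < c * real t" if "real d < c' * real t" for d t
    using that mult_right_mono[OF assms(2), of "real t"] by linarith
  then have "forces_zero N c' n' T P" if "forces_zero N c n T P" for T and P :: "nat \<Rightarrow> nat \<Rightarrow> 'k"
    using that assms(3) unfolding forces_zero_def by (meson order_less_le_trans)
  then show ?thesis using assms(1) unfolding waldschmidt_ge_def by blast
qed

section \<open>Configurations assembled from hyperplane sections\<close>

lemma waldschmidt_ge_0: "waldschmidt_ge TYPE('k::field_char_0) 0 c 1"
  unfolding waldschmidt_ge_def
proof (intro allI exI, rule forces_zeroI)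
  fix T t d :: nat and f :: "(nat \<Rightarrow> 'k) \<Rightarrow> 'k" and v
  assume "real d < c * real t" "poly_deg_le 0 d f" "\<forall>i<1::nat. vanish t ((\<lambda>_ _. 0) i) f"
  \<comment> \<open>For \<open>t = 0\<close> the degree condition would read \<open>d < 0\<close>.
    From order 1 on a constant is forced to vanish, whatever \<open>c\<close> is.\<close>
  moreover from this have "t > 0" by (cases t) auto
  ultimately show "f v = 0"
    using vanish_imp_zero[of t "\<lambda>_. 0" f] poly_deg_le_no_vars[of d f v "\<lambda>_. 0"] by auto
qed

lemma poly_deg_le_divide_parallel:
  fixes f :: "(nat \<Rightarrow> 'k::field_char_0) \<Rightarrow> 'k"
  assumes "poly_deg_le (Suc N) d f" "\<And>j v. j < k \<Longrightarrow> f (v(N := of_nat j)) = 0"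
    "f \<noteq> (\<lambda>v. 0)"
  shows "k \<le> d \<and> (\<exists>g. f = (\<lambda>v. (\<Prod>j<k. v N - of_nat j) * g v) \<and> poly_deg_le (Suc N) (d - k) g)"
  using assms
proof (induction k)
  case 0
  then show ?case by auto
next
  case (Suc k)
  then obtain g where g: "k \<le> d" "f = (\<lambda>v. (\<Prod>j<k. v N - of_nat j) * g v)"
    "poly_deg_le (Suc N) (d - k) g" by auto
  have gz: "g (v(N := of_nat k)) = 0" for v
    using Suc.prems(2)[of k v] unfolding g(2) by auto
  obtain h where h: "g = (\<lambda>v. (v N - of_nat k) * h v)" "poly_deg_le (Suc N) (d - k - 1) h"
    "d - k = 0 \<longrightarrow> g = (\<lambda>v. 0)"
    by (rule poly_deg_le_divide[OF g(3) gz])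
  have "d - k \<noteq> 0" using h(3) g(2) Suc.prems(3) by auto
  then show ?case
    using g(1) h(2) by (auto intro!: exI[of _ h] simp: g(2) h(1) mult.assoc)
qed

text \<open>The same \<open>n\<close> points are placed in \<open>k\<close> parallel hyperplanes. If
  \<open>d < c' t\<close>, then \<open>d < c t\<close> and the polynomial vanishes on each
  hyperplane, so it is divisible by all \<open>k\<close> equations. This lowers the degree by
  \<open>k\<close> and the order by 1, and \<open>c' \<le> k\<close> preserves the
  inequality.\<close>

lemma waldschmidt_ge_parallel:
  assumes "waldschmidt_ge TYPE('k::field_char_0) N c n" "c' \<le> c" "c' \<le> real k"
  shows "waldschmidt_ge TYPE('k) (Suc N) c' (k * n)"
  unfolding waldschmidt_ge_def
proof
  fix T :: nat
  obtain P :: "nat \<Rightarrow> nat \<Rightarrow> 'k" where "forces_zero N c n T P"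
    using assms(1) unfolding waldschmidt_ge_def by blast
  note P = forces_zeroD[OF this]
  define Q where "Q = (\<lambda>i. (P (i mod n))(N := of_nat (i div n) :: 'k))"
  have Q: "f v = 0" if "t \<le> T" "real d < c' * real t" "poly_deg_le (Suc N) d f"
    "\<forall>i<k * n. vanish t (Q i) f" for t d f v
    using that
  proof (induction t arbitrary: d f v)
    case 0
    then show ?case by simp
  next
    case (Suc t)
    have Qji: "vanish (Suc t) ((P i)(N := of_nat j)) f" if "j < k" "i < n" for i j
    proof -
      have "j * n + i < k * n"
      proof -
        have "j * n + i < Suc j * n" using that by simp
        also have "\<dots> \<le> k * n" using that by (intro mult_right_mono) auto
        finally show ?thesis .
      qed
      then have "vanish (Suc t) (Q (j * n + i)) f" using Suc.prems by blast
      then show ?thesis using that by (simp add: Q_def)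
    qed
    have "f (v(N := of_nat j)) = 0" if "j < k" for j v
    proof (rule P[of "Suc t" d "\<lambda>v. f (v(N := of_nat j))"])
      have "c' * real (Suc t) \<le> c * real (Suc t)"
        using assms(2) by (intro mult_right_mono) auto
      then show "real d < c * real (Suc t)" using Suc.prems by linarith
    qed (use Suc.prems that Qji in \<open>auto intro: poly_deg_le_subst vanish_subst\<close>)
    note restr = this
    show ?case
    proof (rule ccontr)
      assume "f v \<noteq> 0"
      then have "f \<noteq> (\<lambda>v. 0)" by auto
      then obtain g where g: "k \<le> d" "f = (\<lambda>v. (\<Prod>j<k. v N - of_nat j) * g v)"
        "poly_deg_le (Suc N) (d - k) g"
        using poly_deg_le_divide_parallel[OF Suc.prems(3) restr] by blast
      have "g v = 0" for v
      proof (rule Suc.IH[of "d - k" g])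
        show "real (d - k) < c' * real t"
          using g(1) Suc.prems(2) assms(3) by (simp add: of_nat_diff algebra_simps)
        show "\<forall>i<k * n. vanish t (Q i) g"
        proof (intro allI impI)
          fix i assume i: "i < k * n"
          then have n: "0 < n" by (cases n) auto
          have j: "i div n < k" using i by (simp add: less_mult_imp_div_less)
          let ?h = "\<lambda>v. \<Prod>j\<in>{..<k} - {i div n}. v N - of_nat j :: 'k"
          have pg: "polyfn g" "polyfn ?h"
            using poly_deg_le_polyfn[OF g(3)]
            by (auto intro!: polyfn_prod polyfn_diff polyfn.var polyfn.const)
          have "f = (\<lambda>v. (v N - of_nat (i div n)) * (?h v * g v))"
            unfolding g(2) using j by (simp add: prod.remove[of "{..<k}" "i div n"] mult.assoc)
          then have "vanish (Suc t) (Q i) (\<lambda>v. (v N - of_nat (i div n)) * (?h v * g v))"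
            using Suc.prems(4) i by simp
          then have "vanish t (Q i) (\<lambda>v. ?h v * g v)"
            by (rule vanish_cancel_coord[rotated]) (use pg in \<open>auto simp: Q_def intro: polyfn.mult\<close>)
          then show "vanish t (Q i) g"
            by (rule vanish_cancel_unit[OF pg, rotated]) (auto simp: Q_def)
        qed
      qed (use Suc.prems g in auto)
      then show False using \<open>f v \<noteq> 0\<close> g(2) by simp
    qed
  qed
  then show "\<exists>P :: nat \<Rightarrow> nat \<Rightarrow> 'k. forces_zero (Suc N) c' (k * n) T P"
    by (intro exI[of _ Q] forces_zeroI)
qed

lemma translate_off_hyperplane:
  fixes P :: "nat \<Rightarrow> nat \<Rightarrow> 'k::field_char_0"
  obtains b where "\<And>i. i < n \<Longrightarrow> P i N + b \<noteq> 0"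
proof -
  have "finite ((\<lambda>i. - P i N) ` {..<n})" by simp
  then obtain b where b: "b \<notin> (\<lambda>i. - P i N) ` {..<n}"
    using ex_new_if_finite[OF infinite_UNIV_char_0[where 'a = 'k]] by blast
  then have "P i N + b \<noteq> 0" if "i < n" for i
    using that by (auto simp: add_eq_0_iff)
  then show thesis using that by blast
qed

text \<open>There are \<open>n1\<close> points in a hyperplane and \<open>n2\<close> points off it.
  Dividing \<open>j\<close> times by its equation leaves order \<open>t - j\<close> at the former
  and \<open>t\<close> at the latter. Divisions go on until the degree is below \<open>c2 t\<close>,
  where the second configuration applies. Before that \<open>j \<le> (c - c2) t\<close>, and the
  last inequality says that \<open>c t - j \<le> c1 (t - j)\<close> for the largest such
  \<open>j\<close>, so the restriction to the hyperplane is zero; \<open>1 \<le> c1\<close> extends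
  this to smaller \<open>j\<close>.\<close>

lemma waldschmidt_ge_hyperplane:
  assumes 1: "waldschmidt_ge TYPE('k::field_char_0) N c1 n1"
    and 2: "waldschmidt_ge TYPE('k) (Suc N) c2 n2"
    and c: "1 \<le> c1" "c2 \<le> c" "c - c2 \<le> 1" "c2 \<le> (1 - (c - c2)) * c1"
  shows "waldschmidt_ge TYPE('k) (Suc N) c (n1 + n2)"
  unfolding waldschmidt_ge_def
proof
  fix T :: nat
  obtain P1 P2 :: "nat \<Rightarrow> nat \<Rightarrow> 'k" where P: "forces_zero N c1 n1 T P1" "forces_zero (Suc N) c2 n2 T P2"
    using 1 2 unfolding waldschmidt_ge_def by blast
  note P1 = forces_zeroD[OF P(1)] and P2 = forces_zeroD[OF P(2)]
  \<comment> \<open>The second configuration is translated off the hyperplane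
    \<open>v N = 0\<close>, so that cancelling \<open>v N\<close> costs no multiplicity at its
    points.\<close>
  obtain b where b: "\<And>i. i < n2 \<Longrightarrow> P2 i N + b \<noteq> 0"
    by (rule translate_off_hyperplane[of n2 P2 N]) blast
  define a where "a = (\<lambda>i. if i = N then b else 0)"
  define Q1 where "Q1 = (\<lambda>i. (P1 i)(N := 0))"
  define Q2 where "Q2 = (\<lambda>i j. P2 i j + a j)"
  define Q where "Q = (\<lambda>i. if i < n1 then Q1 i else Q2 (i - n1))"
  \<comment> \<open>\<open>d + j\<close> remains the degree before the \<open>j\<close>
    divisions.\<close>
  have key: "f v = 0" if "t \<le> T" "real (d + j) < c * real t" "poly_deg_le (Suc N) d f"
    "\<And>i. i < n1 \<Longrightarrow> vanish (t - j) (Q1 i) f" "\<And>i. i < n2 \<Longrightarrow> vanish t (Q2 i) f" for t d j f v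
    using that
  proof (induction "d" arbitrary: j f v rule: less_induct)
    case (less d)
    show ?case
    proof (cases "real d < c2 * real t")
      case True
      have "f (\<lambda>i. v i + a i) = 0" for v
        by (rule P2[OF less.prems(1) True poly_deg_le_translate[OF less.prems(3)]])
          (use less.prems(5) in \<open>auto simp: Q2_def intro: vanish_translate\<close>)
      from this[of "\<lambda>i. v i - a i"] show ?thesis by simp
    next
      case False
      have tj: "real j \<le> (c - c2) * real t"
        using False less.prems(2) by (simp add: algebra_simps)
      also have "\<dots> \<le> 1 * real t" using c by (intro mult_right_mono) auto
      finally have jt: "j \<le> t" by simp
      have "real d < c1 * real (t - j)"
      proof -
        have "real j * (c1 - 1) \<le> (c - c2) * real t * (c1 - 1)"
          using tj c(1) by (intro mult_right_mono) auto
        moreover have "c2 * real t \<le> (1 - (c - c2)) * c1 * real t"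
          using c by (intro mult_right_mono) auto
        moreover have "c1 * real (t - j) = c1 * real t - c1 * real j"
          using jt by (simp add: of_nat_diff algebra_simps)
        ultimately show ?thesis
          using less.prems(2) by (simp add: algebra_simps)
      qed
      then have fz: "f (v(N := 0)) = 0" for v
        by (rule P1[rotated, of d "t - j" "\<lambda>v. f (v(N := 0))"])
          (use less.prems in \<open>auto intro!: poly_deg_le_subst vanish_subst simp flip: Q1_def[THEN fun_cong]\<close>)
      obtain g where g: "f = (\<lambda>v. (v N - 0) * g v)" "poly_deg_le (Suc N) (d - 1) g"
        "d = 0 \<longrightarrow> f = (\<lambda>v. 0)"
        by (rule poly_deg_le_divide[OF less.prems(3) fz])
      show ?thesis
      proof (cases "d = 0")
        case True
        then show ?thesis using g(3) by simp
      next
        case False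
        have pg: "polyfn g" using g(2) by (rule poly_deg_le_polyfn)
        have "g v = 0"
        proof (rule less.IH[of "d - 1" "Suc j" g])
          show "vanish (t - Suc j) (Q1 i) g" if "i < n1" for i
          proof (cases "t - j")
            case 0
            then show ?thesis using vanish_0[OF pg] by simp
          next
            case (Suc t')
            have "vanish (Suc t') (Q1 i) (\<lambda>v. (v N - 0) * g v)"
              using less.prems(4)[OF that] Suc g(1) by simp
            then have "vanish t' (Q1 i) g"
              by (rule vanish_cancel_coord[OF pg]) (simp add: Q1_def)
            then show ?thesis using Suc by (metis Suc_diff_Suc diff_Suc_1 zero_less_Suc zero_less_diff)
          qed
          show "vanish t (Q2 i) g" if "i < n2" for i
            by (rule vanish_cancel_unit[OF pg, where g = "\<lambda>v. v N - 0"])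
              (use b[OF that] less.prems(5)[OF that] g(1) in
                \<open>auto simp: Q2_def a_def intro!: polyfn_diff polyfn.intros\<close>)
        qed (use less.prems False g(2) in auto)
        then show ?thesis using g(1) by simp
      qed
    qed
  qed
  have Q: "f v = 0" if "t \<le> T" "real d < c * real t" "poly_deg_le (Suc N) d f"
    "\<forall>i<n1 + n2. vanish t (Q i) f" for t d f v
  proof (rule key[of t d 0 f])
    show "vanish (t - 0) (Q1 i) f" if "i < n1" for i
      using that \<open>\<forall>i<n1 + n2. vanish t (Q i) f\<close>[rule_format, of i] by (simp add: Q_def)
    show "vanish t (Q2 i) f" if "i < n2" for i
      using that \<open>\<forall>i<n1 + n2. vanish t (Q i) f\<close>[rule_format, of "n1 + i"] by (simp add: Q_def)
  qed (use that in auto)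
  then show "\<exists>P :: nat \<Rightarrow> nat \<Rightarrow> 'k. forces_zero (Suc N) c (n1 + n2) T P"
    by (intro exI[of _ Q] forces_zeroI)
qed

lemma waldschmidt_ge_point: "waldschmidt_ge TYPE('k::field_char_0) N 1 1"
proof (induction N)
  case 0
  show ?case by (rule waldschmidt_ge_0)
next
  case (Suc N)
  show ?case using waldschmidt_ge_parallel[OF Suc, of 1 1] by simp
qed

text \<open>A simplicial grid of size \<open>D + 1\<close> is a face, a grid of size
  \<open>D + 1\<close> in one dimension less, together with a grid of size \<open>D\<close>; this is
  Pascal's rule for the number of points. The constant grows by \<open>1 / dimension\<close> from
  size to size, and the last hypothesis of \<open>waldschmidt_ge_hyperplane\<close> holds with
  equality.\<close>

lemma waldschmidt_ge_simplex:
  "waldschmidt_ge TYPE('k::field_char_0) (Suc N) (real (D + Suc N) / real (Suc N)) ((D + Suc N) choose Suc N)"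
proof (induction N arbitrary: D)
  case 0
  show ?case
    using waldschmidt_ge_parallel[OF waldschmidt_ge_0[of "real (D + 1)"], of "real (D + 1)" "D + 1"]
    by simp
next
  case (Suc N)
  note outer = Suc
  show ?case
  proof (induction D)
    case 0
    show ?case using waldschmidt_ge_point[of "Suc (Suc N)"] by simp
  next
    case (Suc D)
    have "waldschmidt_ge TYPE('k) (Suc (Suc N)) (real (Suc D + Suc (Suc N)) / real (Suc (Suc N)))
        (((Suc D + Suc N) choose Suc N) + ((D + Suc (Suc N)) choose Suc (Suc N)))"
    proof (rule waldschmidt_ge_hyperplane[OF outer[of "Suc D"] Suc])
have "real (Suc D + Suc (Suc N)) / real (Suc (Suc N)) - real (D + Suc (Suc N)) / real (Suc (Suc N))
          = 1 / real (Suc (Suc N))"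
        by (simp flip: diff_divide_distrib)
      then show "real (D + Suc (Suc N)) / real (Suc (Suc N))
          \<le> (1 - (real (Suc D + Suc (Suc N)) / real (Suc (Suc N)) - real (D + Suc (Suc N)) / real (Suc (Suc N))))
            * (real (Suc D + Suc N) / real (Suc N))"
        by (simp add: divide_simps)
    qed (auto simp: field_simps)
    moreover have "((Suc D + Suc N) choose Suc N) + ((D + Suc (Suc N)) choose Suc (Suc N))
        = (Suc D + Suc (Suc N)) choose Suc (Suc N)"
      by (simp add: add.commute)
    ultimately show ?case by simp
  qed
qed

text \<open>A polynomial of degree at most \<open>e + 1\<close> consists of its restriction to a
  hyperplane and a quotient of degree at most \<open>e\<close>, again along Pascal's rule.
  Uniqueness will bound \<alpha>(I) from below, solvability will provide the separators.\<close>

lemma unisolvent_points: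
  "\<exists>P :: nat \<Rightarrow> nat \<Rightarrow> 'k::field_char_0.
    (\<forall>f. poly_deg_le N e f \<longrightarrow> (\<forall>i<(e + N) choose N. f (P i) = 0) \<longrightarrow> (\<forall>v. f v = 0)) \<and>
    (\<forall>y. \<exists>f. poly_deg_le N e f \<and> (\<forall>i<(e + N) choose N. f (P i) = y i))"
proof -
  have single: "\<exists>P :: nat \<Rightarrow> nat \<Rightarrow> 'k. (\<forall>f. poly_deg_le N e f \<longrightarrow> (\<forall>i<1::nat. f (P i) = 0) \<longrightarrow> (\<forall>v. f v = 0)) \<and>
      (\<forall>y. \<exists>f. poly_deg_le N e f \<and> (\<forall>i<1. f (P i) = y i))" if "N = 0 \<or> e = 0" for N e
  proof (intro exI[of _ "\<lambda>_ _. 0"] conjI allI impI)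
    fix f :: "(nat \<Rightarrow> 'k) \<Rightarrow> 'k" and v assume "poly_deg_le N e f" "\<forall>i<1::nat. f (\<lambda>_. 0) = 0"
    then show "f v = 0"
      using that poly_deg_le_no_vars[of e f v "\<lambda>_. 0"] poly_deg_le_0[of N f v "\<lambda>_. 0"] by auto
  next
    fix y :: "nat \<Rightarrow> 'k"
    show "\<exists>f. poly_deg_le N e f \<and> (\<forall>i<1. f (\<lambda>_. 0) = y i)"
      by (intro exI[of _ "\<lambda>v. y 0"]) (auto intro: poly_deg_le.const)
  qed
  show ?thesis
  proof (induction N arbitrary: e)
    case 0
    show ?case using single[of 0 e] by simp
  next
    case (Suc N)
    note outer = Suc
    show ?case
    proof (induction e)
      case 0
      show ?case using single[of "Suc N" 0] by simp
    next
      case (Suc e)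
      define n1 where "n1 = (Suc e + N) choose N"
      define n2 where "n2 = (e + Suc N) choose Suc N"
      obtain P1 :: "nat \<Rightarrow> nat \<Rightarrow> 'k" where
        P1: "\<And>f v. poly_deg_le N (Suc e) f \<Longrightarrow> \<forall>i<n1. f (P1 i) = 0 \<Longrightarrow> f v = 0"
        "\<And>y. \<exists>f. poly_deg_le N (Suc e) f \<and> (\<forall>i<n1. f (P1 i) = y i)"
        using outer[of "Suc e"] unfolding n1_def by blast
      obtain P2 :: "nat \<Rightarrow> nat \<Rightarrow> 'k" where
        P2: "\<And>f v. poly_deg_le (Suc N) e f \<Longrightarrow> \<forall>i<n2. f (P2 i) = 0 \<Longrightarrow> f v = 0"
        "\<And>y. \<exists>f. poly_deg_le (Suc N) e f \<and> (\<forall>i<n2. f (P2 i) = y i)"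
        using Suc unfolding n2_def by blast
      obtain b where b: "\<And>i. i < n2 \<Longrightarrow> P2 i N + b \<noteq> 0"
        by (rule translate_off_hyperplane[of n2 P2 N]) blast
      define a where "a = (\<lambda>i. if i = N then b else 0)"
      define Q where "Q = (\<lambda>i. if i < n1 then (P1 i)(N := 0) else (\<lambda>j. P2 (i - n1) j + a j))"
      have "f v = 0" if f: "poly_deg_le (Suc N) (Suc e) f" "\<forall>i<n1 + n2. f (Q i) = 0" for f v
      proof -
        have fq: "f ((P1 i)(N := 0)) = 0" if "i < n1" for i
          using f(2)[rule_format, of i] that by (simp add: Q_def)
        have fz: "f (v(N := 0)) = 0" for v
          by (rule P1(1)[of "\<lambda>v. f (v(N := 0))"]) (use f fq in \<open>auto intro: poly_deg_le_subst\<close>)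
        obtain g where g: "f = (\<lambda>v. (v N - 0) * g v)" "poly_deg_le (Suc N) (Suc e - 1) g"
          by (rule poly_deg_le_divide[OF f(1) fz])
        have "g (\<lambda>j. P2 i j + a j) = 0" if "i < n2" for i
          using f(2)[rule_format, of "n1 + i"] b[OF that] that by (simp add: Q_def g(1) a_def)
        then have "g (\<lambda>i. v i + a i) = 0" for v
          using P2(1)[of "\<lambda>v. g (\<lambda>i. v i + a i)"] g(2) by (simp add: poly_deg_le_translate)
        from this[of "\<lambda>i. v i - a i"] show ?thesis using g(1) by simp
      qed
      moreover have "\<exists>f. poly_deg_le (Suc N) (Suc e) f \<and> (\<forall>i<n1 + n2. f (Q i) = y i)" for y
      proof -
        obtain f where f: "poly_deg_le N (Suc e) f" "\<forall>i<n1. f (P1 i) = y i" using P1(2) by blast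
        obtain g where g: "poly_deg_le (Suc N) e g"
          "\<forall>i<n2. g (P2 i) = (y (n1 + i) - f (Q (n1 + i))) / (P2 i N + b)"
          using P2(2)[of "\<lambda>i. (y (n1 + i) - f (Q (n1 + i))) / (P2 i N + b)"] by blast
        have "poly_deg_le (Suc N) (Suc e) (\<lambda>v. f v + v N * g (\<lambda>i. v i + (- a i)))"
          using poly_deg_le_mono_N[OF f(1), of "Suc N"] poly_deg_le_translate[OF g(1), of "\<lambda>i. - a i"]
          by (intro poly_deg_le.intros) auto
        moreover have "f (Q i) + Q i N * g (\<lambda>j. Q i j + (- a j)) = y i" if i: "i < n1 + n2" for i
        proof (cases "i < n1")
          case True
          then have "f ((P1 i)(N := 0)) = f (P1 i)"
            by (intro poly_deg_le_cong[OF f(1)]) auto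
          then show ?thesis using True f(2) by (simp add: Q_def)
        next
          case False
          then have "i - n1 < n2" "n1 + (i - n1) = i" using i by auto
          then show ?thesis
            using False g(2)[rule_format, of "i - n1"] b[of "i - n1"] by (simp add: Q_def a_def)
        qed
        ultimately show ?thesis by blast
      qed
      moreover have "(Suc e + Suc N) choose Suc N = n1 + n2" by (simp add: n1_def n2_def)
      ultimately show ?case by (intro exI[of _ Q]) auto
    qed
  qed
qed

text \<open>Semicontinuity of rank by fraction-free Gaussian elimination: \<open>D\<close> is a
  product of pivots, nonzero at \<open>l0\<close>. The equations are indexed by an arbitrary type
  because vanishing is tested on infinitely many arcs, and \<open>Pol\<close> is abstract to cover
  polynomials in one parameter as well as in all coordinates of the points.\<close>

lemma generic_injectivity:
  fixes A :: "'c \<Rightarrow> 'b \<Rightarrow> 'l \<Rightarrow> 'k::field" and Pol :: "('l \<Rightarrow> 'k) set"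
  assumes "finite B"
    and "(\<lambda>l. 1) \<in> Pol"
    and mult: "\<And>f g. f \<in> Pol \<Longrightarrow> g \<in> Pol \<Longrightarrow> (\<lambda>l. f l * g l) \<in> Pol"
    and diff: "\<And>f g. f \<in> Pol \<Longrightarrow> g \<in> Pol \<Longrightarrow> (\<lambda>l. f l - g l) \<in> Pol"
    and "\<And>c b. b \<in> B \<Longrightarrow> A c b \<in> Pol"
    and "\<And>x. (\<And>c. (\<Sum>b\<in>B. A c b l0 * x b) = 0) \<Longrightarrow> \<forall>b\<in>B. x b = 0"
  shows "\<exists>D\<in>Pol. D l0 \<noteq> 0 \<and> (\<forall>l x. D l \<noteq> 0 \<longrightarrow> (\<forall>c. (\<Sum>b\<in>B. A c b l * x b) = 0) \<longrightarrow> (\<forall>b\<in>B. x b = 0))"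
  using assms(1,5,6)
proof (induction B arbitrary: A rule: finite_induct)
  case empty
  then show ?case using assms(2) by (intro bexI[of _ "\<lambda>l. 1"]) auto
next
  case (insert b0 B)
  have "\<exists>c. A c b0 l0 \<noteq> 0"
  proof (rule ccontr)
    assume "\<not> ?thesis"
    then have "(\<Sum>b\<in>insert b0 B. A c b l0 * (if b = b0 then 1 else 0)) = 0" for c
      using insert.hyps by (intro sum.neutral) auto
    from insert.prems(2)[OF this] show False by auto
  qed
  then obtain c0 where c0: "A c0 b0 l0 \<noteq> 0" ..
  \<comment> \<open>Elimination of the unknown \<open>b0\<close> by the pivot row \<open>c0\<close>,
    cross-multiplied so as to stay in \<open>Pol\<close>.\<close>
  define A' where "A' = (\<lambda>c b l. A c0 b0 l * A c b l - A c b0 l * A c0 b l)"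
  have A'_sum: "(\<Sum>b\<in>B. A' c b l * x b)
      = A c0 b0 l * (\<Sum>b\<in>B. A c b l * x b) - A c b0 l * (\<Sum>b\<in>B. A c0 b l * x b)" for c l x
    by (simp add: A'_def left_diff_distrib sum_subtractf sum_distrib_left mult.assoc)
  have "\<exists>D\<in>Pol. D l0 \<noteq> 0 \<and> (\<forall>l x. D l \<noteq> 0 \<longrightarrow> (\<forall>c. (\<Sum>b\<in>B. A' c b l * x b) = 0) \<longrightarrow> (\<forall>b\<in>B. x b = 0))"
  proof (rule insert.IH)
    show "A' c b \<in> Pol" if "b \<in> B" for c b
      unfolding A'_def using that insert.prems(1) by (intro diff mult) auto
    fix x assume x: "\<And>c. (\<Sum>b\<in>B. A' c b l0 * x b) = 0"
    define y where "y = (\<lambda>b. if b = b0 then - (\<Sum>b\<in>B. A c0 b l0 * x b) / A c0 b0 l0 else x b)"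
    have "(\<Sum>b\<in>B. A c b l0 * y b) = (\<Sum>b\<in>B. A c b l0 * x b)" for c
      by (rule sum.cong) (use insert.hyps in \<open>auto simp: y_def\<close>)
    then have "(\<Sum>b\<in>insert b0 B. A c b l0 * y b) = (\<Sum>b\<in>B. A' c b l0 * x b) / A c0 b0 l0" for c
      unfolding A'_sum using insert.hyps c0 by (simp add: y_def divide_simps)
    then have "\<forall>b\<in>insert b0 B. y b = 0" using x by (intro insert.prems(2)) simp
    then show "\<forall>b\<in>B. x b = 0" using insert.hyps by (auto simp: y_def split: if_splits)
  qed
  then obtain D where D: "D \<in> Pol" "D l0 \<noteq> 0"
    "\<And>l x. D l \<noteq> 0 \<Longrightarrow> (\<forall>c. (\<Sum>b\<in>B. A' c b l * x b) = 0) \<Longrightarrow> (\<forall>b\<in>B. x b = 0)" by blast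
  show ?case
  proof (intro bexI[of _ "\<lambda>l. A c0 b0 l * D l"] conjI allI impI)
    show "A c0 b0 l0 * D l0 \<noteq> 0" using c0 D by simp
    show "(\<lambda>l. A c0 b0 l * D l) \<in> Pol" using D insert.prems(1) by (intro mult) auto
    fix l x assume l: "A c0 b0 l * D l \<noteq> 0" and x: "\<forall>c. (\<Sum>b\<in>insert b0 B. A c b l * x b) = 0"
    have x': "(\<Sum>b\<in>B. A c b l * x b) = - A c b0 l * x b0" for c
      using x[rule_format, of c] insert.hyps by (simp add: add_eq_0_iff)
    have "\<forall>c. (\<Sum>b\<in>B. A' c b l * x b) = 0"
      unfolding A'_sum x' by simp
    then have B: "\<forall>b\<in>B. x b = 0" using D(3) l by auto
    then have "A c0 b0 l * x b0 = 0"
      using x'[of c0] by simp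
    then show "\<forall>b\<in>insert b0 B. x b = 0" using B l by auto
  qed
qed

section \<open>Points on a plane curve\<close>

text \<open>Bivariate polynomials are polynomials in \<open>y\<close> over \<open>K[x]\<close>.\<close>

definition total_deg_le :: "'k::zero poly poly \<Rightarrow> nat \<Rightarrow> bool"
  where "total_deg_le F D \<longleftrightarrow> (\<forall>a b. D < a + b \<longrightarrow> coeff (coeff F b) a = 0)"

text \<open>The monomial valuation with weights \<open>1\<close> and \<open>n\<close> is at least \<open>V\<close>.\<close>

definition weight_ge :: "nat \<Rightarrow> nat \<Rightarrow> 'k::comm_semiring_1 poly poly \<Rightarrow> bool"
  where "weight_ge n V G \<longleftrightarrow> (\<forall>b. monom 1 (V - n * b) dvd coeff G b)"

lemma coeff_linear_mult:
  "coeff ([:p, 1:] * G) b = p * coeff G b + (if b = 0 then 0 else coeff G (b - 1))"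
  for p :: "'a::comm_ring_1"
  by (cases b) (simp_all add: algebra_simps)

text \<open>On \<open>y = x^\<delta>\<close> the monomial \<open>x^a y^b\<close> has degree
  \<open>a + \<delta> b \<le> \<delta> (a + b)\<close>.\<close>

lemma curve_degree:
  fixes F :: "'k::idom poly poly"
  assumes "total_deg_le F D" "1 \<le> \<delta>" "\<delta> * D < a"
  shows "coeff (poly F (monom 1 \<delta>)) a = 0"
proof -
  have "coeff (coeff F b * monom 1 (\<delta> * b)) a = 0" for b
  proof (cases "a < \<delta> * b")
    case True
    then show ?thesis by (simp add: coeff_monom_mult mult.commute[of _ "monom _ _"])
  next
    case False
    have "D < a - \<delta> * b + b"
    proof (cases "b \<le> D")
      case True
      have "\<delta> * b + (D - b) \<le> \<delta> * b + \<delta> * (D - b)"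
        using assms(2) by simp
      also have "\<dots> = \<delta> * D" using True by (simp flip: distrib_left)
      finally show ?thesis using assms(3) False True by linarith
    qed auto
    then show ?thesis
      using assms(1) False
      by (simp add: total_deg_le_def coeff_monom_mult mult.commute[of _ "monom _ _"])
  qed
  then show ?thesis
    by (simp add: poly_altdef coeff_sum monom_power)
qed

text \<open>On \<open>y = - x^r\<close> the monomial \<open>x^a y^b\<close> becomes
  \<open>x^(a + r b)\<close> up to sign, and \<open>n (a + r b) \<ge> r (a + n b)\<close> because
  \<open>r \<le> n\<close>. So the order at the origin is at least \<open>r V / n\<close>.\<close>

lemma curve_order:
  fixes G :: "'k::idom poly poly"
  assumes "weight_ge n V G" "r \<le> n" "n * a < r * V"
  shows "coeff (poly G (- monom 1 r)) a = 0"
proof -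
  have "coeff (coeff G b * (- monom 1 r) ^ b) a = 0" for b
  proof -
    have "r * V \<le> n * ((V - n * b) + r * b)"
    proof (cases "n * b \<le> V")
      case True
      then obtain w where w: "V = n * b + w" using le_Suc_ex by blast
      have "r * w \<le> n * w" using assms(2) by simp
      then show ?thesis by (simp add: w algebra_simps)
    next
      case False
      then have "r * V \<le> r * (n * b)" by simp
      then show ?thesis using False by (simp add: algebra_simps)
    qed
    then have "n * a < n * ((V - n * b) + r * b)" using assms(3) by linarith
    then have a: "a < (V - n * b) + r * b" by simp
    have "monom 1 (V - n * b) * monom 1 r ^ b dvd coeff G b * monom 1 r ^ b"
      using assms(1) by (intro mult_dvd_mono) (auto simp: weight_ge_def)
    then have "monom 1 (V - n * b + r * b) dvd coeff G b * monom 1 r ^ b"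
      by (simp add: monom_power mult_monom)
    then have "coeff (coeff G b * monom 1 r ^ b) a = 0"
      using a by (simp only: monom_1_dvd_iff')
    moreover have "(- monom 1 r) ^ b = (-1) ^ b * (monom 1 r ^ b :: 'k poly)"
      by (rule power_minus)
    moreover have "(-1) ^ b = (1 :: 'k poly) \<or> (-1) ^ b = (-1 :: 'k poly)"
      by (cases "even b") auto
    ultimately show ?thesis by auto
  qed
  then show ?thesis by (simp add: poly_altdef coeff_sum)
qed

text \<open>The curve \<open>y = x\<^sup>\<delta>\<close> meets \<open>y = x\<^sup>\<delta> + x\<^sup>r\<close> to order \<open>r\<close> at the origin. By Bezout it
  divides any polynomial of small degree, and its equation has weight exactly \<open>r\<close>, so that
  degree and weight decrease at a fixed rate.\<close>

lemma weight_ge_imp_zero: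
  fixes F :: "'k::field poly poly"
  assumes "1 \<le> \<delta>" "1 \<le> n" "r \<le> n" "real (\<delta> * n) * \<kappa> \<le> real r" "real r * \<kappa> \<le> real \<delta>"
    and "total_deg_le F D" "weight_ge n V (pcompose F [:monom 1 \<delta> + monom 1 r, 1:])"
    and "real D < \<kappa> * real V"
  shows "F = 0"
  using assms(6-8)
proof (induction D arbitrary: F V rule: less_induct)
  case (less D)
  define h where "h = (monom 1 \<delta> + monom 1 r :: 'k poly)"
  define c where "c = (monom 1 \<delta> :: 'k poly)"
  have \<kappa>: "0 < \<kappa>" using less.prems(3)
    by (smt (verit) mult_nonpos_nonneg of_nat_0_le_iff)
  \<comment> \<open>The hypothesis \<open>\<delta> n \<kappa> \<le> r\<close> makes the degree bound
    \<open>\<delta> D\<close> on the curve smaller than the order bound \<open>r V / n\<close> at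
    the origin.\<close>
  have "real (\<delta> * n) * real D < real (\<delta> * n) * (\<kappa> * real V)"
    using less.prems(3) assms(1,2) by (intro mult_strict_left_mono) auto
  also have "\<dots> = (real (\<delta> * n) * \<kappa>) * real V" by simp
  also have "\<dots> \<le> real r * real V" using assms(4) by (intro mult_right_mono) auto
  finally have "real (\<delta> * n * D) < real (r * V)" by simp
  then have V: "n * (\<delta> * D) < r * V"
    by (simp only: of_nat_less_iff ac_simps)
  have "coeff (poly F c) a = 0" for a
  proof (cases "\<delta> * D < a")
    case True
    then show ?thesis using curve_degree[OF less.prems(1) assms(1)] by (simp add: c_def)
  next
    case False
    then have "n * a < r * V"
      using V by (meson le_less_trans mult_le_mono2 not_less)
    moreover have "poly F c = poly (pcompose F [:h, 1:]) (- monom 1 r)"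
      by (simp add: poly_pcompose h_def c_def)
    ultimately show ?thesis
      using curve_order[OF less.prems(2) assms(3)] by (simp add: h_def)
  qed
  then have "poly F c = 0" by (simp add: poly_eq_iff)
  then obtain F' where F': "F = [:- c, 1:] * F'"
    unfolding poly_eq_0_iff_dvd by (rule dvdE)
  have deg: "\<forall>a. D < a + b + \<delta> \<longrightarrow> coeff (coeff F' b) a = 0" for b
  proof (induction b)
    case 0
    show ?case
    proof (intro allI impI)
      fix a assume "D < a + 0 + \<delta>"
      then have "coeff (coeff F 0) (a + \<delta>) = 0"
        using less.prems(1) by (simp add: total_deg_le_def)
      then show "coeff (coeff F' 0) a = 0"
        by (simp add: F' c_def coeff_monom_mult)
    qed
  next
    case (Suc b)
    show ?case
    proof (intro allI impI)
      fix a assume a: "D < a + Suc b + \<delta>"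
      then have "coeff (coeff F (Suc b)) (a + \<delta>) = 0"
        using less.prems(1) by (simp add: total_deg_le_def)
      moreover have "coeff (coeff F' b) (a + \<delta>) = 0"
        using Suc a assms(1) by simp
      ultimately show "coeff (coeff F' (Suc b)) a = 0"
        by (simp add: F' c_def coeff_monom_mult)
    qed
  qed
  show "F = 0"
  proof (cases "D < \<delta>")
    case True
    then have "coeff (coeff F' b) a = 0" for a b using deg[of b] by simp
    then have "F' = 0" by (simp add: poly_eq_iff)
    then show ?thesis by (simp add: F')
  next
    case False
    define G where "G = pcompose F' [:h, 1:]"
    \<comment> \<open>In the coordinate \<open>y - h\<close> the equation of the curve is
      \<open>y + x^r\<close>, of weight \<open>r\<close> because \<open>r \<le> n\<close>. Dividing
      by it costs degree \<delta> and weight \<open>r\<close>, and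
      \<open>r \<kappa> \<le> \<delta>\<close> preserves \<open>D < \<kappa> V\<close>.\<close>
    have "pcompose [:- c, 1:] [:h, 1:] = [:monom 1 r, 1:]"
      by (simp add: pcompose_pCons h_def c_def)
    then have FG: "pcompose F [:h, 1:] = [:monom 1 r, 1:] * G"
      by (simp only: F' G_def pcompose_mult)
    have w: "monom 1 (V - n * b) dvd monom 1 r * coeff G b + (if b = 0 then 0 else coeff G (b - 1))" for b
      using less.prems(2) unfolding weight_ge_def h_def[symmetric] FG coeff_linear_mult by blast
    have "monom 1 (V - r - n * b) dvd coeff G b" for b
    proof (induction b)
      case 0
      have "\<forall>k<V. coeff (monom 1 r * coeff G 0) k = 0"
        using w[of 0] by (simp add: monom_1_dvd_iff')
      then have "coeff (coeff G 0) k = 0" if "k < V - r" for k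
        using that by (auto simp: coeff_monom_mult dest: spec[of _ "k + r"])
      then show ?case by (simp add: monom_1_dvd_iff')
    next
      case (Suc b)
      have *: "coeff (monom 1 r * coeff G (Suc b) + coeff G b) k = 0" if "k < V - n * Suc b" for k
        using w[of "Suc b"] that by (simp add: monom_1_dvd_iff')
      have "coeff (coeff G (Suc b)) k = 0" if "k < V - r - n * Suc b" for k
      proof -
        have "k + r < V - n * Suc b" using that by simp
        moreover have "k + r < V - r - n * b" using that assms(3) by simp
        then have "coeff (coeff G b) (k + r) = 0" using Suc by (simp add: monom_1_dvd_iff')
        ultimately show ?thesis using *[of "k + r"] by (simp add: coeff_monom_mult)
      qed
      then show ?case by (simp only: monom_1_dvd_iff') simp
    qed
    then have "weight_ge n (V - r) (pcompose F' [:monom 1 \<delta> + monom 1 r, 1:])"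
      by (simp add: weight_ge_def G_def h_def)
    moreover have "total_deg_le F' (D - \<delta>)"
      using deg False by (auto simp: total_deg_le_def)
    moreover have "real (D - \<delta>) < \<kappa> * real (V - r)"
    proof -
      have "real (D - \<delta>) = real D - real \<delta>" using False by (simp add: of_nat_diff)
      also have "\<dots> < \<kappa> * (real V - real r)"
        using less.prems(3) assms(5) by (simp add: algebra_simps)
      also have "\<dots> \<le> \<kappa> * real (V - r)" using \<kappa> by (intro mult_left_mono) auto
      finally show ?thesis .
    qed
    moreover have "D - \<delta> < D" using False assms(1) by simp
    ultimately have "F' = 0" using less.IH by blast
    then show ?thesis by (simp add: F')
  qed
qed

lemma poly_deg_le_2:
  assumes "poly_deg_le 2 d f"
  shows "\<exists>F. total_deg_le F d \<and> (\<forall>v. f v = poly (poly F [:v 1:]) (v 0))"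
  using assms
proof (induction "d" f rule: poly_deg_le.induct)
  case (const d c)
  have "total_deg_le [:[:c:]:] d"
    by (auto simp: total_deg_le_def coeff_pCons split: nat.splits)
  then show ?case by (intro exI[of _ "[:[:c:]:]"]) simp
next
  case (add d f g)
  then obtain F G where "total_deg_le F d" "\<forall>v. f v = poly (poly F [:v 1:]) (v 0)"
    "total_deg_le G d" "\<forall>v. g v = poly (poly G [:v 1:]) (v 0)" by blast
  then show ?case by (intro exI[of _ "F + G"]) (simp add: total_deg_le_def)
next
  case (mult i d f)
  then obtain F where F: "total_deg_le F d" "\<forall>v. f v = poly (poly F [:v 1:]) (v 0)" by blast
  consider "i = 0" | "i = 1" using mult.hyps(1) by linarith
  then show ?case
  proof cases
    case 1
    have "total_deg_le (smult [:0, 1:] F) (Suc d)"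
      using F(1) by (auto simp: total_deg_le_def coeff_pCons split: nat.splits)
    then show ?thesis using F(2) 1 by (intro exI[of _ "smult [:0, 1:] F"]) simp
  next
    case 2
    have "total_deg_le (pCons 0 F) (Suc d)"
      using F(1) by (auto simp: total_deg_le_def coeff_pCons split: nat.splits)
    then show ?thesis using F(2) 2 by (intro exI[of _ "pCons 0 F"]) simp
  qed
qed

lemma poly_poly_const: "poly (poly F q) z = poly (poly F [:poly q z:]) z"
  for F :: "'a::comm_semiring_0 poly poly"
  by (induction F) simp_all

text \<open>In the local coordinates \<open>x - p 0\<close> and \<open>y - h(x)\<close>, order
  \<open>t\<close> means that the coefficient of the \<open>b\<close>-th power of the second is
  divisible by the \<open>(t - b)\<close>-th power of the first. Straight lines of all slopes in
  these coordinates reveal this: each low coefficient along them is a polynomial in the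
  slope.\<close>

lemma vanish_on_curve:
  fixes F :: "'k::field_char_0 poly poly"
  assumes "vanish t p (\<lambda>v. poly (poly F [:v 1:]) (v 0))" "p 1 = poly h (p 0)"
  shows "[:- p 0, 1:] ^ (t - b) dvd coeff (pcompose F [:h, 1:]) b"
proof -
  define a where "a = p 0"
  define G where "G = pcompose F [:h, 1:]"
  define g where "g = (\<lambda>b. pcompose (coeff G b) [:a, 1:] * monom 1 b)"
  have "coeff (g b) k = 0" if k: "k < t" for k b
  proof -
    define R where "R = (\<Sum>b\<le>degree G. monom (coeff (g b) k) b)"
    have "poly R y = 0" for y
    proof -
      define u where "u = (\<lambda>i. if i = 0 then [:a, 1:] else if i = 1 then pcompose h [:a, 1:] + [:0, y:]
        else [:p i:])"
      have "poly (u i) 0 = p i" for i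
        using assms(2) by (simp add: u_def a_def poly_pcompose)
      then obtain q where q: "\<And>x. poly (poly F [:poly (u 1) x:]) (poly (u 0) x) = x ^ t * poly q x"
        using vanishD[OF assms(1), of u] by blast
      have "(\<Sum>b\<le>degree G. smult (y ^ b) (g b)) = monom 1 t * q"
      proof (rule poly_eqI_fun)
        fix x
        have "poly (poly F [:poly (u 1) x:]) (poly (u 0) x)
            = poly (poly F (h + [:y * x:])) (a + x)"
          by (subst (2) poly_poly_const) (simp add: u_def poly_pcompose mult.commute)
        also have "\<dots> = poly (poly G [:y * x:]) (a + x)"
          by (simp add: G_def poly_pcompose)
        also have "\<dots> = (\<Sum>b\<le>degree G. poly (coeff G b) (a + x) * (y * x) ^ b)"
          by (simp add: poly_altdef[of G] poly_sum poly_power)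
        also have "\<dots> = poly (\<Sum>b\<le>degree G. smult (y ^ b) (g b)) x"
          by (simp add: poly_sum g_def poly_pcompose poly_monom power_mult_distrib algebra_simps)
        finally show "poly (\<Sum>b\<le>degree G. smult (y ^ b) (g b)) x = poly (monom 1 t * q) x"
          using q by (simp add: poly_monom)
      qed
      then have "coeff (\<Sum>b\<le>degree G. smult (y ^ b) (g b)) k = coeff (monom 1 t * q) k"
        by (rule arg_cong)
      also have "\<dots> = 0" using k by (simp add: coeff_monom_mult)
      finally show ?thesis
        by (simp add: R_def coeff_sum poly_sum poly_monom mult.commute)
    qed
    then have "R = 0" by (intro poly_eqI_fun) simp
    then have "coeff R b = 0" by simp
    then show ?thesis
    proof (cases "b \<le> degree G")
      case False
      then show ?thesis by (simp add: g_def coeff_eq_0)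
    next
      case True
      then show ?thesis using \<open>coeff R b = 0\<close>
        by (simp add: R_def coeff_sum if_distrib[of "\<lambda>x. coeff x b"] sum.delta cong: if_cong)
    qed
  qed
  from this[of "_ + b" b] have "coeff (pcompose (coeff G b) [:a, 1:]) k = 0" if "k < t - b" for k
    using that by (simp add: g_def coeff_monom_mult mult.commute[of _ "monom _ _"])
  then have "monom 1 (t - b) dvd pcompose (coeff G b) [:a, 1:]"
    by (simp add: monom_1_dvd_iff')
  then obtain s where s: "pcompose (coeff G b) [:a, 1:] = monom 1 (t - b) * s" by (rule dvdE)
  have "coeff G b = pcompose (pcompose (coeff G b) [:a, 1:]) [:- a, 1:]"
    by (rule poly_eqI_fun) (simp add: poly_pcompose)
  also have "\<dots> = [:- a, 1:] ^ (t - b) * pcompose s [:- a, 1:]"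
    unfolding s by (rule poly_eqI_fun) (simp add: poly_pcompose poly_monom poly_power)
  finally show ?thesis unfolding G_def a_def by simp
qed

section \<open>Points on the curve moving into the origin\<close>

lemma prod_linear_power_dvd:
  fixes g :: "'k::field poly"
  assumes "finite A" "inj_on a A" "\<And>i. i \<in> A \<Longrightarrow> [:- a i, 1:] ^ m dvd g"
  shows "(\<Prod>i\<in>A. [:- a i, 1:]) ^ m dvd g"
proof (cases "g = 0")
  case False
  show ?thesis
    using assms
  proof (induction A rule: finite_induct)
    case (insert i A)
    define Q where "Q = (\<Prod>i\<in>A. [:- a i, 1:])"
    have "Q ^ m dvd g" unfolding Q_def using insert by (auto simp: inj_on_def)
    then obtain q where q: "g = Q ^ m * q" by (rule dvdE)
    have "poly (Q ^ m) (a i) \<noteq> 0"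
      using insert.hyps insert.prems(1)
      by (auto simp: Q_def poly_prod inj_on_def power_0_left)
    then have "order (a i) (Q ^ m) = 0" by (rule order_0I)
    moreover have "m \<le> order (a i) g"
      using insert.prems(2)[of i] False by (simp add: order_divides)
    ultimately have "m \<le> order (a i) q"
      using False order_mult[of "Q ^ m" q "a i"] unfolding q by simp
    then have "[:- a i, 1:] ^ m dvd q" by (simp add: order_divides)
    then have "[:- a i, 1:] ^ m * Q ^ m dvd q * Q ^ m" by (intro mult_dvd_mono) auto
    then have "([:- a i, 1:] * Q) ^ m dvd g"
      unfolding q power_mult_distrib by (simp only: mult.commute)
    then show ?case
      using insert.hyps by (simp add: Q_def del: mult_pCons_left)
  qed simp
qed simp

text \<open>For \<open>\<epsilon> \<noteq> 0\<close> this is, up to the factor \<open>\<epsilon> ^ k\<close>, the \<open>k\<close>-th coefficient of the remainder of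
  \<open>g(\<epsilon>x)\<close> modulo \<open>Q\<close>. After division by \<open>\<epsilon> ^ k\<close> it extends to \<open>\<epsilon> = 0\<close>.\<close>

definition rem_coeff :: "'k::field poly \<Rightarrow> nat \<Rightarrow> 'k poly \<Rightarrow> 'k \<Rightarrow> 'k"
  where "rem_coeff Q k g e = (\<Sum>a\<le>degree g. coeff g a * (e ^ (a - k) * coeff (monom 1 a mod Q) k))"

lemma rem_coeff_bound:
  "degree g \<le> M \<Longrightarrow> rem_coeff Q k g e = (\<Sum>a\<le>M. coeff g a * (e ^ (a - k) * coeff (monom 1 a mod Q) k))"
  unfolding rem_coeff_def by (rule sum.mono_neutral_left) (auto simp: coeff_eq_0)

lemma rem_coeff_add: "rem_coeff Q k (g + h) e = rem_coeff Q k g e + rem_coeff Q k h e"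
proof -
  define M where "M = max (degree g) (degree h)"
  have "degree g \<le> M" "degree h \<le> M" "degree (g + h) \<le> M"
    by (auto simp: M_def degree_add_le_max)
  then show ?thesis by (simp add: rem_coeff_bound[of _ M] sum.distrib distrib_right)
qed

lemma rem_coeff_smult: "rem_coeff Q k (smult c g) e = c * rem_coeff Q k g e"
  using rem_coeff_bound[of "smult c g" "degree g"]
  by (simp add: degree_smult_le rem_coeff_def sum_distrib_left mult.assoc)

lemma rem_coeff_0: "rem_coeff Q k 0 e = 0"
  by (simp add: rem_coeff_def)

lemma rem_coeff_sum:
  "rem_coeff Q k (\<Sum>b\<in>B. smult (x b) (g b)) e = (\<Sum>b\<in>B. x b * rem_coeff Q k (g b) e)"
  by (induction B rule: infinite_finite_induct)
    (simp_all add: rem_coeff_0 rem_coeff_add rem_coeff_smult)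

lemma rem_coeff_poly: "\<exists>p. \<forall>e. rem_coeff Q k g e = poly p e"
  by (intro exI[of _ "\<Sum>a\<le>degree g. monom (coeff g a * coeff (monom 1 a mod Q) k) (a - k)"])
    (simp add: rem_coeff_def poly_sum poly_monom algebra_simps)

lemma coeff_monom_mod_less: "a < k \<Longrightarrow> k < degree Q \<Longrightarrow> coeff (monom 1 a mod Q) k = 0"
  by (subst mod_poly_less) (auto simp: degree_monom_eq)

lemma rem_coeff_at_0:
  assumes "k < degree Q"
  shows "rem_coeff Q k g 0 = coeff g k"
proof -
  have "coeff g a * (0 ^ (a - k) * coeff (monom 1 a mod Q) k) = (if a = k then coeff g k else 0)" for a
  proof (cases a k rule: linorder_cases)
    case equal
    then show ?thesis using assms by (simp add: mod_poly_less degree_monom_eq)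
  qed (use assms coeff_monom_mod_less in auto)
  then show ?thesis by (simp add: rem_coeff_def coeff_eq_0)
qed

lemma rem_coeff_dvd:
  fixes g :: "'k::field_char_0 poly"
  assumes "k < degree Q" "e \<noteq> 0" "Q dvd pcompose g [:0, e:]"
  shows "rem_coeff Q k g e = 0"
proof -
  have mod_sum: "(\<Sum>a\<in>A. f a) mod Q = (\<Sum>a\<in>A. f a mod Q)" for f :: "nat \<Rightarrow> 'k poly" and A
    by (induction A rule: infinite_finite_induct) (simp_all add: poly_mod_add_left)
  have "pcompose g [:0, e:] = (\<Sum>a\<le>degree g. smult (coeff g a * e ^ a) (monom 1 a))"
    by (rule poly_eqI_fun)
      (simp add: poly_pcompose poly_altdef[of g] poly_sum poly_monom power_mult_distrib algebra_simps)
  then have "coeff (pcompose g [:0, e:] mod Q) k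
      = (\<Sum>a\<le>degree g. coeff g a * e ^ a * coeff (monom 1 a mod Q) k)"
    by (simp add: mod_sum mod_smult_left coeff_sum)
  \<comment> \<open>The truncated exponent \<open>a - k\<close> is harmless, since
    \<open>x^a mod Q\<close> has no term of degree \<open>k\<close> when
    \<open>a < k\<close>.\<close>
  also have "\<dots> = (\<Sum>a\<le>degree g. coeff g a * (e ^ k * e ^ (a - k)) * coeff (monom 1 a mod Q) k)"
  proof (rule sum.cong[OF refl])
    fix a
    show "coeff g a * e ^ a * coeff (monom 1 a mod Q) k
        = coeff g a * (e ^ k * e ^ (a - k)) * coeff (monom 1 a mod Q) k"
      using coeff_monom_mod_less[of a k Q] assms(1)
      by (cases "a < k") (simp_all flip: power_add)
  qed
  also have "\<dots> = e ^ k * rem_coeff Q k g e"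
    by (simp add: rem_coeff_def sum_distrib_left algebra_simps)
  finally show ?thesis using assms by (simp add: dvd_imp_mod_0)
qed

lemma coeff_sum_monom_monom:
  assumes "finite B"
  shows "coeff (coeff (\<Sum>z\<in>B. monom (monom (x z) (fst z)) (snd z)) b) a = (if (a, b) \<in> B then x (a, b) else 0)"
proof -
  have "coeff (coeff (\<Sum>z\<in>B. monom (monom (x z) (fst z)) (snd z)) b) a
      = (\<Sum>z\<in>B. if z = (a, b) then x (a, b) else 0)"
    unfolding coeff_sum by (rule sum.cong) auto
  then show ?thesis using assms by simp
qed

lemma coeff_pcompose_sum_monom_monom:
  "coeff (pcompose (\<Sum>z\<in>B. monom (monom (x z) (fst z)) (snd z)) q) b
    = (\<Sum>z\<in>B. smult (x z) (coeff (pcompose (monom (monom 1 (fst z)) (snd z)) q) b))"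
  for x :: "nat \<times> nat \<Rightarrow> 'k::comm_ring_1"
proof -
  have "monom (monom (x z) (fst z)) (snd z) = smult [:x z:] (monom (monom 1 (fst z)) (snd z))" for z
    by (simp add: smult_monom)
  then show ?thesis by (simp add: pcompose_sum pcompose_smult coeff_sum)
qed

text \<open>By \<open>vanish_on_curve\<close>, order \<open>t\<close> at the points
  \<open>(e i, h(e i))\<close> gives divisibility conditions on the coefficients in
  \<open>y - h\<close>. Replacing \<open>x\<close> by \<open>e x\<close> turns the moduli into the
  fixed \<open>Q ^ (t - b)\<close>, and the conditions into linear equations that are polynomial in
  \<open>e\<close>. At \<open>e = 0\<close> they say that the weight is at least \<open>n t\<close>,
  so \<open>weight_ge_imp_zero\<close> makes the system injective there, hence for almost all
  \<open>e\<close>.\<close>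

lemma curve_points_generic:
  assumes "1 \<le> \<delta>" "1 \<le> n" "r \<le> n" "c * real \<delta> \<le> real r" "c * real r \<le> real n * real \<delta>"
    and "real d < c * real t"
  defines "h \<equiv> monom 1 \<delta> + monom 1 r :: 'k::field_char_0 poly"
  shows "\<exists>p :: 'k poly. poly p 0 \<noteq> 0 \<and> (\<forall>e f. e \<noteq> 0 \<longrightarrow> poly p e \<noteq> 0 \<longrightarrow> poly_deg_le 2 d f \<longrightarrow>
    (\<forall>i<n. vanish t (\<lambda>j. if j = 1 then poly h (e * of_nat i) else e * of_nat i) f) \<longrightarrow> (\<forall>v. f v = 0))"
proof -
  define B where "B = {z :: nat \<times> nat. fst z + snd z \<le> d}"
  have "B \<subseteq> {..d} \<times> {..d}" by (auto simp: B_def)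
  then have B: "finite B" by (rule finite_subset) simp
  define Q where "Q = (\<Prod>i<n. [:- of_nat i, 1:] :: 'k poly)"
  have "degree Q = n"
    unfolding Q_def by (subst degree_prod_eq_sum_degree) auto
  moreover have "Q \<noteq> 0" by (simp add: Q_def)
  ultimately have degQ: "degree (Q ^ m) = n * m" for m
    by (simp add: degree_power_eq)
  define L where "L = (\<lambda>z :: nat \<times> nat. pcompose (monom (monom (1 :: 'k) (fst z)) (snd z)) [:h, 1:])"
  define A where "A = (\<lambda>(b, k) z e. if b < t \<and> k < n * (t - b)
      then rem_coeff (Q ^ (t - b)) k (coeff (L z) b) e else 0)"
  define F where "F = (\<lambda>x :: nat \<times> nat \<Rightarrow> 'k. \<Sum>z\<in>B. monom (monom (x z) (fst z)) (snd z))"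
  have coeffF: "coeff (coeff (F x) b) a = (if (a, b) \<in> B then x (a, b) else 0)" for x a b
    unfolding F_def by (rule coeff_sum_monom_monom[OF B])
  have A_sum: "(\<Sum>z\<in>B. A (b, k) z e * x z)
      = rem_coeff (Q ^ (t - b)) k (coeff (pcompose (F x) [:h, 1:]) b) e"
    if "b < t" "k < n * (t - b)" for b k e x
    unfolding F_def coeff_pcompose_sum_monom_monom rem_coeff_sum
    using that by (simp add: A_def L_def mult.commute)
  have "\<exists>D\<in>range poly. D 0 \<noteq> 0 \<and>
      (\<forall>e x. D e \<noteq> 0 \<longrightarrow> (\<forall>c. (\<Sum>z\<in>B. A c z e * x z) = 0) \<longrightarrow> (\<forall>z\<in>B. x z = 0))"
  proof (rule generic_injectivity[OF B])
    show "(\<lambda>e. 1) \<in> range (poly :: 'k poly \<Rightarrow> _)" by (intro range_eqI[of _ _ 1]) auto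
    show "(\<lambda>e. f e * g e) \<in> range poly" if "f \<in> range poly" "g \<in> range poly" for f g :: "'k \<Rightarrow> 'k"
      using that by (auto simp flip: poly_mult)
    show "(\<lambda>e. f e - g e) \<in> range poly" if "f \<in> range poly" "g \<in> range poly" for f g :: "'k \<Rightarrow> 'k"
      using that by (auto simp flip: poly_diff)
    show "A c z \<in> range poly" for c z
    proof -
      obtain b k where c: "c = (b, k)" by (cases c)
      obtain p where p: "\<And>e. rem_coeff (Q ^ (t - b)) k (coeff (L z) b) e = poly p e"
        using rem_coeff_poly by blast
      show ?thesis
      proof (cases "b < t \<and> k < n * (t - b)")
        case True
        then have "A c z = poly p" by (auto simp: A_def c p)
        then show ?thesis by blast
      next
        case False
        then have "A c z = poly 0" by (auto simp: A_def c)
        then show ?thesis by blast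
      qed
    qed
    fix x assume x: "\<And>c. (\<Sum>z\<in>B. A c z 0 * x z) = 0"
    have "F x = 0"
    proof (rule weight_ge_imp_zero[OF assms(1-3)])
      show "total_deg_le (F x) d"
        by (auto simp: total_deg_le_def coeffF B_def)
      show "weight_ge n (n * t) (pcompose (F x) [:monom 1 \<delta> + monom 1 r, 1:])"
        unfolding weight_ge_def h_def[symmetric] monom_1_dvd_iff'
      proof (intro allI impI)
        fix b k assume k: "k < n * t - n * b"
        then have bt: "b < t" "k < n * (t - b)"
          by (auto simp: diff_mult_distrib2 intro: ccontr)
        then have "0 = rem_coeff (Q ^ (t - b)) k (coeff (pcompose (F x) [:h, 1:]) b) 0"
          using x[of "(b, k)"] A_sum by simp
        also have "\<dots> = coeff (coeff (pcompose (F x) [:h, 1:]) b) k"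
          by (rule rem_coeff_at_0) (use bt degQ in simp)
        finally show "coeff (coeff (pcompose (F x) [:h, 1:]) b) k = 0" by simp
      qed
      \<comment> \<open>For weight \<open>n t\<close> the ratio is \<kappa> = \<open>c / n\<close>,
        so that \<open>d < \<kappa> n t\<close> is \<open>d < c t\<close>.\<close>
      show "real (\<delta> * n) * (c / real n) \<le> real r" "real r * (c / real n) \<le> real \<delta>"
        "real d < c / real n * real (n * t)"
        using assms(2,4-6) by (simp_all add: field_simps)
    qed
    then show "\<forall>z\<in>B. x z = 0"
      using coeffF[of x] by (metis coeff_0 prod.collapse)
  qed
  then obtain p where p: "poly p 0 \<noteq> 0"
    "\<And>e x. poly p e \<noteq> 0 \<Longrightarrow> (\<forall>c. (\<Sum>z\<in>B. A c z e * x z) = 0) \<Longrightarrow> (\<forall>z\<in>B. x z = 0)"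
    by (smt (verit) rangeE)
  have "f v = 0" if e: "e \<noteq> 0" "poly p e \<noteq> 0" and f: "poly_deg_le 2 d f"
    and van: "\<And>i. i < n \<Longrightarrow> vanish t (\<lambda>j. if j = 1 then poly h (e * of_nat i) else e * of_nat i) f"
    for e f v
  proof -
    obtain G where G: "total_deg_le G d" "\<And>v. f v = poly (poly G [:v 1:]) (v 0)"
      using poly_deg_le_2[OF f] by blast
    define x where "x = (\<lambda>(a, b). coeff (coeff G b) a)"
    have GF: "G = F x"
      using G(1) by (auto simp: poly_eq_iff coeffF x_def B_def total_deg_le_def)
    have "rem_coeff (Q ^ (t - b)) k (coeff (pcompose (F x) [:h, 1:]) b) e = 0"
      if bk: "b < t" "k < n * (t - b)" for b k
    proof (rule rem_coeff_dvd)
      show "k < degree (Q ^ (t - b))" using bk degQ by simp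
      show "e \<noteq> 0" by fact
      have "[:- of_nat i, 1:] ^ (t - b) dvd pcompose (coeff (pcompose (F x) [:h, 1:]) b) [:0, e:]"
        if i: "i < n" for i
      proof -
        let ?p = "\<lambda>j::nat. if j = 1 then poly h (e * of_nat i) else e * of_nat i :: 'k"
        have "f = (\<lambda>v. poly (poly (F x) [:v 1:]) (v 0))"
          using G(2) GF by auto
        then have "[:- ?p 0, 1:] ^ (t - b) dvd coeff (pcompose (F x) [:h, 1:]) b"
          using van[OF i] by (intro vanish_on_curve) auto
        then obtain s where s: "coeff (pcompose (F x) [:h, 1:]) b = [:- (e * of_nat i), 1:] ^ (t - b) * s"
          by (auto elim: dvdE)
        have "pcompose ([:- (e * of_nat i), 1:] ^ (t - b) * s) [:0, e:]
            = [:- of_nat i, 1:] ^ (t - b) * (smult (e ^ (t - b)) (pcompose s [:0, e:]))"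
          by (rule poly_eqI_fun)
            (simp add: poly_pcompose poly_power algebra_simps flip: power_mult_distrib)
        then show ?thesis unfolding s by (metis dvd_triv_left)
      qed
      then show "Q ^ (t - b) dvd pcompose (coeff (pcompose (F x) [:h, 1:]) b) [:0, e:]"
        unfolding Q_def by (intro prod_linear_power_dvd) (auto simp: inj_on_def)
    qed
    then have "(\<Sum>z\<in>B. A c z e * x z) = 0" for c
      using A_sum by (cases c; cases "fst c < t \<and> snd c < n * (t - fst c)") (auto simp: A_def)
    then have "\<forall>z\<in>B. x z = 0" using p(2) e(2) by blast
    then have "F x = 0" by (simp add: F_def)
    then show ?thesis using G(2) GF by simp
  qed
  then show ?thesis using p(1) by blast
qed

text \<open>The inequalities allow any \<open>c\<close> up to the minimum of
  \<open>r / \<delta>\<close> and \<open>n \<delta> / r\<close>. These two have product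
  \<open>n\<close>, so \<open>c\<close> is at most \<open>sqrt n\<close>, and it is best to take
  \<open>r / \<delta>\<close> near \<open>sqrt n\<close>.\<close>

lemma waldschmidt_ge_curve:
  assumes "1 \<le> \<delta>" "1 \<le> n" "r \<le> n" "c * real \<delta> \<le> real r" "c * real r \<le> real n * real \<delta>"
  shows "waldschmidt_ge TYPE('k::field_char_0) 2 c n"
  unfolding waldschmidt_ge_def
proof
  fix T :: nat
  define h where "h = (monom 1 \<delta> + monom 1 r :: 'k poly)"
  define P where "P = (\<lambda>e i (j :: nat). if j = 1 then poly h (e * of_nat i) else e * of_nat i :: 'k)"
  define good where "good = (\<lambda>t d p. poly p (0 :: 'k) \<noteq> 0 \<and> (real d < c * real t \<longrightarrow>
    (\<forall>e f. e \<noteq> 0 \<longrightarrow> poly p e \<noteq> 0 \<longrightarrow> poly_deg_le 2 d f \<longrightarrow>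
      (\<forall>i<n. vanish t (P e i) f) \<longrightarrow> (\<forall>v. f v = 0))))"
  have "\<exists>p. good t d p" for t d
  proof (cases "real d < c * real t")
    case True
    then show ?thesis
      using curve_points_generic[OF assms True, where 'k = 'k] unfolding good_def P_def h_def by simp
  next
    case False
    then show ?thesis by (intro exI[of _ 1]) (simp add: good_def)
  qed
  then obtain p where p: "\<And>t d. good t d (p t d)" by metis
  \<comment> \<open>Only degrees up to \<open>M\<close> can satisfy \<open>d < c t\<close> with
    \<open>t \<le> T\<close>, so a single parameter \<open>e\<close> has to avoid the roots of
    finitely many polynomials; the factor \<open>[:0, 1:]\<close> of \<open>q\<close> ensures
    \<open>e \<noteq> 0\<close>.\<close>
  define M where "M = nat \<lceil>\<bar>c\<bar> * real T\<rceil>"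
  define q where "q = [:0, 1:] * (\<Prod>t\<le>T. \<Prod>d\<le>M. p t d)"
  have "p t d \<noteq> 0" for t d using p[of t d] by (auto simp: good_def)
  then have "q \<noteq> 0" by (simp add: q_def del: mult_pCons_left)
  then have "finite {x. poly q x = 0}" by (rule poly_roots_finite)
  then obtain e where "poly q e \<noteq> 0"
    using ex_new_if_finite[OF infinite_UNIV_char_0[where 'a = 'k]] by blast
  then have e: "e \<noteq> 0" "\<And>t d. t \<le> T \<Longrightarrow> d \<le> M \<Longrightarrow> poly (p t d) e \<noteq> 0"
    by (auto simp: q_def poly_prod)
  show "\<exists>P :: nat \<Rightarrow> nat \<Rightarrow> 'k. forces_zero 2 c n T P"
  proof (intro exI[of _ "P e"] forces_zeroI)
    fix t d f v
    assume *: "t \<le> T" "real d < c * real t" "poly_deg_le 2 d f" "\<forall>i<n. vanish t (P e i) f"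
    have "c * real t \<le> \<bar>c\<bar> * real T"
      using *(1) by (intro mult_mono) auto
    then have "d \<le> M" using *(2) unfolding M_def by linarith
    then show "f v = 0"
      using p[of t d] e * unfolding good_def by blast
  qed
qed

section \<open>Forms and powers of the ideal of a finite set of points\<close>

inductive form :: "nat \<Rightarrow> nat \<Rightarrow> ((nat \<Rightarrow> 'k::comm_ring_1) \<Rightarrow> 'k) \<Rightarrow> bool" for N where
  zero: "form N d (\<lambda>v. 0)"
| const: "form N 0 (\<lambda>v. c)"
| add: "form N d f \<Longrightarrow> form N d g \<Longrightarrow> form N d (\<lambda>v. f v + g v)"
| mult: "i \<le> N \<Longrightarrow> form N d f \<Longrightarrow> form N (Suc d) (\<lambda>v. v i * f v)"

lemma form_polyfn: "form N d f \<Longrightarrow> polyfn f"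
  by (induction rule: form.induct) (auto intro: polyfn.intros)

lemma form_cong: "form N d f \<Longrightarrow> (\<And>i. i \<le> N \<Longrightarrow> v i = w i) \<Longrightarrow> f v = f w"
  by (induction rule: form.induct) auto

lemma form_scale: "form N d f \<Longrightarrow> f (\<lambda>i. c * v i) = c ^ d * f v"
  by (induction rule: form.induct) (simp_all add: algebra_simps)

lemma form_times: "form N d f \<Longrightarrow> form N e g \<Longrightarrow> form N (d + e) (\<lambda>v. f v * g v)"
proof (induction rule: form.induct)
  case (zero d)
  show ?case by (simp add: form.zero)
next
  case (const c)
  from this show ?case
  proof (induction rule: form.induct)
    case (add d f g)
    then show ?case using form.add by (fastforce simp: distrib_left)
  next
    case (mult i d f)
    then have "form N (Suc (0 + d)) (\<lambda>v. v i * (c * f v))" by (intro form.mult)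
    then show ?case by (simp add: mult.left_commute)
  qed (auto intro: form.intros)
next
  case (add d f g')
  then show ?case using form.add by (fastforce simp: distrib_right)
next
  case (mult i d f)
  then have "form N (Suc (d + e)) (\<lambda>v. v i * (f v * g v))" by (intro form.mult)
  then show ?case by (simp add: mult.assoc)
qed

lemma form_cmult: "form N d f \<Longrightarrow> form N d (\<lambda>v. c * f v)"
  using form_times[OF form.const] by fastforce

lemma form_diff:
  assumes "form N d f" "form N d g"
  shows "form N d (\<lambda>v. f v - g v)"
  using form.add[OF assms(1) form_cmult[OF assms(2), of "-1"]] by simp

lemma form_sum: "(\<And>a. a \<in> A \<Longrightarrow> form N d (f a)) \<Longrightarrow> form N d (\<lambda>v. \<Sum>a\<in>A. f a v)"
  by (induction A rule: infinite_finite_induct) (auto intro: form.zero form.add)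

lemma form_var: "i \<le> N \<Longrightarrow> form N 1 (\<lambda>v. v i)"
  using form.mult[OF _ form.const[of N 1]] by simp

lemma form_var_power: "i \<le> N \<Longrightarrow> form N k (\<lambda>v. v i ^ k)"
  by (induction k) (auto intro: form.intros)

lemma form_expand:
  assumes "form N (Suc d) f"
  obtains g where "\<And>j. form N d (g j)" "f = (\<lambda>v. \<Sum>j\<le>N. v j * g j v)"
proof -
  have "\<exists>g. (\<forall>j. form N d (g j)) \<and> f = (\<lambda>v. \<Sum>j\<le>N. v j * g j v)"
    using assms
  proof (induction "Suc d" f rule: form.induct)
    case zero
    show ?case by (rule exI[of _ "\<lambda>j v. 0"]) (simp add: form.zero)
  next
    case (add f g)
    then obtain f' g' where "\<forall>j. form N d (f' j)" "f = (\<lambda>v. \<Sum>j\<le>N. v j * f' j v)"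
      "\<forall>j. form N d (g' j)" "g = (\<lambda>v. \<Sum>j\<le>N. v j * g' j v)" by blast
    then show ?case
      by (intro exI[of _ "\<lambda>j v. f' j v + g' j v"])
        (auto intro: form.add simp: distrib_left sum.distrib)
  next
    case (mult i f)
    have "(\<Sum>j\<le>N. v j * (if j = i then f v else 0)) = v i * f v" for v
      using mult.hyps(1) by (simp add: if_distrib cong: if_cong)
    then show ?case
      using mult.hyps
      by (intro exI[of _ "\<lambda>j. if j = i then f else (\<lambda>v. 0)"])
        (auto intro: form.zero simp: if_distrib[of "\<lambda>g. g _"] cong: if_cong)
  qed
  then show thesis using that by blast
qed

text \<open>The linear forms \<open>v j - p j * v N\<close> generate the ideal of \<open>p\<close>,
  so this is division by that ideal with a multiple of \<open>v N ^ d\<close> as remainder.\<close>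

lemma form_expand_at_point:
  assumes "form N d f" "p N = 1"
  obtains g where "\<forall>j. form N (d - 1) (g j)"
    "\<forall>v. f v = f p * v N ^ d + (\<Sum>j<N. (v j - p j * v N) * g j v)"
proof -
  have "\<exists>g. (\<forall>j. form N (d - 1) (g j)) \<and> (d = 0 \<longrightarrow> (\<forall>j. g j = (\<lambda>v. 0))) \<and>
    (\<forall>v. f v = f p * v N ^ d + (\<Sum>j<N. (v j - p j * v N) * g j v))"
    using assms(1)
  proof (induction "d" f rule: form.induct)
    case (zero d)
    show ?case by (rule exI[of _ "\<lambda>j v. 0"]) (simp add: form.zero)
  next
    case (const c)
    show ?case by (rule exI[of _ "\<lambda>j v. 0"]) (simp add: form.zero)
  next
    case (add d f g)
    obtain f' where "(\<forall>j. form N (d - 1) (f' j)) \<and> (d = 0 \<longrightarrow> (\<forall>j. f' j = (\<lambda>v. 0))) \<and>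
      (\<forall>v. f v = f p * v N ^ d + (\<Sum>j<N. (v j - p j * v N) * f' j v))"
      using add.IH(1) ..
    note f' = this[THEN conjunct1, rule_format] this[THEN conjunct2, THEN conjunct1, rule_format]
      this[THEN conjunct2, THEN conjunct2, rule_format]
    obtain g' where "(\<forall>j. form N (d - 1) (g' j)) \<and> (d = 0 \<longrightarrow> (\<forall>j. g' j = (\<lambda>v. 0))) \<and>
      (\<forall>v. g v = g p * v N ^ d + (\<Sum>j<N. (v j - p j * v N) * g' j v))"
      using add.IH(2) ..
    note g' = this[THEN conjunct1, rule_format] this[THEN conjunct2, THEN conjunct1, rule_format]
      this[THEN conjunct2, THEN conjunct2, rule_format]
    have eq: "f v + g v = (f p + g p) * v N ^ d + (\<Sum>j<N. (v j - p j * v N) * (f' j v + g' j v))" for v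
      using f'(3)[of v] g'(3)[of v] by (simp add: distrib_left distrib_right sum.distrib)
    show ?case
      by (intro exI[of _ "\<lambda>j v. f' j v + g' j v"] conjI allI, rule form.add[OF f'(1) g'(1)], rule_tac [2] eq)
        (use f'(2) g'(2) in simp)
  next
    case (mult i d f)
    obtain g where "(\<forall>j. form N (d - 1) (g j)) \<and> (d = 0 \<longrightarrow> (\<forall>j. g j = (\<lambda>v. 0))) \<and>
      (\<forall>v. f v = f p * v N ^ d + (\<Sum>j<N. (v j - p j * v N) * g j v))"
      using mult.IH ..
    note g = this[THEN conjunct1, rule_format] this[THEN conjunct2, THEN conjunct1, rule_format]
      this[THEN conjunct2, THEN conjunct2, rule_format]
    have vg: "form N d (\<lambda>v. v i * g j v)" for j
    proof (cases d)
      case 0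
      then show ?thesis using g(2) by (simp add: form.zero)
    next
      case (Suc d')
      then show ?thesis using form.mult[OF mult.hyps(1) g(1)] by simp
    qed
    define g' where "g' = (\<lambda>j v. v i * g j v + (if j = i then f p else 0) * v N ^ d)"
    have g': "form N d (g' j)" for j
      unfolding g'_def by (intro form.add vg form_cmult form_var_power) simp
    have eq: "v i * f v = p i * f p * v N ^ Suc d + (\<Sum>j<N. (v j - p j * v N) * g' j v)" for v
    proof -
      have "(\<Sum>j<N. (v j - p j * v N) * ((if j = i then f p else 0) * v N ^ d))
          = (\<Sum>j<N. if j = i then (v i - p i * v N) * (f p * v N ^ d) else 0)"
        by (rule sum.cong) auto
      also have "\<dots> = (v i - p i * v N) * (f p * v N ^ d)"
        using mult.hyps(1) assms(2) by (cases "i = N") auto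
      finally have "(\<Sum>j<N. (v j - p j * v N) * g' j v)
          = v i * (\<Sum>j<N. (v j - p j * v N) * g j v) + (v i - p i * v N) * (f p * v N ^ d)"
        by (simp add: g'_def distrib_left sum.distrib sum_distrib_left mult.left_commute)
      moreover have "v i * f v = v i * (f p * v N ^ d + (\<Sum>j<N. (v j - p j * v N) * g j v))"
        using g(3)[of v] by (rule arg_cong)
      ultimately show ?thesis by (simp add: algebra_simps)
    qed
    show ?case
      by (intro exI[of _ g'] conjI allI, simp add: g', simp, rule eq)
  qed
  then show thesis using that by blast
qed

text \<open>Representatives with last coordinate 1 make \<open>v N\<close> a linear form that
  vanishes at none of the points; its powers adjust degrees without changing orders of
  vanishing.\<close>

locale separated_points =
  fixes N e s :: nat and u :: "nat \<Rightarrow> nat \<Rightarrow> 'k::field_char_0" and F :: "nat \<Rightarrow> (nat \<Rightarrow> 'k) \<Rightarrow> 'k"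
  assumes normalized: "q < s \<Longrightarrow> u q N = 1"
    and form_F: "q < s \<Longrightarrow> form N e (F q)"
    and F_delta: "p < s \<Longrightarrow> q < s \<Longrightarrow> F q (u p) = (if p = q then 1 else 0)"
begin

definition vanishing :: "nat \<Rightarrow> ((nat \<Rightarrow> 'k) \<Rightarrow> 'k) \<Rightarrow> bool"
  where "vanishing d f \<longleftrightarrow> form N d f \<and> (\<forall>q<s. f (u q) = 0)"

text \<open>\<open>ideal_pow k d\<close> is the degree \<open>d\<close> part of the \<open>k\<close>-th power of the ideal generated by the
  forms of degree \<open>e + 1\<close> that vanish at all points.\<close>

inductive ideal_pow :: "nat \<Rightarrow> nat \<Rightarrow> ((nat \<Rightarrow> 'k) \<Rightarrow> 'k) \<Rightarrow> bool" where
  base: "form N d f \<Longrightarrow> ideal_pow 0 d f"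
| zero: "ideal_pow k d (\<lambda>v. 0)"
| add: "ideal_pow k d f \<Longrightarrow> ideal_pow k d g \<Longrightarrow> ideal_pow k d (\<lambda>v. f v + g v)"
| mult: "vanishing (Suc e) h \<Longrightarrow> ideal_pow k d f \<Longrightarrow> ideal_pow (Suc k) (d + Suc e) (\<lambda>v. h v * f v)"

lemma vanishing_form: "vanishing d f \<Longrightarrow> form N d f"
  by (simp add: vanishing_def)

lemma ideal_pow_form: "ideal_pow k d f \<Longrightarrow> form N d f"
proof (induction rule: ideal_pow.induct)
  case (mult h k d f)
  then show ?case using form_times[of N d f "Suc e" h] by (simp add: vanishing_form mult.commute)
qed (auto intro: form.intros)

lemma ideal_pow_times:
  "ideal_pow k d f \<Longrightarrow> ideal_pow l d' g \<Longrightarrow> ideal_pow (k + l) (d + d') (\<lambda>v. f v * g v)"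
proof (induction rule: ideal_pow.induct)
  case (base d f)
  from base(2,1) show ?case
  proof (induction rule: ideal_pow.induct)
    case (base d' g)
    then show ?case using ideal_pow.base[OF form_times[of N d f d' g]] by simp
  next
    case (zero k d')
    show ?case by (simp add: ideal_pow.zero)
  next
    case (add k d' g h)
    then show ?case using ideal_pow.add by (fastforce simp: distrib_left)
  next
    case (mult h k d' g)
    then have "ideal_pow (Suc (0 + k)) (d + d' + Suc e) (\<lambda>v. h v * (f v * g v))"
      by (intro ideal_pow.mult) auto
    then show ?case by (simp add: mult.left_commute add.assoc)
  qed
next
  case (zero k d)
  show ?case by (simp add: ideal_pow.zero)
next
  case (add k d f g')
  then show ?case using ideal_pow.add by (fastforce simp: distrib_right)
next
  case (mult h k d f)
  then have "ideal_pow (Suc (k + l)) (d + d' + Suc e) (\<lambda>v. h v * (f v * g v))"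
    by (intro ideal_pow.mult)
  then show ?case by (simp add: mult.assoc ac_simps)
qed

lemma ideal_pow_times_form:
  assumes "ideal_pow k d f" "form N d' g"
  shows "ideal_pow k (d' + d) (\<lambda>v. g v * f v)"
  using ideal_pow_times[OF ideal_pow.base[OF assms(2)] assms(1)] by simp

lemma ideal_pow_sum:
  "(\<And>a. a \<in> A \<Longrightarrow> ideal_pow k d (f a)) \<Longrightarrow> ideal_pow k d (\<lambda>v. \<Sum>a\<in>A. f a v)"
  by (induction A rule: infinite_finite_induct) (auto intro: ideal_pow.zero ideal_pow.add)

lemma ideal_pow_1:
  assumes "vanishing (Suc e) h"
  shows "ideal_pow 1 (Suc e) h"
  using ideal_pow.mult[OF assms ideal_pow.base[OF form.const[of N 1]]] by simp

lemma ideal_pow_2: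
  assumes "vanishing (Suc e) g" "vanishing (Suc e) h"
  shows "ideal_pow 2 (2 * Suc e) (\<lambda>v. g v * h v)"
  using ideal_pow_times[OF ideal_pow_1[OF assms(1)] ideal_pow_1[OF assms(2)]]
  by (simp add: numeral_2_eq_2 mult_2)

lemma ideal_pow_vanish:
  assumes "p < s"
  shows "ideal_pow k d f \<Longrightarrow> vanish k (u p) f"
proof (induction rule: ideal_pow.induct)
  case (base d f)
  then show ?case by (simp add: vanish_0 form_polyfn)
next
  case (mult h k d f)
  have "vanish 1 (u p) h"
    using mult.hyps(1) assms by (intro vanish_1I form_polyfn) (auto simp: vanishing_def)
  from vanish_mult[OF this mult.IH] show ?case by simp
qed (auto intro: vanish_add)

lemma polyfn_F: "q < s \<Longrightarrow> polyfn (F q)"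
  by (rule form_polyfn[OF form_F])

lemma vanishing_interpolation:
  assumes "form N d f" "e \<le> d"
  shows "vanishing d (\<lambda>v. f v - (\<Sum>q<s. f (u q) * (F q v * v N ^ (d - e))))"
  unfolding vanishing_def
proof
  have "form N (e + (d - e)) (\<lambda>v. F q v * v N ^ (d - e))" if "q < s" for q
    using that by (intro form_times form_F form_var_power) auto
  then show "form N d (\<lambda>v. f v - (\<Sum>q<s. f (u q) * (F q v * v N ^ (d - e))))"
    using assms by (intro form_diff form_sum form_cmult) auto
  show "\<forall>p<s. f (u p) - (\<Sum>q<s. f (u q) * (F q (u p) * u p N ^ (d - e))) = 0"
  proof (intro allI impI)
    fix p assume p: "p < s"
    have "(\<Sum>q<s. f (u q) * (F q (u p) * u p N ^ (d - e))) = (\<Sum>q<s. if q = p then f (u p) else 0)"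
      by (rule sum.cong) (use p in \<open>auto simp: F_delta normalized\<close>)
    then show "f (u p) - (\<Sum>q<s. f (u q) * (F q (u p) * u p N ^ (d - e))) = 0"
      using p by simp
  qed
qed

lemma vanishing_F_times:
  assumes "q < s" "form N 1 l" "l (u q) = 0"
  shows "vanishing (Suc e) (\<lambda>v. F q v * l v)"
  unfolding vanishing_def
proof
  show "form N (Suc e) (\<lambda>v. F q v * l v)"
    using form_times[OF form_F[OF assms(1)] assms(2)] by simp
qed (use assms F_delta in auto)

text \<open>The ideal has no new generators beyond degree \<open>e + 1\<close>. When
  \<open>f\<close> is written as a sum of terms \<open>v j * g j\<close>, each \<open>g j\<close> is
  reduced by its interpolant to a form in the ideal. What is left groups by points into multiples of
  \<open>F q * l q\<close>, where the linear form \<open>l q\<close> vanishes at \<open>u q\<close>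
  because \<open>f\<close> does.\<close>

lemma ideal_pow_1_vanishing:
  assumes "Suc e \<le> d" "vanishing d f"
  shows "ideal_pow 1 d f"
  using assms
proof (induction d arbitrary: f rule: dec_induct)
  case base
  then show ?case by (rule ideal_pow_1)
next
  case (step d)
  obtain g where g: "\<And>j. form N d (g j)" "f = (\<lambda>v. \<Sum>j\<le>N. v j * g j v)"
    using form_expand[OF vanishing_form[OF step.prems]] by blast
  define g' where "g' = (\<lambda>j v. g j v - (\<Sum>q<s. g j (u q) * (F q v * v N ^ (d - e))))"
  define l where "l = (\<lambda>q v. \<Sum>j\<le>N. g j (u q) * v j)"
  have "ideal_pow 1 d (g' j)" for j
    unfolding g'_def using step.hyps by (intro step.IH vanishing_interpolation g) simp
  then have 1: "ideal_pow 1 (Suc d) (\<lambda>v. \<Sum>j\<le>N. v j * g' j v)"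
    using ideal_pow_times_form[OF _ form_var] by (intro ideal_pow_sum) fastforce
  have "ideal_pow 1 (Suc d) (\<lambda>v. v N ^ (d - e) * (F q v * l q v))" if "q < s" for q
  proof -
    have "form N 1 (l q)" unfolding l_def by (intro form_sum form_cmult form_var) auto
    moreover have "l q (u q) = 0"
      using step.prems that unfolding vanishing_def l_def g(2) by (simp add: mult.commute)
    ultimately have "ideal_pow 1 (d - e + Suc e) (\<lambda>v. v N ^ (d - e) * (F q v * l q v))"
      using that by (intro ideal_pow_times_form ideal_pow_1 vanishing_F_times form_var_power) auto
    then show ?thesis using step.hyps by simp
  qed
  then have 2: "ideal_pow 1 (Suc d) (\<lambda>v. \<Sum>q<s. v N ^ (d - e) * (F q v * l q v))"
    by (intro ideal_pow_sum) auto
  have "f v = (\<Sum>j\<le>N. v j * g' j v) + (\<Sum>q<s. v N ^ (d - e) * (F q v * l q v))" for v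
  proof -
    have "(\<Sum>j\<le>N. v j * (\<Sum>q<s. g j (u q) * (F q v * v N ^ (d - e))))
        = (\<Sum>q<s. \<Sum>j\<le>N. v j * (g j (u q) * (F q v * v N ^ (d - e))))"
      unfolding sum_distrib_left by (rule sum.swap)
    also have "\<dots> = (\<Sum>q<s. v N ^ (d - e) * (F q v * l q v))"
      by (simp add: l_def sum_distrib_left ac_simps)
    finally show ?thesis
      by (simp add: g(2) g'_def right_diff_distrib sum_subtractf)
  qed
  then show ?case using ideal_pow.add[OF 1 2] by presburger
qed

section \<open>Leading forms at a single point\<close>

lemma distinct_coordinate:
  assumes "p < s" "q < s" "p \<noteq> q"
  obtains i where "i < N" "u p i \<noteq> u q i"
proof -
  have "\<exists>i<N. u p i \<noteq> u q i"
  proof (rule ccontr)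
    assume "\<not> ?thesis"
    then have "u p i = u q i" if "i \<le> N" for i
      using that assms normalized by (cases "i = N") auto
    then have "F p (u p) = F p (u q)" by (rule form_cong[OF form_F[OF assms(1)]])
    then show False using assms F_delta by simp
  qed
  then show thesis using that by blast
qed

lemma form_var_diff: "j < N \<Longrightarrow> form N 1 (\<lambda>v. v j - c * v N)"
  by (intro form_diff form_cmult form_var) auto

text \<open>Modulo the square of the ideal, \<open>F p * h\<close> is a combination of products \<open>F p * F q * l\<close> with a
  linear form \<open>l\<close> vanishing at \<open>u p\<close> and \<open>u q\<close>. Writing the last coordinate as the sum of two linear
  forms vanishing at \<open>u p\<close> and at \<open>u q\<close>, respectively, splits such a product into two elements of
  the ideal.\<close>

lemma double_point:
  assumes p: "p < s" and h: "vanishing (Suc e) h" and van: "vanish 2 (u p) h"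
  shows "ideal_pow 2 (2 * Suc e) (\<lambda>v. v N * F p v * h v)"
proof -
  have hp: "h (u p) = 0" using h p by (simp add: vanishing_def)
  obtain g where g: "\<And>j. form N e (g j)"
    "\<And>v. h v = (\<Sum>j<N. (v j - u p j * v N) * g j v)"
  proof -
    obtain g where "\<forall>j. form N (Suc e - 1) (g j)"
      "\<forall>v. h v = h (u p) * v N ^ Suc e + (\<Sum>j<N. (v j - u p j * v N) * g j v)"
      by (rule form_expand_at_point[of N "Suc e" h "u p", OF vanishing_form[OF h] normalized[OF p]])
    then show thesis using that[of g] hp by simp
  qed
  have gp: "g j (u p) = 0" if j: "j < N" for j
  proof -
    \<comment> \<open>On the line in direction \<open>j\<close> only the \<open>j\<close>-th summand
      survives, so \<open>g j (u p)\<close> is a first derivative of \<open>h\<close> at a double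
      point.\<close>
    define w where "w = (\<lambda>i. [:u p i, if i = j then 1 else 0:])"
    have "poly (w i) 0 = u p i" for i by (simp add: w_def)
    then obtain q where q: "\<And>x. h (\<lambda>i. poly (w i) x) = x ^ 2 * poly q x"
      using vanishD[OF van, of w] by blast
    obtain r where r: "\<And>x. g j (\<lambda>i. poly (w i) x) = poly r x"
      using polyfn_arc[OF form_polyfn[OF g(1)]] by blast
    have "h (\<lambda>i. poly (w i) x) = x * poly r x" for x
    proof -
      have "h (\<lambda>i. poly (w i) x)
          = (\<Sum>i<N. (poly (w i) x - u p i * poly (w N) x) * g i (\<lambda>i. poly (w i) x))"
        by (rule g(2))
      also have "\<dots> = (\<Sum>i<N. if i = j then x * g j (\<lambda>i. poly (w i) x) else 0)"
        using j normalized[OF p] by (intro sum.cong) (auto simp: w_def)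
      finally show ?thesis using j r by simp
    qed
    then have "[:0, 1:] * r = [:0, 1:] * ([:0, 1:] * q)"
      using q by (intro poly_eqI_fun) (simp add: power2_eq_square, metis)
    then have "r = [:0, 1:] * q" by (subst (asm) mult_left_cancel) auto
    then show ?thesis using r[of 0] by (simp add: w_def)
  qed
  define l where "l = (\<lambda>q v. \<Sum>j<N. g j (u q) * (v j - u p j * v N))"
  have l: "form N 1 (l q)" "l q (u p) = 0" for q
    unfolding l_def using normalized[OF p] by (intro form_sum form_cmult form_var_diff, simp_all)
  have lq: "l q (u q) = 0" if "q < s" for q
    using h that g(2)[of "u q"] by (simp add: vanishing_def l_def mult.commute)
  define g' where "g' = (\<lambda>j v. g j v - (\<Sum>q<s. g j (u q) * (F q v * v N ^ (e - e))))"
  have "ideal_pow 2 (2 * Suc e) (\<lambda>v. (F p v * (v j - u p j * v N)) * (v N * g' j v))" if "j < N" for j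
  proof (rule ideal_pow_2)
    show "vanishing (Suc e) (\<lambda>v. F p v * (v j - u p j * v N))"
      using p that normalized by (intro vanishing_F_times form_var_diff) auto
    have "vanishing e (g' j)"
      unfolding g'_def by (rule vanishing_interpolation[OF g(1)]) simp
    then show "vanishing (Suc e) (\<lambda>v. v N * g' j v)"
      by (auto simp: vanishing_def intro: form.mult)
  qed
  then have 1: "ideal_pow 2 (2 * Suc e) (\<lambda>v. \<Sum>j<N. (F p v * (v j - u p j * v N)) * (v N * g' j v))"
    by (intro ideal_pow_sum) auto
  have "ideal_pow 2 (2 * Suc e) (\<lambda>v. v N * F p v * F q v * l q v)" if q: "q < s" for q
  proof (cases "p = q")
    case True
    then have "l q = (\<lambda>v. 0)" using gp by (auto simp: l_def)
    then show ?thesis by (simp add: ideal_pow.zero)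
  next
    case False
    obtain i where i: "i < N" "u p i \<noteq> u q i" using distinct_coordinate[OF p q False] .
    define x where "x = (\<lambda>v :: nat \<Rightarrow> 'k. inverse (u q i - u p i) * (v i - u p i * v N))"
    have x: "form N 1 x" "x (u p) = 0" "x (u q) = 1"
      using i normalized p q unfolding x_def by (intro form_cmult form_var_diff, simp_all)
    have "ideal_pow 2 (2 * Suc e) (\<lambda>v. (F p v * x v) * (F q v * l q v))"
      using p q x l lq by (intro ideal_pow_2 vanishing_F_times) auto
    moreover have "ideal_pow 2 (2 * Suc e) (\<lambda>v. (F p v * l q v) * (F q v * (v N - x v)))"
      using p q x l normalized by (intro ideal_pow_2 vanishing_F_times form_diff form_var) auto
    moreover have "v N * F p v * F q v * l q v
        = (F p v * x v) * (F q v * l q v) + (F p v * l q v) * (F q v * (v N - x v))" for v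
      by (simp add: algebra_simps)
    ultimately show ?thesis using ideal_pow.add by presburger
  qed
  then have 2: "ideal_pow 2 (2 * Suc e) (\<lambda>v. \<Sum>q<s. v N * F p v * F q v * l q v)"
    by (intro ideal_pow_sum) auto
  have "v N * F p v * h v = (\<Sum>j<N. (F p v * (v j - u p j * v N)) * (v N * g' j v))
      + (\<Sum>q<s. v N * F p v * F q v * l q v)" for v
  proof -
    have "(\<Sum>j<N. (v j - u p j * v N) * (\<Sum>q<s. g j (u q) * F q v)) = (\<Sum>q<s. F q v * l q v)"
      unfolding l_def sum_distrib_left by (subst sum.swap) (simp add: ac_simps)
    then have "(\<Sum>j<N. (v j - u p j * v N) * g' j v) = h v - (\<Sum>q<s. F q v * l q v)"
      by (simp add: g'_def g(2) right_diff_distrib sum_subtractf)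
    then have "v N * F p v * (\<Sum>j<N. (v j - u p j * v N) * g' j v)
        = v N * F p v * (h v - (\<Sum>q<s. F q v * l q v))" by (rule arg_cong)
    then show ?thesis
      by (simp add: sum_distrib_left right_diff_distrib ac_simps)
  qed
  then show ?thesis using ideal_pow.add[OF 1 2] by presburger
qed

text \<open>A generator is written as \<open>h = h' + F p * l\<close>, where \<open>l\<close> is its
  linear part at \<open>u p\<close> and \<open>h'\<close> vanishes doubly, so that
  \<open>double_point\<close> applies to \<open>h'\<close>. Products of linear parts make up \<phi>,
  the leading form of \<open>f\<close> at \<open>u p\<close>. The scaling condition says that \<phi>
  is homogeneous of degree \<open>k\<close> in the displacement from \<open>u p\<close> and, by
  taking \<open>x = 1\<close>, invariant under translation by \<open>u p\<close>.\<close>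

lemma leading_term:
  assumes p: "p < s"
  shows "ideal_pow k d f \<Longrightarrow> d = k * Suc e \<Longrightarrow>
    \<exists>\<phi>. polyfn \<phi> \<and> (\<forall>x z. \<phi> (\<lambda>i. u p i + x * z i) = x ^ k * \<phi> z) \<and>
      vanish (Suc k) (u p) (\<lambda>v. f v - F p v ^ k * \<phi> v) \<and>
      ideal_pow (Suc k) (d + Suc e) (\<lambda>v. v N * F p v * (f v - F p v ^ k * \<phi> v))"
proof (induction rule: ideal_pow.induct)
  case (base d f)
  define c where "c = f (\<lambda>_. 0)"
  have "f v = c" for v
    using form_scale[of N 0 f 0 v] base by (simp add: c_def)
  then have "f = (\<lambda>v. c)" by (rule ext)
  then show ?case
    using base.prems by (intro exI[of _ "\<lambda>v. c"]) (simp add: polyfn.const ideal_pow.zero)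
next
  case (zero k d)
  show ?case by (intro exI[of _ "\<lambda>v. 0"]) (auto intro: polyfn.const ideal_pow.zero)
next
  case (add k d f g)
  obtain \<phi> where \<phi>: "polyfn \<phi>" "\<forall>x z. \<phi> (\<lambda>i. u p i + x * z i) = x ^ k * \<phi> z"
    "vanish (Suc k) (u p) (\<lambda>v. f v - F p v ^ k * \<phi> v)"
    "ideal_pow (Suc k) (d + Suc e) (\<lambda>v. v N * F p v * (f v - F p v ^ k * \<phi> v))"
    using add.IH(1)[OF add.prems] by blast
  obtain \<psi> where \<psi>: "polyfn \<psi>" "\<forall>x z. \<psi> (\<lambda>i. u p i + x * z i) = x ^ k * \<psi> z"
    "vanish (Suc k) (u p) (\<lambda>v. g v - F p v ^ k * \<psi> v)"
    "ideal_pow (Suc k) (d + Suc e) (\<lambda>v. v N * F p v * (g v - F p v ^ k * \<psi> v))"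
    using add.IH(2)[OF add.prems] by blast
  have eq: "f v + g v - F p v ^ k * (\<phi> v + \<psi> v)
      = (f v - F p v ^ k * \<phi> v) + (g v - F p v ^ k * \<psi> v)" for v
    by (simp add: algebra_simps)
  show ?case
  proof (intro exI[of _ "\<lambda>v. \<phi> v + \<psi> v"] conjI)
    show "ideal_pow (Suc k) (d + Suc e) (\<lambda>v. v N * F p v * (f v + g v - F p v ^ k * (\<phi> v + \<psi> v)))"
      using ideal_pow.add[OF \<phi>(4) \<psi>(4)] unfolding eq by (simp only: distrib_left)
    show "vanish (Suc k) (u p) (\<lambda>v. f v + g v - F p v ^ k * (\<phi> v + \<psi> v))"
      unfolding eq by (rule vanish_add[OF \<phi>(3) \<psi>(3)])
  qed (use \<phi> \<psi> in \<open>simp_all add: polyfn.add distrib_left\<close>)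
next
  case (mult h k d f)
  have d: "d = k * Suc e" using mult.prems by simp
  obtain \<phi> where \<phi>: "polyfn \<phi>" "\<forall>x z. \<phi> (\<lambda>i. u p i + x * z i) = x ^ k * \<phi> z"
    "vanish (Suc k) (u p) (\<lambda>v. f v - F p v ^ k * \<phi> v)"
    "ideal_pow (Suc k) (d + Suc e) (\<lambda>v. v N * F p v * (f v - F p v ^ k * \<phi> v))"
    using mult.IH[OF d] by blast
  have hp: "h (u p) = 0" using mult.hyps(1) p by (simp add: vanishing_def)
  obtain g where g: "\<And>j. form N e (g j)"
    "\<And>v. h v = (\<Sum>j<N. (v j - u p j * v N) * g j v)"
  proof -
    obtain g where "\<forall>j. form N (Suc e - 1) (g j)"
      "\<forall>v. h v = h (u p) * v N ^ Suc e + (\<Sum>j<N. (v j - u p j * v N) * g j v)"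
      by (rule form_expand_at_point[of N "Suc e" h "u p",
            OF vanishing_form[OF mult.hyps(1)] normalized[OF p]])
    then show thesis using that[of g] hp by simp
  qed
  define l where "l = (\<lambda>v. \<Sum>j<N. g j (u p) * (v j - u p j * v N))"
  have l: "form N 1 l" "l (u p) = 0"
    unfolding l_def using normalized[OF p] by (intro form_sum form_cmult form_var_diff, simp_all)
  have l_scale: "l (\<lambda>i. u p i + x * z i) = x * l z" for x z
    unfolding l_def sum_distrib_left using normalized[OF p]
    by (intro sum.cong) (simp_all add: algebra_simps)
  define h' where "h' = (\<lambda>v. h v - F p v * l v)"
  have Fl: "vanishing (Suc e) (\<lambda>v. F p v * l v)"
    by (rule vanishing_F_times[OF p l])
  have h': "vanishing (Suc e) h'"
    using mult.hyps(1) Fl by (auto simp: vanishing_def h'_def intro: form_diff)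
  have "vanish 2 (u p) h'"
  proof -
    have "h' = (\<lambda>v. \<Sum>j<N. (v j - u p j * v N) * (g j v - g j (u p) * F p v))"
      by (rule ext) (simp add: h'_def g(2) l_def sum_distrib_left sum_distrib_right
          right_diff_distrib sum_subtractf ac_simps)
    moreover have "vanish 2 (u p) (\<lambda>v. (v j - u p j * v N) * (g j v - g j (u p) * F p v))"
      if "j < N" for j
    proof -
      have "vanish 1 (u p) (\<lambda>v. v j - u p j * v N)"
        using form_var_diff[OF that] normalized[OF p] by (intro vanish_1I form_polyfn) auto
      moreover have "vanish 1 (u p) (\<lambda>v. g j v - g j (u p) * F p v)"
        by (intro vanish_1I polyfn_diff polyfn.mult polyfn.const polyfn_F[OF p] form_polyfn[OF g(1)])
          (simp add: F_delta[OF p p])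
      ultimately have "vanish (1 + 1) (u p) (\<lambda>v. (v j - u p j * v N) * (g j v - g j (u p) * F p v))"
        by (rule vanish_mult)
      then show ?thesis by (simp only: one_add_one)
    qed
    ultimately show ?thesis
      using vanish_sum[of "{..<N}" 2 "u p" "\<lambda>j v. (v j - u p j * v N) * (g j v - g j (u p) * F p v)"]
      by simp
  qed
  note van_h' = this
  \<comment> \<open>The first summand gains an order through \<open>h'\<close>, the second through
    the difference; after multiplication by \<open>v N * F p v\<close> each gains one power of the
    ideal for the same reason.\<close>
  have eq: "h v * f v - F p v ^ Suc k * (l v * \<phi> v)
      = h' v * f v + (F p v * l v) * (f v - F p v ^ k * \<phi> v)" for v
    by (simp add: h'_def algebra_simps)
  show ?case
  proof (intro exI[of _ "\<lambda>v. l v * \<phi> v"] conjI)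
    show "polyfn (\<lambda>v. l v * \<phi> v)"
      by (intro polyfn.mult form_polyfn[OF l(1)] \<phi>)
    show "\<forall>x z. l (\<lambda>i. u p i + x * z i) * \<phi> (\<lambda>i. u p i + x * z i) = x ^ Suc k * (l z * \<phi> z)"
      using \<phi>(2) by (simp add: l_scale)
    have "vanish (Suc (Suc k)) (u p) (\<lambda>v. h' v * f v)"
      using vanish_mult[OF van_h' ideal_pow_vanish[OF p mult.hyps(2)]] by simp
    moreover have "vanish (Suc (Suc k)) (u p) (\<lambda>v. (F p v * l v) * (f v - F p v ^ k * \<phi> v))"
      using vanish_mult[OF vanish_1I[OF form_polyfn[OF vanishing_form[OF Fl]]] \<phi>(3)] l(2) by simp
    ultimately show "vanish (Suc (Suc k)) (u p) (\<lambda>v. h v * f v - F p v ^ Suc k * (l v * \<phi> v))"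
      unfolding eq by (rule vanish_add)
    have "ideal_pow (Suc (Suc k)) (d + Suc e + Suc e) (\<lambda>v. v N * F p v * h' v * f v)"
      using ideal_pow_times[OF double_point[OF p h' van_h'] mult.hyps(2)]
      by (simp add: numeral_2_eq_2 ac_simps)
    moreover have "ideal_pow (Suc (Suc k)) (d + Suc e + Suc e)
        (\<lambda>v. (F p v * l v) * (v N * F p v * (f v - F p v ^ k * \<phi> v)))"
      by (rule ideal_pow.mult[OF Fl \<phi>(4)])
    moreover have "v N * F p v * (h v * f v - F p v ^ Suc k * (l v * \<phi> v))
        = v N * F p v * h' v * f v + (F p v * l v) * (v N * F p v * (f v - F p v ^ k * \<phi> v))" for v
      unfolding eq by (simp add: algebra_simps)
    ultimately show "ideal_pow (Suc (Suc k)) (d + Suc e + Suc e)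
        (\<lambda>v. v N * F p v * (h v * f v - F p v ^ Suc k * (l v * \<phi> v)))"
      using ideal_pow.add by presburger
  qed
qed

text \<open>Order beyond \<open>k\<close> kills the leading form, because a function that scales by
  \<open>x ^ k\<close> along lines through \<open>u p\<close> has no higher order there unless it is
  0.\<close>

lemma ideal_pow_at_point:
  assumes p: "p < s" and f: "ideal_pow k (k * Suc e) f" and van: "vanish (Suc k) (u p) f"
  shows "ideal_pow (Suc k) (Suc k * Suc e) (\<lambda>v. v N * F p v * f v)"
proof -
  obtain \<phi> where \<phi>: "polyfn \<phi>" "\<forall>x z. \<phi> (\<lambda>i. u p i + x * z i) = x ^ k * \<phi> z"
    "vanish (Suc k) (u p) (\<lambda>v. f v - F p v ^ k * \<phi> v)"
    "ideal_pow (Suc k) (k * Suc e + Suc e) (\<lambda>v. v N * F p v * (f v - F p v ^ k * \<phi> v))"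
    using leading_term[OF p f refl] by blast
  have "vanish (Suc k) (u p) (\<lambda>v. F p v ^ k * \<phi> v)"
    using vanish_diff[OF van \<phi>(3)] by simp
  then have van_\<phi>: "vanish (Suc k) (u p) \<phi>"
    by (rule vanish_cancel_unit[OF \<phi>(1) polyfn_power[OF polyfn_F[OF p]], rotated])
      (simp add: F_delta[OF p p])
  have "\<phi> z = 0" for z
  proof -
    have "poly [:u p i, z i:] 0 = u p i" for i by simp
    then obtain q where q: "\<And>x. \<phi> (\<lambda>i. poly [:u p i, z i:] x) = x ^ Suc k * poly q x"
      using vanishD[OF van_\<phi>, of "\<lambda>i. [:u p i, z i:]"] by blast
    have "[:\<phi> z:] = [:0, 1:] * q"
    proof (rule poly_eqI_cofinite[of 0])
      fix x :: 'k assume "x \<noteq> 0"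
      then show "poly [:\<phi> z:] x = poly ([:0, 1:] * q) x"
        using q[of x] \<phi>(2) by simp
    qed
    from arg_cong[OF this, of "\<lambda>q. poly q 0"] show ?thesis by simp
  qed
  then have "ideal_pow (Suc k) (k * Suc e + Suc e) (\<lambda>v. v N * F p v * f v)"
    using \<phi>(4) by simp
  moreover have "k * Suc e + Suc e = Suc k * Suc e" by simp
  ultimately show ?thesis by (simp only:)
qed

text \<open>Modulo the next power, an element of the \<open>k\<close>-th power is localized:
  \<open>F q\<close> carries the contribution of \<open>u q\<close>, with a factor
  \<open>w q\<close> of the least degree \<open>k (e + 1)\<close>. A further generator
  \<open>h\<close> only multiplies each \<open>w q\<close>.\<close>

lemma ideal_pow_interpolation:
  "ideal_pow k d f \<Longrightarrow> Suc k * Suc e \<le> d \<Longrightarrow>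
    \<exists>w. (\<forall>q. ideal_pow k (k * Suc e) (w q)) \<and>
      ideal_pow (Suc k) d (\<lambda>v. f v - (\<Sum>q<s. F q v * w q v * v N ^ (d - k * Suc e - e)))"
proof (induction rule: ideal_pow.induct)
  case (base d f)
  then have "vanishing d (\<lambda>v. f v - (\<Sum>q<s. f (u q) * (F q v * v N ^ (d - e))))"
    by (intro vanishing_interpolation) auto
  then have "ideal_pow 1 d (\<lambda>v. f v - (\<Sum>q<s. f (u q) * (F q v * v N ^ (d - e))))"
    using base by (intro ideal_pow_1_vanishing) auto
  then show ?case
    by (intro exI[of _ "\<lambda>q v. f (u q)"]) (auto intro: ideal_pow.base form.const simp: ac_simps)
next
  case (zero k d)
  show ?case by (intro exI[of _ "\<lambda>q v. 0"]) (auto intro: ideal_pow.zero)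
next
  case (add k d f g)
  let ?E = "d - k * Suc e - e"
  obtain w where w: "\<forall>q. ideal_pow k (k * Suc e) (w q)"
    "ideal_pow (Suc k) d (\<lambda>v. f v - (\<Sum>q<s. F q v * w q v * v N ^ ?E))"
    using add.IH(1)[OF add.prems] by blast
  obtain w' where w': "\<forall>q. ideal_pow k (k * Suc e) (w' q)"
    "ideal_pow (Suc k) d (\<lambda>v. g v - (\<Sum>q<s. F q v * w' q v * v N ^ ?E))"
    using add.IH(2)[OF add.prems] by blast
  have eq: "f v + g v - (\<Sum>q<s. F q v * (w q v + w' q v) * v N ^ ?E)
      = (f v - (\<Sum>q<s. F q v * w q v * v N ^ ?E)) + (g v - (\<Sum>q<s. F q v * w' q v * v N ^ ?E))" for v
    by (simp add: algebra_simps sum.distrib)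
  show ?case
  proof (intro exI[of _ "\<lambda>q v. w q v + w' q v"] conjI)
    show "ideal_pow (Suc k) d (\<lambda>v. f v + g v - (\<Sum>q<s. F q v * (w q v + w' q v) * v N ^ ?E))"
      unfolding eq by (rule ideal_pow.add[OF w(2) w'(2)])
  qed (use w w' in \<open>auto intro: ideal_pow.add\<close>)
next
  case (mult h k d f)
  let ?E = "d - k * Suc e - e"
  obtain w where w: "\<forall>q. ideal_pow k (k * Suc e) (w q)"
    "ideal_pow (Suc k) d (\<lambda>v. f v - (\<Sum>q<s. F q v * w q v * v N ^ ?E))"
    using mult by auto
  have "ideal_pow (Suc k) (k * Suc e + Suc e) (\<lambda>v. h v * w q v)" for q
    using w(1) mult.hyps(1) by (blast intro: ideal_pow.mult)
  moreover have "ideal_pow (Suc (Suc k)) (d + Suc e)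
      (\<lambda>v. h v * (f v - (\<Sum>q<s. F q v * w q v * v N ^ ?E)))"
    by (rule ideal_pow.mult[OF mult.hyps(1) w(2)])
  moreover have "d + Suc e - Suc k * Suc e - e = ?E" by simp
  ultimately show ?case
    by (intro exI[of _ "\<lambda>q v. h v * w q v"])
      (simp add: right_diff_distrib sum_distrib_left ac_simps)
qed

text \<open>The separators show that \<open>e + 1\<close> bounds the regularity of the ideal, and
  symbolic elements of degree at least \<open>m\<close> times this bound are in the ordinary power.
  In the step from \<open>m\<close> to \<open>m + 1\<close>, all summands but the
  \<open>p\<close>-th have order \<open>m + 1\<close> at \<open>u p\<close>, as \<open>F q\<close>
  contributes one order there. Hence so has the \<open>p\<close>-th, and then \<open>w p\<close>,
  since \<open>F p\<close> and \<open>v N\<close> do not vanish at \<open>u p\<close>.\<close>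

theorem symbolic_power_degree:
  assumes "form N d f" "\<And>p. p < s \<Longrightarrow> vanish m (u p) f" "m * Suc e \<le> d"
  shows "ideal_pow m d f"
  using assms(2,3)
proof (induction m)
  case 0
  then show ?case by (intro ideal_pow.base assms)
next
  case (Suc m)
  have "ideal_pow m d f"
    using Suc.prems by (intro Suc.IH) (auto intro: vanish_mono[of "Suc m"])
  then obtain w where w: "\<And>q. ideal_pow m (m * Suc e) (w q)"
    "ideal_pow (Suc m) d (\<lambda>v. f v - (\<Sum>q<s. F q v * w q v * v N ^ (d - m * Suc e - e)))"
    using ideal_pow_interpolation[OF _ Suc.prems(2)] by blast
  define E where "E = d - m * Suc e - e"
  \<comment> \<open>The degree hypothesis leaves at least one factor \<open>v N\<close>, which
    \<open>ideal_pow_at_point\<close> consumes.\<close>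
  have E: "E = Suc (E - 1)" "d = E - 1 + Suc m * Suc e"
    using Suc.prems(2) by (auto simp: E_def)
  have pw: "polyfn (w q)" for q
    by (rule form_polyfn[OF ideal_pow_form[OF w(1)]])
  have "ideal_pow (Suc m) d (\<lambda>v. F p v * w p v * v N ^ E)" if p: "p < s" for p
  proof -
    have "vanish (Suc m) (u p) (\<lambda>v. f v - (f v - (\<Sum>q<s. F q v * w q v * v N ^ E)))"
      using vanish_diff[OF Suc.prems(1)[OF p] ideal_pow_vanish[OF p w(2)]] unfolding E_def .
    moreover have "vanish (Suc m) (u p) (\<lambda>v. \<Sum>q\<in>{..<s} - {p}. F q v * w q v * v N ^ E)"
    proof (rule vanish_sum)
      fix q assume q: "q \<in> {..<s} - {p}"
      have "vanish 1 (u p) (F q)"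
        using q p by (intro vanish_1I polyfn_F) (auto simp: F_delta)
      from vanish_mult[OF vanish_mult[OF this ideal_pow_vanish[OF p w(1)]]
          vanish_0[OF polyfn_power[OF polyfn.var]], of q N E]
      show "vanish (Suc m) (u p) (\<lambda>v. F q v * w q v * v N ^ E)" by simp
    qed
    ultimately have "vanish (Suc m) (u p) (\<lambda>v. f v - (f v - (\<Sum>q<s. F q v * w q v * v N ^ E))
        - (\<Sum>q\<in>{..<s} - {p}. F q v * w q v * v N ^ E))"
      by (rule vanish_diff)
    moreover have "f v - (f v - (\<Sum>q<s. F q v * w q v * v N ^ E))
        - (\<Sum>q\<in>{..<s} - {p}. F q v * w q v * v N ^ E) = (F p v * v N ^ E) * w p v" for v
      using p by (simp add: sum.remove[of "{..<s}" p])
    ultimately have "vanish (Suc m) (u p) (\<lambda>v. (F p v * v N ^ E) * w p v)" by simp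
    then have "vanish (Suc m) (u p) (w p)"
      by (rule vanish_cancel_unit[OF pw polyfn.mult[OF polyfn_F[OF p] polyfn_power[OF polyfn.var]], rotated])
        (simp add: p F_delta normalized)
    then have "ideal_pow (Suc m) (Suc m * Suc e) (\<lambda>v. v N * F p v * w p v)"
      by (rule ideal_pow_at_point[OF p w(1)])
    then have "ideal_pow (Suc m) (E - 1 + Suc m * Suc e) (\<lambda>v. v N ^ (E - 1) * (v N * F p v * w p v))"
      by (rule ideal_pow_times_form) (auto intro: form_var_power)
    moreover have "v N ^ (E - 1) * (v N * F p v * w p v) = F p v * w p v * v N ^ E" for v
      by (subst (2) E(1)) (simp add: ac_simps)
    ultimately show ?thesis by (simp only: E(2)[symmetric])
  qed
  then have "ideal_pow (Suc m) d (\<lambda>v. \<Sum>q<s. F q v * w q v * v N ^ E)"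
    by (intro ideal_pow_sum) auto
  from ideal_pow.add[OF w(2)[folded E_def] this] show ?case by simp
qed

end

section \<open>Polynomials and polynomial functions\<close>

lemma monom_degree_superset:
  assumes "finite S" "Poly_Mapping.keys t \<subseteq> S"
  shows "monom_degree t = (\<Sum>i\<in>S. Poly_Mapping.lookup t i)"
  unfolding monom_degree_def
  by (rule sum.mono_neutral_left) (use assms in \<open>auto simp: in_keys_iff\<close>)

lemma monom_degree_add: "monom_degree (s + t) = monom_degree s + monom_degree t"
proof -
  let ?S = "Poly_Mapping.keys s \<union> Poly_Mapping.keys t"
  have "monom_degree h = (\<Sum>i\<in>?S. Poly_Mapping.lookup h i)" if "h \<in> {s, t, s + t}" for h
    by (rule monom_degree_superset) (use that Poly_Mapping.keys_add[of s t] in auto)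
  then show ?thesis by (simp add: lookup_add sum.distrib)
qed

lemma monom_eval_upd:
  assumes "v i = 1"
  shows "monom_eval t (v(i := x)) = x ^ Poly_Mapping.lookup t i * monom_eval t v"
proof (cases "i \<in> Poly_Mapping.keys t")
  case True
  then show ?thesis
    using assms by (simp add: monom_eval_def prod.remove[of _ i])
next
  case False
  then have "monom_eval t (v(i := x)) = monom_eval t v"
    unfolding monom_eval_def by (intro prod.cong) auto
  then show ?thesis using False by (simp add: in_keys_iff)
qed

lemma monom_eval_independent:
  fixes c :: "('i \<Rightarrow>\<^sub>0 nat) \<Rightarrow> 'k::field_char_0"
  assumes "finite A" "finite T"
    and "\<And>t t'. t \<in> T \<Longrightarrow> t' \<in> T \<Longrightarrow> (\<And>i. i \<in> A \<Longrightarrow> Poly_Mapping.lookup t i = Poly_Mapping.lookup t' i) \<Longrightarrow> t = t'"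
    and "\<And>v. (\<And>j. j \<notin> A \<Longrightarrow> v j = 1) \<Longrightarrow> (\<Sum>t\<in>T. c t * monom_eval t v) = 0"
    and "t0 \<in> T"
  shows "c t0 = 0"
  using assms
proof (induction A arbitrary: T rule: finite_induct)
  case empty
  then have "T = {t0}" by blast
  then show ?case
    using empty.prems(3)[of "\<lambda>_. 1"] by (simp add: monom_eval_def)
next
  case (insert i A)
  define k where "k = Poly_Mapping.lookup t0 i"
  define T' where "T' = {t \<in> T. Poly_Mapping.lookup t i = k}"
  show ?case
  proof (rule insert.IH[of T'])
    show "finite T'" "t0 \<in> T'" using insert.prems by (auto simp: T'_def k_def)
    show "t = t'" if "t \<in> T'" "t' \<in> T'"
      "\<And>i. i \<in> A \<Longrightarrow> Poly_Mapping.lookup t i = Poly_Mapping.lookup t' i" for t t'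
      using that by (intro insert.prems(2)) (auto simp: T'_def)
    fix v :: "'i \<Rightarrow> 'k" assume v: "\<And>j. j \<notin> A \<Longrightarrow> v j = 1"
    define p where "p = (\<Sum>t\<in>T. monom (c t * monom_eval t v) (Poly_Mapping.lookup t i))"
    have "poly p x = 0" for x
    proof -
      have "poly p x = (\<Sum>t\<in>T. c t * monom_eval t (v(i := x)))"
        using v insert.hyps by (simp add: p_def poly_sum poly_monom monom_eval_upd algebra_simps)
      also have "\<dots> = 0" using v by (intro insert.prems(3)) auto
      finally show ?thesis .
    qed
    then have "p = 0" by (intro poly_eqI_fun) simp
    then have "0 = coeff p k" by simp
    also have "\<dots> = (\<Sum>t\<in>T'. c t * monom_eval t v)"
      unfolding p_def coeff_sum T'_def
      using insert.prems(1) by (subst sum.inter_filter) (auto intro!: sum.cong)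
    finally show "(\<Sum>t\<in>T'. c t * monom_eval t v) = 0" by simp
  qed
qed

lemma poly_eval_eq_0_iff:
  fixes f :: "('i, 'k::field_char_0) mpoly"
  shows "(\<forall>v. poly_eval f v = 0) \<longleftrightarrow> f = 0"
proof
  assume f: "\<forall>v. poly_eval f v = 0"
  have "Poly_Mapping.lookup f t = 0" if t: "t \<in> Poly_Mapping.keys f" for t
  proof (rule monom_eval_independent[of "poly_vars f" "Poly_Mapping.keys f" "Poly_Mapping.lookup f"])
    show "finite (poly_vars f)" by (simp add: poly_vars_def)
    show "t = t'" if "t \<in> Poly_Mapping.keys f" "t' \<in> Poly_Mapping.keys f"
      "\<And>i. i \<in> poly_vars f \<Longrightarrow> Poly_Mapping.lookup t i = Poly_Mapping.lookup t' i" for t t'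
    proof (rule poly_mapping_eqI)
      fix i
      show "Poly_Mapping.lookup t i = Poly_Mapping.lookup t' i"
        using that by (cases "i \<in> poly_vars f") (auto simp: poly_vars_def in_keys_iff)
    qed
  qed (use f t in \<open>auto simp: poly_eval_def\<close>)
  then show "f = 0" by (intro poly_mapping_eqI) (auto simp: in_keys_iff)
qed simp

lemma poly_eval_uminus: "poly_eval (- f) v = - poly_eval f v"
  for f :: "('i, 'k::comm_ring_1) mpoly"
  using poly_eval_add[of f "- f" v] by (simp add: add_eq_0_iff)

lemma poly_eval_diff: "poly_eval (f - g) v = poly_eval f v - poly_eval g v"
  for f :: "('i, 'k::comm_ring_1) mpoly"
  using poly_eval_add[of f "- g" v] by (simp add: poly_eval_uminus)

lemma poly_eval_inject:
  fixes f g :: "('i, 'k::field_char_0) mpoly"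
  assumes "poly_eval f = poly_eval g"
  shows "f = g"
  using poly_eval_eq_0_iff[of "f - g"] assms by (simp add: poly_eval_diff)

lemma monom_eval_cong: "(\<And>i. i \<in> Poly_Mapping.keys t \<Longrightarrow> v i = w i) \<Longrightarrow> monom_eval t v = monom_eval t w"
  unfolding monom_eval_def by (intro prod.cong) auto

lemma poly_eval_cong:
  assumes "poly_vars f \<subseteq> A" "\<And>i. i \<in> A \<Longrightarrow> v i = w i"
  shows "poly_eval f v = poly_eval f w"
  unfolding poly_eval_def
proof (rule sum.cong[OF refl])
  fix t assume "t \<in> Poly_Mapping.keys f"
  then have "monom_eval t v = monom_eval t w"
    using assms by (intro monom_eval_cong) (auto simp: poly_vars_def)
  then show "Poly_Mapping.lookup f t * monom_eval t v = Poly_Mapping.lookup f t * monom_eval t w"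
    by simp
qed

lemma polyfn_monom_eval: "polyfn (monom_eval t)"
  unfolding monom_eval_def by (intro polyfn_prod polyfn_power polyfn.var)

lemma polyfn_poly_eval: "polyfn (poly_eval f)"
  unfolding poly_eval_def by (intro polyfn_sum polyfn.mult polyfn.const polyfn_monom_eval)

lemma form_monom_eval:
  assumes "Poly_Mapping.keys t \<subseteq> {..N}"
  shows "form N (monom_degree t) (monom_eval t)"
proof -
  have "form N (\<Sum>i\<in>S. n i) (\<lambda>v. \<Prod>i\<in>S. v i ^ n i)" if "finite S" "S \<subseteq> {..N}" for S and n :: "nat \<Rightarrow> nat"
    using that
  proof (induction S rule: finite_induct)
    case empty
    show ?case using form.const[of N 1] by simp
  next
    case (insert i S)
    then show ?case
      using form_times[OF form_var_power[of i N "n i"]] by simp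
  qed
  from this[OF finite_keys assms] show ?thesis
    unfolding monom_degree_def monom_eval_def .
qed

lemma form_poly_eval:
  assumes "poly_vars f \<subseteq> {..N}" "\<And>t. t \<in> Poly_Mapping.keys f \<Longrightarrow> monom_degree t = d"
  shows "form N d (poly_eval f)"
  unfolding poly_eval_def
proof (intro form_sum form_cmult)
  fix t assume t: "t \<in> Poly_Mapping.keys f"
  then have "Poly_Mapping.keys t \<subseteq> {..N}" using assms(1) by (auto simp: poly_vars_def)
  from form_monom_eval[OF this] show "form N d (monom_eval t)" using assms(2)[OF t] by simp
qed

lemma form_obtain_poly:
  assumes "form N d f"
  obtains G where "poly_vars G \<subseteq> {..N}" "\<And>t. t \<in> Poly_Mapping.keys G \<Longrightarrow> monom_degree t = d"
    "f = poly_eval G"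
proof -
  have "\<exists>G. poly_vars G \<subseteq> {..N} \<and> (\<forall>t\<in>Poly_Mapping.keys G. monom_degree t = d) \<and> f = poly_eval G"
    using assms
  proof (induction rule: form.induct)
    case (zero d)
    show ?case by (intro exI[of _ 0]) auto
  next
    case (const c)
    show ?case
      by (intro exI[of _ "Poly_Mapping.single 0 c"])
        (auto simp: poly_vars_def monom_degree_def poly_eval_single monom_eval_def)
  next
    case (add d f g)
    then obtain F G where *: "poly_vars F \<subseteq> {..N}" "\<forall>t\<in>Poly_Mapping.keys F. monom_degree t = d"
      "f = poly_eval F" "poly_vars G \<subseteq> {..N}" "\<forall>t\<in>Poly_Mapping.keys G. monom_degree t = d"
      "g = poly_eval G" by blast
    have "poly_vars (F + G) \<subseteq> {..N}" using * poly_vars_add[of F G] by blast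
    moreover have "\<forall>t\<in>Poly_Mapping.keys (F + G). monom_degree t = d"
      using * Poly_Mapping.keys_add[of F G] by blast
    ultimately show ?case
      using * by (intro exI[of _ "F + G"]) (auto simp: poly_eval_add)
  next
    case (mult i d f)
    then obtain F where *: "poly_vars F \<subseteq> {..N}" "\<forall>t\<in>Poly_Mapping.keys F. monom_degree t = d"
      "f = poly_eval F" by blast
    define X :: "(nat, 'a) mpoly" where "X = Poly_Mapping.single (Poly_Mapping.single i 1) 1"
    have X: "poly_vars X \<subseteq> {..N}" "Poly_Mapping.keys X = {Poly_Mapping.single i 1}"
      using mult.hyps(1) by (auto simp: X_def poly_vars_def split: if_splits)
    have "poly_vars (X * F) \<subseteq> {..N}" using X * poly_vars_mult[of X F] by blast
    moreover have "monom_degree t = Suc d" if t: "t \<in> Poly_Mapping.keys (X * F)" for t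
    proof -
      obtain b where "t = Poly_Mapping.single i 1 + b" "b \<in> Poly_Mapping.keys F"
        using subsetD[OF Poly_Mapping.keys_mult t] X(2) by auto
      moreover have "monom_degree (Poly_Mapping.single i 1) = 1" by (simp add: monom_degree_def)
      ultimately show ?thesis using * by (simp add: monom_degree_add)
    qed
    moreover have "poly_eval X v = v i" for v
      by (simp add: X_def poly_eval_single monom_eval_def)
    ultimately show ?case
      using * by (intro exI[of _ "X * F"]) (auto simp: poly_eval_mult)
  qed
  then show thesis using that by blast
qed

section \<open>Homogeneous components and their orders of vanishing\<close>

definition hom_component :: "nat \<Rightarrow> ('i, 'k::comm_monoid_add) mpoly \<Rightarrow> ('i, 'k) mpoly"
  where "hom_component d f = (\<Sum>t\<in>{t \<in> Poly_Mapping.keys f. monom_degree t = d}.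
    Poly_Mapping.single t (Poly_Mapping.lookup f t))"

lemma lookup_hom_component:
  "Poly_Mapping.lookup (hom_component d f) t = (if monom_degree t = d then Poly_Mapping.lookup f t else 0)"
proof -
  have "Poly_Mapping.lookup (hom_component d f) t
      = (\<Sum>s\<in>{t \<in> Poly_Mapping.keys f. monom_degree t = d}. if s = t then Poly_Mapping.lookup f t else 0)"
    unfolding hom_component_def lookup_sum
    by (rule sum.cong) (auto simp: lookup_single when_def)
  then show ?thesis by (simp add: in_keys_iff)
qed

lemma keys_hom_component:
  "Poly_Mapping.keys (hom_component d f) = {t \<in> Poly_Mapping.keys f. monom_degree t = d}"
  by (auto simp: in_keys_iff lookup_hom_component split: if_splits)

lemma poly_vars_hom_component: "poly_vars (hom_component d f) \<subseteq> poly_vars f"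
  by (auto simp: poly_vars_def keys_hom_component)

lemma sum_hom_component: "(\<Sum>d\<in>monom_degree ` Poly_Mapping.keys f. hom_component d f) = f"
proof (rule poly_mapping_eqI)
  fix t
  have "Poly_Mapping.lookup (\<Sum>d\<in>monom_degree ` Poly_Mapping.keys f. hom_component d f) t
      = (\<Sum>d\<in>monom_degree ` Poly_Mapping.keys f. if d = monom_degree t then Poly_Mapping.lookup f t else 0)"
    unfolding lookup_sum by (rule sum.cong) (auto simp: lookup_hom_component)
  also have "\<dots> = Poly_Mapping.lookup f t"
    by (auto simp: in_keys_iff)
  finally show "Poly_Mapping.lookup (\<Sum>d\<in>monom_degree ` Poly_Mapping.keys f. hom_component d f) t
      = Poly_Mapping.lookup f t" .
qed

lemma form_hom_component:
  assumes "poly_vars f \<subseteq> {..N}"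
  shows "form N d (poly_eval (hom_component d f))"
  by (rule form_poly_eval) (use assms poly_vars_hom_component[of d f] in \<open>auto simp: keys_hom_component\<close>)

text \<open>The component of degree \<open>d\<close> scales by \<open>c ^ d\<close>. Along an arc
  scaled by \<open>c\<close>, each coefficient of order below \<open>t\<close> is thus a polynomial
  in \<open>c\<close> that vanishes for all \<open>c \<noteq> 0\<close>, so the contributions of the
  different degrees vanish separately.\<close>

lemma vanish_hom_component:
  fixes f :: "(nat, 'k::field_char_0) mpoly"
  assumes vars: "poly_vars f \<subseteq> {..N}"
    and van: "\<And>c. c \<noteq> 0 \<Longrightarrow> vanish t (\<lambda>i. c * p i) (poly_eval f)"
  shows "vanish t p (poly_eval (hom_component d f))"
  unfolding vanish_def
proof (intro allI impI)
  fix u assume u: "\<forall>i. poly (u i) 0 = p i"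
  define D where "D = insert d (monom_degree ` Poly_Mapping.keys f)"
  have f: "f = (\<Sum>d\<in>D. hom_component d f)"
  proof (cases "d \<in> monom_degree ` Poly_Mapping.keys f")
    case True
    then show ?thesis by (simp add: D_def insert_absorb sum_hom_component)
  next
    case False
    then have "hom_component d f = 0" by (auto simp: hom_component_def intro!: sum.neutral)
    then show ?thesis using False by (simp add: D_def sum_hom_component)
  qed
  have "\<forall>d. \<exists>q. \<forall>x. poly_eval (hom_component d f) (\<lambda>i. poly (u i) x) = poly q x"
    using polyfn_arc[OF polyfn_poly_eval] by blast
  then obtain r where r: "\<And>d x. poly_eval (hom_component d f) (\<lambda>i. poly (u i) x) = poly (r d) x"
    by metis
  have "coeff (r d) k = 0" if k: "k < t" for k
  proof -
    define R where "R = (\<Sum>d\<in>D. monom (coeff (r d) k) d)"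
    have "poly R c = 0" if c: "c \<noteq> 0" for c
    proof -
      have "poly (smult c (u i)) 0 = c * p i" for i using u by simp
      then obtain q where q: "\<And>x. poly_eval f (\<lambda>i. poly (smult c (u i)) x) = x ^ t * poly q x"
        using vanishD[OF van[OF c], of "\<lambda>i. smult c (u i)"] by blast
      have "poly_eval f (\<lambda>i. poly (smult c (u i)) x) = poly (\<Sum>d\<in>D. smult (c ^ d) (r d)) x" for x
      proof -
        have "poly_eval f (\<lambda>i. poly (smult c (u i)) x)
            = (\<Sum>d\<in>D. poly_eval (hom_component d f) (\<lambda>i. c * poly (u i) x))"
          by (subst f) (simp add: poly_eval_sum)
        also have "\<dots> = (\<Sum>d\<in>D. c ^ d * poly (r d) x)"
          by (simp add: form_scale[OF form_hom_component[OF vars]] r)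
        finally show ?thesis by (simp add: poly_sum)
      qed
      then have "(\<Sum>d\<in>D. smult (c ^ d) (r d)) = monom 1 t * q"
        using q by (intro poly_eqI_fun) (simp add: poly_monom)
      then have "coeff (\<Sum>d\<in>D. smult (c ^ d) (r d)) k = coeff (monom 1 t * q) k" by (rule arg_cong)
      also have "\<dots> = 0" using k by (simp add: coeff_monom_mult)
      finally show ?thesis by (simp add: R_def coeff_sum poly_sum poly_monom mult.commute)
    qed
    then have "R = 0" by (intro poly_eqI_cofinite[of 0]) auto
    then have "coeff R d = 0" by simp
    moreover have "coeff R d = coeff (r d) k"
      unfolding R_def coeff_sum by (simp add: D_def)
    ultimately show ?thesis by simp
  qed
  then have "monom 1 t dvd r d" by (simp add: monom_1_dvd_iff')
  then obtain q where "r d = monom 1 t * q" by (rule dvdE)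
  then show "\<exists>q. \<forall>x. poly_eval (hom_component d f) (\<lambda>i. poly (u i) x) = x ^ t * poly q x"
    using r by (auto simp: poly_monom)
qed

section \<open>Powers of ideals of points\<close>

lemmas monoid_ideals_set = comm_monoid.axioms(1)[OF cring.ideals_set_is_comm_monoid[OF cring_poly_ring]]

lemma ideal_power_0: "ideal_power N J 0 = carrier (hom_coord_ring N :: (nat, 'k::field) mpoly ring)"
  unfolding ideal_power_def monoid.nat_pow_0[OF monoid_ideals_set] by (simp add: ideals_set_def)

lemma ideal_power_Suc:
  "ideal_power N J (Suc m) = ideal_prod (hom_coord_ring N :: (nat, 'k::field) mpoly ring) (ideal_power N J m) J"
  unfolding ideal_power_def monoid.nat_pow_Suc[OF monoid_ideals_set] by (simp add: ideals_set_def)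

lemma ideal_ideal_power:
  assumes "ideal J (hom_coord_ring N :: (nat, 'k::field) mpoly ring)"
  shows "ideal (ideal_power N J m) (hom_coord_ring N)"
proof -
  interpret cring "hom_coord_ring N :: (nat, 'k) mpoly ring" by (rule cring_poly_ring)
  show ?thesis
    by (induction m) (simp_all only: ideal_power_0 ideal_power_Suc oneideal ideal_prod_is_ideal assms)
qed

lemma ideal_power_1:
  assumes "ideal J (hom_coord_ring N :: (nat, 'k::field) mpoly ring)"
  shows "ideal_power N J 1 = J"
proof -
  interpret monoid "ideals_set (hom_coord_ring N :: (nat, 'k) mpoly ring)" by (rule monoid_ideals_set)
  have "J \<in> carrier (ideals_set (hom_coord_ring N))" using assms by (simp add: ideals_set_def)
  then show ?thesis unfolding ideal_power_def by simp
qed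

lemma ideal_point_ideal: "ideal (point_ideal N P) (hom_coord_ring N :: (nat, 'k::field) mpoly ring)"
proof -
  interpret cring "hom_coord_ring N :: (nat, 'k) mpoly ring" by (rule cring_poly_ring)
  show ?thesis unfolding point_ideal_def by (rule genideal_ideal) auto
qed

lemma ideal_points_ideal:
  assumes "0 < s"
  shows "ideal (points_ideal N s P) (hom_coord_ring N :: (nat, 'k::field) mpoly ring)"
proof -
  interpret cring "hom_coord_ring N :: (nat, 'k) mpoly ring" by (rule cring_poly_ring)
  have "ideal (\<Inter>((\<lambda>i. point_ideal N (P i)) ` {..<s})) (hom_coord_ring N)"
    using assms by (intro i_Intersect) (auto simp: ideal_point_ideal)
  then show ?thesis by (simp add: points_ideal_def)
qed

lemma point_ideal_I:
  assumes "poly_vars f \<subseteq> {..N}" "homogeneous f" "\<And>v. v \<in> P \<Longrightarrow> poly_eval f v = 0"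
  shows "f \<in> point_ideal N (P :: (nat \<Rightarrow> 'k::field) set)"
proof -
  interpret cring "hom_coord_ring N :: (nat, 'k) mpoly ring" by (rule cring_poly_ring)
  show ?thesis unfolding point_ideal_def by (rule subsetD[OF genideal_self]) (use assms in auto)
qed

lemma point_ideal_eval:
  assumes "f \<in> point_ideal N (P :: (nat \<Rightarrow> 'k::field) set)" "v \<in> P"
  shows "poly_eval f v = 0"
proof -
  interpret cring "hom_coord_ring N :: (nat, 'k) mpoly ring" by (rule cring_poly_ring)
  let ?I = "{f \<in> carrier (hom_coord_ring N). poly_eval f v = 0}"
  have "ideal ?I (hom_coord_ring N)"
  proof (rule idealI)
    show "ring (hom_coord_ring N :: (nat, 'k) mpoly ring)" by (rule ring_axioms)
    show "subgroup ?I (add_monoid (hom_coord_ring N))"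
    proof (rule group.subgroupI)
      show "group (add_monoid (hom_coord_ring N :: (nat, 'k) mpoly ring))" by (rule a_group)
      show "?I \<noteq> {}" by (auto intro!: exI[of _ 0])
      fix f g assume f: "f \<in> ?I"
      have "inv\<^bsub>add_monoid (hom_coord_ring N)\<^esub> f = - f"
      proof -
        have "\<ominus>\<^bsub>hom_coord_ring N\<^esub> f = - f"
          using f by (intro minus_equality) auto
        then show ?thesis by (simp add: a_inv_def)
      qed
      then show "inv\<^bsub>add_monoid (hom_coord_ring N)\<^esub> f \<in> ?I"
        using f by (simp add: poly_eval_uminus)
      assume "g \<in> ?I"
      then show "f \<otimes>\<^bsub>add_monoid (hom_coord_ring N)\<^esub> g \<in> ?I"
        using f poly_vars_add[of f g] by (auto simp: poly_eval_add)
    qed auto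
    fix f g :: "(nat, 'k) mpoly" assume f: "f \<in> ?I" and g: "g \<in> carrier (hom_coord_ring N)"
    show "g \<otimes>\<^bsub>hom_coord_ring N\<^esub> f \<in> ?I" "f \<otimes>\<^bsub>hom_coord_ring N\<^esub> g \<in> ?I"
      using f g poly_vars_mult[of f g] poly_vars_mult[of g f] by (auto simp: poly_eval_mult)
  qed
  then have "point_ideal N P \<subseteq> ?I"
    unfolding point_ideal_def by (rule genideal_minimal) (use assms in auto)
  then show ?thesis using assms(1) by blast
qed

lemma ideal_power_vanish:
  fixes J :: "(nat, 'k::field_char_0) mpoly set"
  assumes "\<And>g. g \<in> J \<Longrightarrow> poly_eval g p = 0"
  shows "f \<in> ideal_power N J t \<Longrightarrow> vanish t p (poly_eval f)"
proof (induction t arbitrary: f)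
  case 0
  then show ?case by (simp add: vanish_0 polyfn_poly_eval)
next
  case (Suc t)
  from Suc.prems show ?case
    unfolding ideal_power_Suc
  proof (induction rule: ideal_prod.induct)
    case (prod i j)
    have "vanish 1 p (poly_eval j)" using assms prod by (intro vanish_1I polyfn_poly_eval) auto
    from vanish_mult[OF Suc.IH[OF prod(1)] this] show ?case
      by (simp add: poly_eval_mult[abs_def])
  next
    case (sum f g)
    then show ?case using vanish_add by (simp add: poly_eval_add[abs_def])
  qed
qed

section \<open>Very general points\<close>

lemma poly_eval_arc: "\<exists>q. \<forall>x. poly_eval f (\<lambda>i. poly (u i) x) = poly q x"
  for f :: "('i, 'k::comm_ring_1) mpoly"
  by (intro exI[of _ "\<Sum>t\<in>Poly_Mapping.keys f. smult (Poly_Mapping.lookup f t)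
        (\<Prod>i\<in>Poly_Mapping.keys t. u i ^ Poly_Mapping.lookup t i)"])
    (simp add: poly_eval_def monom_eval_def poly_sum poly_prod poly_power)

text \<open>Two nonempty open sets meet: on the line from \<open>w\<close> to \<open>v0\<close> both
  \<open>f\<close> and \<open>g\<close> are nonzero polynomials in one variable, and the field is
  infinite.\<close>

lemma zariski_dense_open_nonzero:
  fixes g :: "('i, 'k::field_char_0) mpoly"
  assumes g: "poly_vars g \<subseteq> A" "poly_eval g v0 \<noteq> 0"
  shows "zariski_dense_open A {v \<in> affine_space A. poly_eval g v \<noteq> 0}"
  unfolding zariski_dense_open_def
proof
  let ?U = "{v \<in> affine_space A. poly_eval g v \<noteq> 0}"
  have "?U = affine_space A - zero_locus A {g}" by (auto simp: zero_locus_def)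
  then show "openin (zariski A) ?U"
    unfolding openin_zariski using g(1) by (intro exI[of _ "{g}"]) auto
  show "zariski A closure_of ?U = topspace (zariski A)"
    unfolding dense_intersects_open
  proof (intro allI impI)
    fix T :: "('i \<Rightarrow> 'k) set" assume T: "openin (zariski A) T \<and> T \<noteq> {}"
    then obtain F where F: "F \<subseteq> carrier (poly_ring A)" "T = affine_space A - zero_locus A F"
      unfolding openin_zariski by blast
    with T obtain w f where w: "w \<in> affine_space A" "f \<in> F" "poly_eval f w \<noteq> 0"
      by (auto simp: zero_locus_def)
    define u where "u = (\<lambda>i. [:w i, v0 i - w i:])"
    obtain p q where p: "\<And>x. poly_eval f (\<lambda>i. poly (u i) x) = poly p x"
      and q: "\<And>x. poly_eval g (\<lambda>i. poly (u i) x) = poly q x"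
      using poly_eval_arc by metis
    have "poly p 0 \<noteq> 0" "poly q 1 \<noteq> 0"
      using p[of 0] q[of 1] w g by (simp_all add: u_def)
    then have "p * q \<noteq> 0" by auto
    then have "finite {x. poly (p * q) x = 0}" by (rule poly_roots_finite)
    then obtain x where x: "poly (p * q) x \<noteq> 0"
      using ex_new_if_finite[OF infinite_UNIV_char_0[where 'a = 'k]] by blast
    \<comment> \<open>Elements of \<open>affine_space A\<close> are \<open>undefined\<close> outside
      \<open>A\<close>; polynomials in the variables \<open>A\<close> do not see this.\<close>
    define v where "v = restrict (\<lambda>i. poly (u i) x) A"
    have v: "v \<in> affine_space A" by (simp add: v_def affine_space_def)
    have "poly_vars f \<subseteq> A" using F(1) w(2) by auto
    then have "poly_eval f v = poly p x" "poly_eval g v = poly q x"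
      using g(1) poly_eval_cong[of _ A v "\<lambda>i. poly (u i) x"] by (simp_all add: v_def flip: p q)
    then have "v \<in> ?U \<inter> T" using x v w(2) by (auto simp: F(2) zero_locus_def intro!: bexI[of _ f])
    then show "?U \<inter> T \<noteq> {}" by blast
  qed
qed

text \<open>The value at \<open>v0\<close> certifies that \<open>g\<close> is nonzero, so that a
  special configuration can be supplied directly as the witness of density.\<close>

definition general :: "'i set \<Rightarrow> (('i \<Rightarrow> 'k::field_char_0) \<Rightarrow> bool) \<Rightarrow> bool"
  where "general A \<Phi> \<longleftrightarrow> (\<exists>g v0. poly_vars g \<subseteq> A \<and> poly_eval g v0 \<noteq> 0 \<and> (\<forall>v. poly_eval g v \<noteq> 0 \<longrightarrow> \<Phi> v))"

lemma very_general_pointsI: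
  fixes \<Phi> :: "nat \<Rightarrow> (nat \<times> nat \<Rightarrow> 'k::field_char_0) \<Rightarrow> bool"
  assumes "\<And>k. general ({..<s} \<times> {..N}) (\<Phi> k)"
    and "\<And>l. (\<And>k. \<Phi> k l) \<Longrightarrow> (\<forall>i<s. param_point N l i \<in> proj_space N) \<and>
      inj_on (param_point N l) {..<s} \<and> Q (param_point N l)"
  shows "very_general_points N s Q"
proof -
  let ?A = "{..<s} \<times> {..N}"
  have "\<forall>k. \<exists>g. poly_vars g \<subseteq> ?A \<and> (\<exists>v0. poly_eval g v0 \<noteq> 0) \<and> (\<forall>v. poly_eval g v \<noteq> 0 \<longrightarrow> \<Phi> k v)"
    using assms(1) unfolding general_def by fast
  from choice[OF this] obtain g where g: "\<forall>k. poly_vars (g k) \<subseteq> ?A \<and> (\<exists>v0. poly_eval (g k) v0 \<noteq> 0) \<and>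
    (\<forall>v. poly_eval (g k) v \<noteq> 0 \<longrightarrow> \<Phi> k v)" ..
  define U where "U = (\<lambda>k. {v \<in> affine_space ?A. poly_eval (g k) v \<noteq> 0})"
  have "zariski_dense_open ?A (U k)" for k
  proof -
    obtain v0 where "poly_eval (g k) v0 \<noteq> 0" using g by fast
    then show ?thesis unfolding U_def using g by (intro zariski_dense_open_nonzero) auto
  qed
  moreover have "\<forall>l\<in>(\<Inter>k. U k). (\<forall>i<s. param_point N l i \<in> proj_space N) \<and>
      inj_on (param_point N l) {..<s} \<and> Q (param_point N l)"
  proof
    fix l assume l: "l \<in> (\<Inter>k. U k)"
    show "(\<forall>i<s. param_point N l i \<in> proj_space N) \<and> inj_on (param_point N l) {..<s} \<and> Q (param_point N l)"
    proof (rule assms(2))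
      fix k
      have "poly_eval (g k) l \<noteq> 0" using l by (simp add: U_def)
      then show "\<Phi> k l" using g by simp
    qed
  qed
  ultimately show ?thesis
    unfolding very_general_points_def by (intro exI[of _ U] conjI allI)
qed

section \<open>Conditions polynomial in the coordinates of the points\<close>

definition poly_functions :: "'i set \<Rightarrow> (('i \<Rightarrow> 'k::comm_ring_1) \<Rightarrow> 'k) set"
  where "poly_functions A = {poly_eval g |g. poly_vars g \<subseteq> A}"

lemma poly_functions_const: "(\<lambda>v. c) \<in> poly_functions A"
proof -
  have "(\<lambda>v. c) = poly_eval (Poly_Mapping.single 0 c)"
    by (rule ext) (simp add: poly_eval_single monom_eval_def)
  then show ?thesis unfolding poly_functions_def
    by (auto simp: poly_vars_def intro!: exI[of _ "Poly_Mapping.single 0 c"] split: if_splits)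
qed

lemma poly_functions_var: "i \<in> A \<Longrightarrow> (\<lambda>v. v i) \<in> poly_functions A"
proof -
  assume i: "i \<in> A"
  let ?X = "Poly_Mapping.single (Poly_Mapping.single i 1) 1"
  have "(\<lambda>v. v i) = poly_eval ?X"
    by (rule ext) (simp add: poly_eval_single monom_eval_def)
  moreover have "poly_vars ?X \<subseteq> A" using i by (auto simp: poly_vars_def split: if_splits)
  ultimately show ?thesis unfolding poly_functions_def by blast
qed

lemma poly_functions_mult:
  assumes "f \<in> poly_functions A" "g \<in> poly_functions A"
  shows "(\<lambda>v. f v * g v) \<in> poly_functions A"
proof -
  from assms obtain F G where *: "f = poly_eval F" "poly_vars F \<subseteq> A" "g = poly_eval G" "poly_vars G \<subseteq> A"
    by (auto simp: poly_functions_def)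
  then have "(\<lambda>v. f v * g v) = poly_eval (F * G)" by (auto simp: poly_eval_mult)
  moreover have "poly_vars (F * G) \<subseteq> A" using * poly_vars_mult[of F G] by blast
  ultimately show ?thesis unfolding poly_functions_def by blast
qed

lemma poly_functions_add:
  assumes "f \<in> poly_functions A" "g \<in> poly_functions A"
  shows "(\<lambda>v. f v + g v) \<in> poly_functions A"
proof -
  from assms obtain F G where *: "f = poly_eval F" "poly_vars F \<subseteq> A" "g = poly_eval G" "poly_vars G \<subseteq> A"
    by (auto simp: poly_functions_def)
  then have "(\<lambda>v. f v + g v) = poly_eval (F + G)" by (auto simp: poly_eval_add)
  moreover have "poly_vars (F + G) \<subseteq> A" using * poly_vars_add[of F G] by blast
  ultimately show ?thesis unfolding poly_functions_def by blast
qed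

lemma poly_functions_diff:
  assumes "f \<in> poly_functions A" "g \<in> poly_functions A"
  shows "(\<lambda>v. f v - g v) \<in> poly_functions A"
  using poly_functions_add[OF assms(1) poly_functions_mult[OF poly_functions_const[of "-1"] assms(2)]]
  by simp

lemma poly_functions_sum:
  "(\<And>a. a \<in> S \<Longrightarrow> f a \<in> poly_functions A) \<Longrightarrow> (\<lambda>v. \<Sum>a\<in>S. f a v) \<in> poly_functions A"
  by (induction S rule: infinite_finite_induct)
    (auto intro: poly_functions_add poly_functions_const)

lemma poly_functions_coeff_mult:
  assumes "\<And>k. (\<lambda>l. coeff (p l) k) \<in> poly_functions A" "\<And>k. (\<lambda>l. coeff (q l) k) \<in> poly_functions A"
  shows "(\<lambda>l. coeff (p l * q l) k) \<in> poly_functions A"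
  unfolding coeff_mult by (intro poly_functions_sum poly_functions_mult assms)

lemma poly_functions_coeff_power:
  assumes "\<And>k. (\<lambda>l. coeff (p l) k) \<in> poly_functions A"
  shows "(\<lambda>l. coeff (p l ^ n) k) \<in> poly_functions A"
proof (induction n arbitrary: k)
  case 0
  show ?case by (simp only: power_0 poly_functions_const)
next
  case (Suc n)
  show ?case unfolding power_Suc by (rule poly_functions_coeff_mult[OF assms Suc])
qed

lemma poly_functions_coeff_prod:
  assumes "\<And>a k. a \<in> S \<Longrightarrow> (\<lambda>l. coeff (p a l) k) \<in> poly_functions A"
  shows "(\<lambda>l. coeff (\<Prod>a\<in>S. p a l) k) \<in> poly_functions A"
  using assms
proof (induction S arbitrary: k rule: infinite_finite_induct)
  case (insert a S)
  then show ?case by (simp add: poly_functions_coeff_mult)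
next
  case (infinite S)
  show ?case unfolding prod.infinite[OF infinite(1)] by (rule poly_functions_const)
qed (simp only: prod.empty poly_functions_const)

lemma general_injectivity:
  fixes M :: "'c \<Rightarrow> 'b \<Rightarrow> ('i \<Rightarrow> 'k::field_char_0) \<Rightarrow> 'k"
  assumes "finite B" "\<And>c b. b \<in> B \<Longrightarrow> M c b \<in> poly_functions A"
    and "\<And>x. (\<And>c. (\<Sum>b\<in>B. M c b l0 * x b) = 0) \<Longrightarrow> \<forall>b\<in>B. x b = 0"
  shows "general A (\<lambda>l. \<forall>x. (\<forall>c. (\<Sum>b\<in>B. M c b l * x b) = 0) \<longrightarrow> (\<forall>b\<in>B. x b = 0))"
proof -
  have "\<exists>D\<in>poly_functions A. D l0 \<noteq> 0 \<and>
      (\<forall>l x. D l \<noteq> 0 \<longrightarrow> (\<forall>c. (\<Sum>b\<in>B. M c b l * x b) = 0) \<longrightarrow> (\<forall>b\<in>B. x b = 0))"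
    by (rule generic_injectivity[OF assms(1)])
      (use assms(2,3) in \<open>auto intro: poly_functions_const poly_functions_mult poly_functions_diff\<close>)
  then obtain g where "poly_vars g \<subseteq> A" "poly_eval g l0 \<noteq> 0"
    "\<And>l x. poly_eval g l \<noteq> 0 \<Longrightarrow> (\<forall>c. (\<Sum>b\<in>B. M c b l * x b) = 0) \<Longrightarrow> (\<forall>b\<in>B. x b = 0)"
    unfolding poly_functions_def by blast
  then show ?thesis unfolding general_def by blast
qed

lemma general_True: "general A (\<lambda>l. True)"
  unfolding general_def by (intro exI[of _ 1]) auto

lemma general_mono: "general A \<Phi> \<Longrightarrow> (\<And>l. \<Phi> l \<Longrightarrow> \<Psi> l) \<Longrightarrow> general A \<Psi>"
  unfolding general_def by blast

lemma general_last_coordinate: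
  fixes s N :: nat
  shows "general ({..<s} \<times> {..N}) (\<lambda>l. \<forall>i<s. l (i, N) \<noteq> (0 :: 'k::field_char_0))"
proof -
  have "(\<lambda>l :: nat \<times> nat \<Rightarrow> 'k. \<Prod>i\<in>S. l (i, N)) \<in> poly_functions ({..<s} \<times> {..N})"
    if "S \<subseteq> {..<s}" for S
    using finite_subset[OF that finite_lessThan] that
    by (induction S rule: finite_induct)
      (auto intro: poly_functions_const poly_functions_mult poly_functions_var)
  from this[of "{..<s}"] obtain g :: "(nat \<times> nat, 'k) mpoly" where
    g: "(\<lambda>l. \<Prod>i<s. l (i, N)) = poly_eval g" "poly_vars g \<subseteq> {..<s} \<times> {..N}"
    by (auto simp: poly_functions_def)
  have "poly_eval g (\<lambda>_. 1) = 1" by (simp flip: g(1))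
  moreover have "\<forall>i<s. l (i, N) \<noteq> 0" if "poly_eval g l \<noteq> 0" for l
    using that by (simp flip: g(1))
  ultimately show ?thesis unfolding general_def using g(2) by (intro exI[of _ g] exI[of _ "\<lambda>_. 1"]) auto
qed

section \<open>Forms given by coefficients, and their behaviour at general points\<close>

lemma finite_monomials: "finite {t :: 'i \<Rightarrow>\<^sub>0 nat. Poly_Mapping.keys t \<subseteq> A \<and> monom_degree t = d}"
  if "finite A"
proof (rule finite_imageD)
  let ?B = "{t :: 'i \<Rightarrow>\<^sub>0 nat. Poly_Mapping.keys t \<subseteq> A \<and> monom_degree t = d}"
  have "Poly_Mapping.lookup t i \<le> d" if "t \<in> ?B" for t i
  proof (cases "i \<in> Poly_Mapping.keys t")
    case True
    then have "Poly_Mapping.lookup t i \<le> monom_degree t"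
      unfolding monom_degree_def by (intro member_le_sum) auto
    then show ?thesis using that by simp
  qed (auto simp: in_keys_iff)
  then have "(\<lambda>t. restrict (Poly_Mapping.lookup t) A) ` ?B \<subseteq> PiE A (\<lambda>_. {..d})" by auto
  then show "finite ((\<lambda>t. restrict (Poly_Mapping.lookup t) A) ` ?B)"
    by (rule finite_subset) (simp add: finite_PiE that)
  show "inj_on (\<lambda>t. restrict (Poly_Mapping.lookup t) A) ?B"
  proof (rule inj_onI)
    fix t t' assume t: "t \<in> ?B" "t' \<in> ?B"
      "restrict (Poly_Mapping.lookup t) A = restrict (Poly_Mapping.lookup t') A"
    show "t = t'"
    proof (rule poly_mapping_eqI)
      fix i
      show "Poly_Mapping.lookup t i = Poly_Mapping.lookup t' i"
      proof (cases "i \<in> A")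
        case True
        then show ?thesis using fun_cong[OF t(3), of i] by simp
      next
        case False
        then have "i \<notin> Poly_Mapping.keys t" "i \<notin> Poly_Mapping.keys t'" using t by auto
        then show ?thesis by (simp add: in_keys_iff)
      qed
    qed
  qed
qed

definition monomials :: "nat \<Rightarrow> nat \<Rightarrow> (nat \<Rightarrow>\<^sub>0 nat) set"
  where "monomials N d = {t. Poly_Mapping.keys t \<subseteq> {..N} \<and> monom_degree t = d}"

lemma finite_monomials': "finite (monomials N d)"
  unfolding monomials_def by (rule finite_monomials) simp

lemma form_monomials: "form N d (\<lambda>v. \<Sum>t\<in>monomials N d. x t * monom_eval t v)"
  by (intro form_sum form_cmult) (auto simp: monomials_def intro: form_monom_eval)

lemma form_obtain_monomials:
  assumes "form N d f"
  obtains x where "f = (\<lambda>v. \<Sum>t\<in>monomials N d. x t * monom_eval t v)"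
proof -
  obtain G where G: "poly_vars G \<subseteq> {..N}" "\<And>t. t \<in> Poly_Mapping.keys G \<Longrightarrow> monom_degree t = d"
    "f = poly_eval G" using form_obtain_poly[OF assms] by blast
  then have "Poly_Mapping.keys G \<subseteq> monomials N d" by (auto simp: monomials_def poly_vars_def)
  from poly_eval_superset[OF finite_monomials' this] show thesis
    using that[of "Poly_Mapping.lookup G"] G(3) by auto
qed

lemma monomials_independent:
  fixes x :: "(nat \<Rightarrow>\<^sub>0 nat) \<Rightarrow> 'k::field_char_0"
  assumes "\<And>v. (\<Sum>t\<in>monomials N d. x t * monom_eval t v) = 0" "t \<in> monomials N d"
  shows "x t = 0"
proof (rule monom_eval_independent[OF _ finite_monomials' _ assms(1,2)])
  show "t = t'" if "t \<in> monomials N d" "t' \<in> monomials N d"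
    "\<And>i. i \<in> {..N} \<Longrightarrow> Poly_Mapping.lookup t i = Poly_Mapping.lookup t' i" for t t'
  proof (rule poly_mapping_eqI)
    fix i
    show "Poly_Mapping.lookup t i = Poly_Mapping.lookup t' i"
    proof (cases "i \<in> {..N}")
      case False
      then have "i \<notin> Poly_Mapping.keys t" "i \<notin> Poly_Mapping.keys t'"
        using that(1,2) unfolding monomials_def by blast+
      then show ?thesis by (simp add: in_keys_iff)
    qed (rule that(3))
  qed
qed simp

lemma form_dehomogenize: "form N d f \<Longrightarrow> poly_deg_le N d (\<lambda>v. f (v(N := 1)))"
proof (induction rule: form.induct)
  case (mult i d f)
  show ?case
  proof (cases "i = N")
    case True
    then show ?thesis using poly_deg_le_Suc[OF mult.IH] by simp
  next
    case False
    then show ?thesis using poly_deg_le.mult[OF _ mult.IH, of i] mult.hyps(1) by simp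
  qed
qed (auto intro: poly_deg_le.intros)

lemma form_homogenize: "poly_deg_le N d f \<Longrightarrow> \<exists>g. form N d g \<and> (\<forall>v. g (v(N := 1)) = f v)"
proof (induction rule: poly_deg_le.induct)
  case (const d c)
  show ?case
    by (intro exI[of _ "\<lambda>v. c * v N ^ d"]) (simp add: form_cmult form_var_power)
next
  case (add d f g)
  then obtain f' g' where "form N d f'" "\<forall>v. f' (v(N := 1)) = f v" "form N d g'" "\<forall>v. g' (v(N := 1)) = g v"
    by blast
  then show ?case by (intro exI[of _ "\<lambda>v. f' v + g' v"]) (simp add: form.add del: fun_upd_apply)
next
  case (mult i d f)
  then obtain f' where "form N d f'" "\<forall>v. f' (v(N := 1)) = f v" by blast
  moreover have "(v(N := 1)) i = v i" for v :: "nat \<Rightarrow> 'a" using mult.hyps(1) by simp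
  ultimately show ?case
    using mult.hyps by (intro exI[of _ "\<lambda>v. v i * f' v"]) (simp add: form.mult del: fun_upd_apply)
qed

lemma form_eq_0_if_dehomogenized:
  fixes f :: "(nat \<Rightarrow> 'k::field_char_0) \<Rightarrow> 'k"
  assumes f: "form N d f" and "\<And>v. f (v(N := 1)) = 0"
  shows "f v = 0"
proof -
  have nz: "f v = 0" if "v N \<noteq> 0" for v
  proof -
    let ?w = "\<lambda>i. inverse (v N) * v i"
    have "?w = ?w(N := 1)" using that by auto
    then have "f ?w = 0" using assms(2)[of ?w] by simp
    moreover have "f (\<lambda>i. v N * ?w i) = v N ^ d * f ?w" by (rule form_scale[OF f])
    ultimately show ?thesis using that by (simp add: mult.assoc[symmetric])
  qed
  obtain q where q: "\<And>x. f (\<lambda>i. poly (if i = N then [:0, 1:] else [:v i:]) x) = poly q x"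
    using polyfn_arc[OF form_polyfn[OF f], of "\<lambda>i. if i = N then [:0, 1:] else [:v i:]"] by blast
  have "q = 0"
  proof (rule poly_eqI_cofinite[of 0])
    fix x :: 'k assume "x \<noteq> 0"
    then show "poly q x = poly 0 x" unfolding q[symmetric] by (simp add: nz)
  qed
  have "(\<lambda>i. poly (if i = N then [:0, 1:] else [:v i:]) (v N)) = v" by auto
  then show ?thesis using q[of "v N"] \<open>q = 0\<close> by simp
qed

text \<open>Order \<open>t\<close> at the \<open>i\<close>-th point is a system of linear equations
  in the coefficients of the form, one for each displacement arc \<open>w\<close> through the origin
  and each \<open>k < t\<close>. Their entries are polynomial in the coordinates of the points, so
  injectivity spreads from the configuration \<open>P\<close>, placed in the chart
  \<open>v N = 1\<close>, to general points.\<close>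

lemma general_no_form:
  fixes P :: "nat \<Rightarrow> nat \<Rightarrow> 'k::field_char_0"
  assumes P: "\<And>f v. poly_deg_le N d f \<Longrightarrow> (\<And>i. i < s \<Longrightarrow> vanish t (P i) f) \<Longrightarrow> f v = 0"
  shows "general ({..<s} \<times> {..N}) (\<lambda>l. \<forall>f :: (nat \<Rightarrow> 'k) \<Rightarrow> 'k. form N d f \<longrightarrow>
    (\<forall>i<s. vanish t (\<lambda>j. l (i, j)) f) \<longrightarrow> (\<forall>v. f v = 0))"
proof -
  define shift where "shift = (\<lambda>(\<tau> :: nat \<Rightarrow>\<^sub>0 nat) (i :: nat) (w :: nat \<Rightarrow> 'k poly) (l :: nat \<times> nat \<Rightarrow> 'k).
    \<Prod>j\<in>Poly_Mapping.keys \<tau>. ([:l (i, j):] + w j) ^ Poly_Mapping.lookup \<tau> j)"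
  \<comment> \<open>Indices that describe no equation get a zero row.\<close>
  define M where "M = (\<lambda>(i, w, k) \<tau> l.
    if i < s \<and> k < t \<and> (\<forall>j. poly (w j) 0 = 0) then coeff (shift \<tau> i w l) k else 0)"
  have poly_shift: "poly (shift \<tau> i w l) x = monom_eval \<tau> (\<lambda>j. l (i, j) + poly (w j) x)" for \<tau> i w l x
    by (simp add: shift_def monom_eval_def poly_prod poly_power)
  define f where "f = (\<lambda>x v. \<Sum>\<tau>\<in>monomials N d. x \<tau> * monom_eval \<tau> v :: 'k)"
  have vanish_iff: "vanish t (\<lambda>j. l (i, j)) (f x) \<longleftrightarrow>
      (\<forall>w k. (\<Sum>\<tau>\<in>monomials N d. M (i, w, k) \<tau> l * x \<tau>) = 0)" if i: "i < s" for l i x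
  proof
    assume van: "vanish t (\<lambda>j. l (i, j)) (f x)"
    show "\<forall>w k. (\<Sum>\<tau>\<in>monomials N d. M (i, w, k) \<tau> l * x \<tau>) = 0"
    proof (intro allI)
      fix w k
      show "(\<Sum>\<tau>\<in>monomials N d. M (i, w, k) \<tau> l * x \<tau>) = 0"
      proof (cases "k < t \<and> (\<forall>j. poly (w j) 0 = 0)")
        case True
        then have "poly ([:l (i, j):] + w j) 0 = l (i, j)" for j by simp
        then obtain q where q: "\<And>z. f x (\<lambda>j. poly ([:l (i, j):] + w j) z) = z ^ t * poly q z"
          using vanishD[OF van, of "\<lambda>j. [:l (i, j):] + w j"] by blast
        have "(\<Sum>\<tau>\<in>monomials N d. smult (x \<tau>) (shift \<tau> i w l)) = monom 1 t * q"
          by (rule poly_eqI_fun) (use q in \<open>simp add: f_def poly_sum poly_shift poly_monom\<close>)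
        then have "coeff (\<Sum>\<tau>\<in>monomials N d. smult (x \<tau>) (shift \<tau> i w l)) k = coeff (monom 1 t * q) k"
          by (rule arg_cong)
        also have "\<dots> = 0" using True by (simp add: coeff_monom_mult)
        finally show ?thesis
          using True i by (simp add: coeff_sum M_def mult.commute)
      next
        case False
        then have "M (i, w, k) \<tau> l = 0" for \<tau> by (auto simp: M_def)
        then show ?thesis by simp
      qed
    qed
  next
    assume M0: "\<forall>w k. (\<Sum>\<tau>\<in>monomials N d. M (i, w, k) \<tau> l * x \<tau>) = 0"
    show "vanish t (\<lambda>j. l (i, j)) (f x)"
      unfolding vanish_def
    proof (intro allI impI)
      fix u assume u: "\<forall>j. poly (u j) 0 = l (i, j)"
      define w where "w = (\<lambda>j. u j - [:l (i, j):])"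
      define p where "p = (\<Sum>\<tau>\<in>monomials N d. smult (x \<tau>) (shift \<tau> i w l))"
      have "coeff p k = 0" if "k < t" for k
        using M0[rule_format, of w k] that i u
        by (simp add: M_def p_def w_def coeff_sum mult.commute)
      then have "monom 1 t dvd p" by (simp add: monom_1_dvd_iff')
      then obtain q where "p = monom 1 t * q" by (rule dvdE)
      moreover have "f x (\<lambda>j. poly (u j) z) = poly p z" for z
        by (simp add: f_def p_def poly_sum poly_shift w_def)
      ultimately show "\<exists>q. \<forall>z. f x (\<lambda>j. poly (u j) z) = z ^ t * poly q z"
        by (auto simp: poly_monom)
    qed
  qed
  define l0 where "l0 = (\<lambda>(i, j). ((P i)(N := 1)) j)"
  have "general ({..<s} \<times> {..N}) (\<lambda>l. \<forall>x. (\<forall>c. (\<Sum>\<tau>\<in>monomials N d. M c \<tau> l * x \<tau>) = 0) \<longrightarrow>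
      (\<forall>\<tau>\<in>monomials N d. x \<tau> = 0))"
  proof (rule general_injectivity[OF finite_monomials', of _ _ _ _ l0])
    fix c :: "nat \<times> (nat \<Rightarrow> 'k poly) \<times> nat" and \<tau> assume \<tau>: "\<tau> \<in> monomials N d"
    obtain i w k where c: "c = (i, w, k)" by (cases c)
    show "M c \<tau> \<in> poly_functions ({..<s} \<times> {..N})"
    proof (cases "i < s \<and> k < t \<and> (\<forall>j. poly (w j) 0 = 0)")
      case True
      have "(\<lambda>l. coeff ([:l (i, j):] + w j) k) \<in> poly_functions ({..<s} \<times> {..N})"
        if "j \<in> Poly_Mapping.keys \<tau>" for j k
        using that True \<tau> unfolding coeff_add coeff_pCons
        by (cases k) (auto simp: monomials_def intro!: poly_functions_add poly_functions_const poly_functions_var)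
      then have "(\<lambda>l. coeff (shift \<tau> i w l) k) \<in> poly_functions ({..<s} \<times> {..N})"
        unfolding shift_def by (intro poly_functions_coeff_prod poly_functions_coeff_power)
      then show ?thesis using True by (simp add: M_def c)
    next
      case False
      then have "M c \<tau> l = 0" for l by (auto simp: M_def c)
      then have "M c \<tau> = (\<lambda>l. 0)" by (rule ext)
      then show ?thesis by (simp add: poly_functions_const)
    qed
  next
    fix x assume x: "\<And>c. (\<Sum>\<tau>\<in>monomials N d. M c \<tau> l0 * x \<tau>) = 0"
    have fx: "form N d (f x)" unfolding f_def by (rule form_monomials)
    have "f x (v(N := 1)) = 0" for v
    proof (rule P[OF form_dehomogenize[OF fx]])
      fix i assume "i < s"
      then have "vanish t (\<lambda>j. l0 (i, j)) (f x)" using vanish_iff x by blast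
      then show "vanish t (P i) (\<lambda>v. f x (v(N := 1)))"
        by (intro vanish_subst) (simp add: l0_def del: fun_upd_apply)
    qed
    then have "f x v = 0" for v by (rule form_eq_0_if_dehomogenized[OF fx])
    then show "\<forall>\<tau>\<in>monomials N d. x \<tau> = 0"
      using monomials_independent[of x N d] by (auto simp: f_def)
  qed
  then show ?thesis
  proof (rule general_mono, intro allI impI)
    fix l g v
    assume l: "\<forall>x. (\<forall>c. (\<Sum>\<tau>\<in>monomials N d. M c \<tau> l * x \<tau>) = 0) \<longrightarrow> (\<forall>\<tau>\<in>monomials N d. x \<tau> = 0)"
      and g: "form N d g" "\<forall>i<s. vanish t (\<lambda>j. l (i, j)) g"
    obtain x where x: "g = f x" using form_obtain_monomials[OF g(1)] unfolding f_def by blast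
    have "(\<Sum>\<tau>\<in>monomials N d. M c \<tau> l * x \<tau>) = 0" for c
    proof -
      obtain i w k where c: "c = (i, w, k)" by (cases c)
      show ?thesis
      proof (cases "i < s")
        case True
        then show ?thesis using vanish_iff[OF True] g(2) x c by blast
      qed (simp add: M_def c)
    qed
    then have "\<forall>\<tau>\<in>monomials N d. x \<tau> = 0" using l by blast
    then show "g v = 0" by (simp add: x f_def)
  qed
qed

text \<open>A dual basis for linearly independent evaluations. A new point \<open>b\<close> admits
  an \<open>f\<close> in \<open>V\<close> whose value at \<open>b\<close> is not the one
  interpolated from its values on \<open>B\<close>; subtracting the interpolant leaves a
  \<open>g\<close> that is zero on \<open>B\<close> but not at \<open>b\<close>.\<close>

lemma separators_exist:
  fixes V :: "('p \<Rightarrow> 'k::field) set"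
  assumes "finite B"
    and add: "\<And>f g. f \<in> V \<Longrightarrow> g \<in> V \<Longrightarrow> (\<lambda>p. f p + g p) \<in> V"
    and smult: "\<And>c f. f \<in> V \<Longrightarrow> (\<lambda>p. c * f p) \<in> V"
    and zero: "(\<lambda>p. 0) \<in> V"
    and "\<And>y. (\<And>f. f \<in> V \<Longrightarrow> (\<Sum>q\<in>B. y q * f q) = 0) \<Longrightarrow> \<forall>q\<in>B. y q = 0"
  shows "\<exists>F. \<forall>q\<in>B. F q \<in> V \<and> (\<forall>p\<in>B. F q p = (if p = q then 1 else 0))"
  using assms(1,5)
proof (induction B rule: finite_induct)
  case empty
  then show ?case by simp
next
  case (insert b B)
  have "\<exists>F. \<forall>q\<in>B. F q \<in> V \<and> (\<forall>p\<in>B. F q p = (if p = q then 1 else 0))"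
  proof (rule insert.IH)
    fix y assume y: "\<And>f. f \<in> V \<Longrightarrow> (\<Sum>q\<in>B. y q * f q) = 0"
    define y' where "y' = y(b := 0)"
    have "(\<Sum>q\<in>insert b B. y' q * f q) = (\<Sum>q\<in>B. y q * f q)" for f
      using insert.hyps by (auto simp: y'_def intro!: sum.cong)
    then have "\<forall>q\<in>insert b B. y' q = 0" using y by (intro insert.prems) simp
    then show "\<forall>q\<in>B. y q = 0" using insert.hyps by (auto simp: y'_def split: if_splits)
  qed
  then obtain F where F: "\<And>q. q \<in> B \<Longrightarrow> F q \<in> V"
    "\<And>p q. q \<in> B \<Longrightarrow> p \<in> B \<Longrightarrow> F q p = (if p = q then 1 else 0)" by blast
  define y where "y = (\<lambda>q. if q = b then -1 else F q b)"
  have "\<exists>f\<in>V. (\<Sum>q\<in>insert b B. y q * f q) \<noteq> 0"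
  proof (rule ccontr)
    assume "\<not> ?thesis"
    then have "\<forall>q\<in>insert b B. y q = 0" by (intro insert.prems) blast
    then show False by (simp add: y_def)
  qed
  then obtain f where f: "f \<in> V" "(\<Sum>q\<in>insert b B. y q * f q) \<noteq> 0" by blast
  define g where "g = (\<lambda>p. f p + (\<Sum>q\<in>B. - f q * F q p))"
  have sum: "(\<lambda>p. \<Sum>q\<in>S. h q * F q p) \<in> V" if "S \<subseteq> B" for S h
    using finite_subset[OF that insert.hyps(1)] that
  proof (induction S rule: finite_induct)
    case (insert q S)
    then have "(\<lambda>p. h q * F q p + (\<Sum>q\<in>S. h q * F q p)) \<in> V" by (intro add smult F) auto
    then show ?case using insert.hyps by simp
  qed (simp add: zero)
  have gV: "g \<in> V" unfolding g_def by (intro add f sum) simp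
  have gB: "g p = 0" if "p \<in> B" for p
  proof -
    have "(\<Sum>q\<in>B. - f q * F q p) = (\<Sum>q\<in>B. if q = p then - f p else 0)"
      using F that by (intro sum.cong) auto
    then show ?thesis using that insert.hyps by (simp add: g_def)
  qed
  have "(\<Sum>q\<in>B. y q * f q) = (\<Sum>q\<in>B. F q b * f q)"
    using insert.hyps by (intro sum.cong) (auto simp: y_def)
  then have gb: "g b \<noteq> 0"
    using f(2) insert.hyps by (simp add: g_def y_def sum_negf mult.commute)
  define G where "G = (\<lambda>q. if q = b then (\<lambda>p. inverse (g b) * g p)
    else (\<lambda>p. F q p + (- F q b * inverse (g b)) * g p))"
  have GV: "(\<lambda>p. F q p + (- F q b * inverse (g b)) * g p) \<in> V" if "q \<in> B" for q
    using that by (intro add smult F gV)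
  have "G q \<in> V \<and> (\<forall>p\<in>insert b B. G q p = (if p = q then 1 else 0))" if "q \<in> insert b B" for q
  proof (cases "q = b")
    case True
    then show ?thesis using smult[OF gV, of "inverse (g b)"] gb gB insert.hyps by (auto simp: G_def)
  next
    case False
    then have q: "q \<in> B" using that by simp
    then have "G q \<in> V" using GV False by (simp add: G_def)
    moreover have "G q p = (if p = q then 1 else 0)" if "p \<in> insert b B" for p
      using that False q gb gB F(2) by (auto simp: G_def)
    ultimately show ?thesis by blast
  qed
  then show ?case by blast
qed

lemma form_poly_functions:
  assumes "form N d f" "p < s"
  shows "(\<lambda>l. f (\<lambda>j. l (p, j))) \<in> poly_functions ({..<s} \<times> {..N})"
  using assms
  by (induction rule: form.induct)
    (auto intro: poly_functions_const poly_functions_add poly_functions_mult poly_functions_var)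

text \<open>The forms \<open>G q\<close> separate the special points \<open>l0\<close>. At general
  points they still make the evaluations linearly independent, which is an injectivity statement and
  therefore open; independence then gives separators that depend on \<open>l\<close>.\<close>

lemma general_separators:
  assumes "s \<le> (e + N) choose N"
  shows "general ({..<s} \<times> {..N}) (\<lambda>l :: nat \<times> nat \<Rightarrow> 'k::field_char_0. \<exists>F. \<forall>q<s. form N e (F q) \<and>
    (\<forall>p<s. F q (\<lambda>j. l (p, j)) = (if p = q then 1 else 0)))"
proof -
  obtain P :: "nat \<Rightarrow> nat \<Rightarrow> 'k" where P: "\<And>y. \<exists>f. poly_deg_le N e f \<and> (\<forall>i<(e + N) choose N. f (P i) = y i)"
    using unisolvent_points by blast
  define l0 where "l0 = (\<lambda>(i, j). ((P i)(N := 1)) j)"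
  have "\<exists>g. form N e g \<and> (\<forall>i<s. g (\<lambda>j. l0 (i, j)) = (if i = q then 1 else 0))" for q
  proof -
    obtain f where f: "poly_deg_le N e f" "\<forall>i<(e + N) choose N. f (P i) = (if i = q then 1 else 0)"
      using P[of "\<lambda>i. if i = q then 1 else 0"] by blast
    obtain g where "form N e g" "\<forall>v. g (v(N := 1)) = f v" using form_homogenize[OF f(1)] by blast
    then show ?thesis
      using f(2) assms by (intro exI[of _ g]) (simp add: l0_def del: fun_upd_apply)
  qed
  then obtain G where G: "\<And>q. form N e (G q)"
    "\<And>q i. i < s \<Longrightarrow> G q (\<lambda>j. l0 (i, j)) = (if i = q then 1 else 0)" by metis
  define M where "M = (\<lambda>q p (l :: nat \<times> nat \<Rightarrow> 'k). G q (\<lambda>j. l (p, j)))"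
  have "general ({..<s} \<times> {..N}) (\<lambda>l. \<forall>y. (\<forall>q. (\<Sum>p\<in>{..<s}. M q p l * y p) = 0) \<longrightarrow> (\<forall>p\<in>{..<s}. y p = 0))"
  proof (rule general_injectivity[of _ _ _ l0])
    show "M q p \<in> poly_functions ({..<s} \<times> {..N})" if "p \<in> {..<s}" for q p
      using form_poly_functions[OF G(1)] that by (simp add: M_def)
    fix y assume y: "\<And>q. (\<Sum>p\<in>{..<s}. M q p l0 * y p) = 0"
    have "(\<Sum>p<s. M q p l0 * y p) = (\<Sum>p<s. if p = q then y q else 0)" for q
      by (rule sum.cong) (auto simp: M_def G(2))
    then have "(if q < s then y q else 0) = 0" for q using y[of q] by simp
    then show "\<forall>p\<in>{..<s}. y p = 0" by (metis lessThan_iff)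
  qed simp
  then show ?thesis
  proof (rule general_mono)
    fix l assume l: "\<forall>y. (\<forall>q. (\<Sum>p\<in>{..<s}. M q p l * y p) = 0) \<longrightarrow> (\<forall>p\<in>{..<s}. y p = 0)"
    define V where "V = {\<lambda>p. f (\<lambda>j. l (p, j)) |f. form N e f}"
    have "\<exists>F. \<forall>q\<in>{..<s}. F q \<in> V \<and> (\<forall>p\<in>{..<s}. F q p = (if p = q then 1 else 0))"
    proof (rule separators_exist)
      show "(\<lambda>p. f p + g p) \<in> V" if "f \<in> V" "g \<in> V" for f g
        using that form.add unfolding V_def by fastforce
      show "(\<lambda>p. c * f p) \<in> V" if "f \<in> V" for c f
        using that form_cmult unfolding V_def by fastforce
      show "(\<lambda>p. 0) \<in> V" using form.zero unfolding V_def by fastforce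
      fix y assume y: "\<And>f. f \<in> V \<Longrightarrow> (\<Sum>q\<in>{..<s}. y q * f q) = 0"
      have "(\<lambda>p. G q (\<lambda>j. l (p, j))) \<in> V" for q using G(1) unfolding V_def by blast
      from y[OF this] have "(\<Sum>p\<in>{..<s}. M q p l * y p) = 0" for q by (simp add: M_def mult.commute)
      then show "\<forall>q\<in>{..<s}. y q = 0" using l by blast
    qed simp
    then obtain F where F: "\<And>q. q < s \<Longrightarrow> F q \<in> V" "\<And>p q. q < s \<Longrightarrow> p < s \<Longrightarrow> F q p = (if p = q then 1 else 0)"
      by auto
    have "\<forall>q. \<exists>f. q < s \<longrightarrow> form N e f \<and> (\<lambda>p. f (\<lambda>j. l (p, j))) = F q"
      using F(1) unfolding V_def by fastforce
    then obtain G where G: "\<And>q. q < s \<Longrightarrow> form N e (G q) \<and> (\<lambda>p. G q (\<lambda>j. l (p, j))) = F q" by metis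
    have "G q (\<lambda>j. l (p, j)) = F q p" if "q < s" for p q
      using G[OF that] by (auto dest: fun_cong)
    then show "\<exists>F. \<forall>q<s. form N e (F q) \<and> (\<forall>p<s. F q (\<lambda>j. l (p, j)) = (if p = q then 1 else 0))"
      using G F(2) by (intro exI[of _ G]) auto
  qed
qed

section \<open>The containment\<close>

text \<open>The ideal powers carried over to functions, where they can be compared with
  \<open>form\<close> and \<open>ideal_pow\<close>; membership is pulled back by
  \<open>poly_eval_inject\<close>.\<close>

definition power_image :: "nat \<Rightarrow> nat \<Rightarrow> (nat \<times> nat \<Rightarrow> 'k::field_char_0) \<Rightarrow> nat \<Rightarrow> ((nat \<Rightarrow> 'k) \<Rightarrow> 'k) set"
  where "power_image N s l k = poly_eval ` ideal_power N (points_ideal N s (param_point N l)) k"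

lemma mem_param_point:
  assumes "l (i, N) \<noteq> 0"
  shows "v \<in> param_point N l i \<longleftrightarrow> v \<in> affine_space {..N} \<and> (\<exists>c. c \<noteq> 0 \<and> (\<forall>j\<le>N. v j = c * l (i, j)))"
  using assms by (auto simp: param_point_def proj_point_def proj_rel_def affine_space_def)

context
  fixes N s :: nat and l :: "nat \<times> nat \<Rightarrow> 'k::field_char_0"
  assumes s: "0 < s" and last: "\<And>i. i < s \<Longrightarrow> l (i, N) \<noteq> 0"
begin

lemma power_image_0: "form N d f \<Longrightarrow> f \<in> power_image N s l 0"
  by (erule form_obtain_poly) (auto simp: power_image_def ideal_power_0)

lemma ideal_ideal_power_points: "ideal (ideal_power N (points_ideal N s (param_point N l)) k) (hom_coord_ring N)"
  by (intro ideal_ideal_power ideal_points_ideal s)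

lemma power_image_zero: "(\<lambda>v. 0) \<in> power_image N s l k"
proof -
  have "0 \<in> ideal_power N (points_ideal N s (param_point N l)) k"
    using additive_subgroup.zero_closed[OF ideal.axioms(1)[OF ideal_ideal_power_points, of k]] by simp
  moreover have "(\<lambda>v. 0) = poly_eval (0 :: (nat, 'k) mpoly)" by auto
  ultimately show ?thesis unfolding power_image_def by (rule rev_image_eqI)
qed

lemma power_image_add:
  assumes "f \<in> power_image N s l k" "g \<in> power_image N s l k"
  shows "(\<lambda>v. f v + g v) \<in> power_image N s l k"
proof -
  obtain F G where F: "F \<in> ideal_power N (points_ideal N s (param_point N l)) k" "f = poly_eval F"
    and G: "G \<in> ideal_power N (points_ideal N s (param_point N l)) k" "g = poly_eval G"
    using assms by (auto simp: power_image_def)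
  have "F + G \<in> ideal_power N (points_ideal N s (param_point N l)) k"
    using additive_subgroup.a_closed[OF ideal.axioms(1)[OF ideal_ideal_power_points] F(1) G(1)] by simp
  moreover have "(\<lambda>v. f v + g v) = poly_eval (F + G)" by (auto simp: F G poly_eval_add)
  ultimately show ?thesis unfolding power_image_def by (rule rev_image_eqI)
qed

lemma form_in_points_ideal:
  assumes h: "form N d h" "\<And>i. i < s \<Longrightarrow> h (\<lambda>j. l (i, j)) = 0"
  obtains H where "H \<in> points_ideal N s (param_point N l)" "h = poly_eval H"
proof -
  obtain H where H: "poly_vars H \<subseteq> {..N}" "\<And>t. t \<in> Poly_Mapping.keys H \<Longrightarrow> monom_degree t = d"
    "h = poly_eval H" using form_obtain_poly[OF h(1)] by blast
  have "H \<in> point_ideal N (param_point N l i)" if i: "i < s" for i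
  proof (rule point_ideal_I[OF H(1)])
    show "homogeneous H" using H(2) by (auto simp: homogeneous_def)
    fix v assume "v \<in> param_point N l i"
    then obtain c where c: "\<forall>j\<le>N. v j = c * l (i, j)"
      using mem_param_point[of l i N, OF last[OF i]] by blast
    then have "h v = h (\<lambda>j. c * l (i, j))" by (intro form_cong[OF h(1)]) auto
    also have "\<dots> = 0" by (simp add: form_scale[OF h(1)] h(2)[OF i])
    finally show "poly_eval H v = 0" using H(3) by simp
  qed
  then have "H \<in> points_ideal N s (param_point N l)" by (simp add: points_ideal_def)
  then show thesis using H(3) by (rule that)
qed

lemma power_image_mult:
  assumes "form N d h" "\<And>i. i < s \<Longrightarrow> h (\<lambda>j. l (i, j)) = 0" "f \<in> power_image N s l k"
  shows "(\<lambda>v. h v * f v) \<in> power_image N s l (Suc k)"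
proof -
  obtain H where H: "H \<in> points_ideal N s (param_point N l)" "h = poly_eval H"
    by (rule form_in_points_ideal[OF assms(1,2)])
  obtain F where F: "F \<in> ideal_power N (points_ideal N s (param_point N l)) k" "f = poly_eval F"
    using assms(3) by (auto simp: power_image_def)
  have "F * H \<in> ideal_power N (points_ideal N s (param_point N l)) (Suc k)"
    unfolding ideal_power_Suc using ideal_prod.prod[OF F(1) H(1), of "hom_coord_ring N"] by simp
  moreover have "(\<lambda>v. h v * f v) = poly_eval (F * H)" by (auto simp: F H poly_eval_mult)
  ultimately show ?thesis unfolding power_image_def by (rule rev_image_eqI)
qed

lemma power_image_antimono: "k \<le> m \<Longrightarrow> power_image N s l m \<subseteq> power_image N s l k"
proof (induction m rule: dec_induct)
  case (step m)
  interpret cring "hom_coord_ring N :: (nat, 'k) mpoly ring" by (rule cring_poly_ring)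
  have "ideal_power N (points_ideal N s (param_point N l)) (Suc m)
      \<subseteq> ideal_power N (points_ideal N s (param_point N l)) m"
    unfolding ideal_power_Suc
    using ideal_prod_inter[OF ideal_ideal_power_points ideal_points_ideal[OF s]] by blast
  then show ?case using step.IH by (auto simp: power_image_def)
qed simp

lemma power_imageD:
  assumes "poly_eval f \<in> power_image N s l k"
  shows "f \<in> ideal_power N (points_ideal N s (param_point N l)) k"
  using assms by (auto simp: power_image_def dest: poly_eval_inject)

lemma point_ideal_eval_multiple:
  assumes "i < s" "c \<noteq> 0" "g \<in> point_ideal N (param_point N l i)"
  shows "poly_eval g (\<lambda>j. c * l (i, j)) = 0"
proof -
  interpret ideal "point_ideal N (param_point N l i)" "hom_coord_ring N"
    by (rule ideal_point_ideal)
  define v where "v = restrict (\<lambda>j. c * l (i, j)) {..N}"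
  have "v \<in> param_point N l i"
    unfolding mem_param_point[of l i N, OF last[OF assms(1)]] using assms(2)
    by (auto simp: v_def affine_space_def)
  then have "poly_eval g v = 0" by (rule point_ideal_eval[OF assms(3)])
  moreover have "poly_vars g \<subseteq> {..N}" using Icarr[OF assms(3)] by simp
  then have "poly_eval g v = poly_eval g (\<lambda>j. c * l (i, j))"
    by (rule poly_eval_cong) (simp add: v_def)
  ultimately show ?thesis by simp
qed

lemma symbolic_power_vars:
  assumes "f \<in> symbolic_power N s (param_point N l) t"
  shows "poly_vars f \<subseteq> {..N}"
proof -
  have "f \<in> ideal_power N (point_ideal N (param_point N l 0)) t"
    using assms s by (auto simp: symbolic_power_def)
  then show ?thesis
    using ideal.Icarr[OF ideal_ideal_power[OF ideal_point_ideal]] by fastforce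
qed

lemma symbolic_power_hom_component:
  assumes f: "f \<in> symbolic_power N s (param_point N l) t" and i: "i < s" and c: "c \<noteq> 0"
  shows "vanish t (\<lambda>j. c * l (i, j)) (poly_eval (hom_component d f))"
proof (rule vanish_hom_component[OF symbolic_power_vars[OF f]])
  fix b :: 'k assume b: "b \<noteq> 0"
  have "f \<in> ideal_power N (point_ideal N (param_point N l i)) t"
    using f i by (auto simp: symbolic_power_def)
  then have "vanish t (\<lambda>j. (b * c) * l (i, j)) (poly_eval f)"
    using point_ideal_eval_multiple[OF i, of "b * c"] b c by (intro ideal_power_vanish) auto
  then show "vanish t (\<lambda>j. b * (c * l (i, j))) (poly_eval f)" by (simp add: mult.assoc)
qed

text \<open>The homogeneous components of an element of the symbolic power inherit its orders of
  vanishing, and their sum is in the ideal power if all of them are.\<close>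

lemma symbolic_power_subsetI:
  assumes "\<And>d f. form N d f \<Longrightarrow> (\<And>i c. i < s \<Longrightarrow> c \<noteq> 0 \<Longrightarrow> vanish t (\<lambda>j. c * l (i, j)) f) \<Longrightarrow>
    f \<in> power_image N s l m"
  shows "symbolic_power N s (param_point N l) t \<subseteq> ideal_power N (points_ideal N s (param_point N l)) m"
proof
  fix f assume f: "f \<in> symbolic_power N s (param_point N l) t"
  have "poly_eval (hom_component d f) \<in> power_image N s l m" for d
    by (rule assms[OF form_hom_component[OF symbolic_power_vars[OF f]] symbolic_power_hom_component[OF f]])
  then have "(\<lambda>v. \<Sum>d\<in>D. poly_eval (hom_component d f) v) \<in> power_image N s l m" for D
    by (induction D rule: infinite_finite_induct) (auto intro: power_image_zero power_image_add)
  from this[of "monom_degree ` Poly_Mapping.keys f"] have "poly_eval f \<in> power_image N s l m"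
    by (simp only: poly_eval_sum[symmetric, abs_def] sum_hom_component)
  then show "f \<in> ideal_power N (points_ideal N s (param_point N l)) m" by (rule power_imageD)
qed

text \<open>\<open>alpha\<close> ranges over all nonzero elements of the ideal, homogeneous or not.
  The top component of a minimal one is a nonzero form that vanishes at the points, so its degree is
  at least \<open>e\<close>.\<close>

lemma alpha_ge:
  assumes "0 < N" and "\<And>d f. d < e \<Longrightarrow> form N d f \<Longrightarrow> (\<And>i. i < s \<Longrightarrow> f (\<lambda>j. l (i, j)) = 0) \<Longrightarrow> f = (\<lambda>v. 0)"
  shows "e \<le> alpha (points_ideal N s (param_point N l))"
proof -
  let ?I = "points_ideal N s (param_point N l)"
  have "\<exists>f\<in>?I. f \<noteq> 0"
  proof -
    \<comment> \<open>A product of linear forms, one through each point, shows that the ideal is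
      nonzero, so the \<open>LEAST\<close> in \<open>alpha\<close> is attained.\<close>
    define h where "h = (\<lambda>v. \<Prod>i<s. l (i, N) * v 0 - l (i, 0) * v N)"
    have "form N (card S) (\<lambda>v. \<Prod>i\<in>S. l (i, N) * v 0 - l (i, 0) * v N)" if "finite S" for S
      using that
    proof (induction S rule: finite_induct)
      case empty
      show ?case using form.const[of N 1] by simp
    next
      case (insert i S)
      have "form N 1 (\<lambda>v. l (i, N) * v 0 - l (i, 0) * v N)"
        by (intro form_diff form_cmult form_var) auto
      from form_times[OF this insert.IH] show ?case using insert.hyps by simp
    qed
    from this[of "{..<s}"] have "form N s h" unfolding h_def by simp
    moreover have "h (\<lambda>j. l (i, j)) = 0" if "i < s" for i
      unfolding h_def using that by (intro prod_zero bexI[of _ i]) (auto simp: mult.commute)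
    ultimately obtain H where H: "H \<in> ?I" "h = poly_eval H"
      by (rule form_in_points_ideal)
    have "finite ((\<lambda>i. l (i, 0) / l (i, N)) ` {..<s})" by simp
    then obtain x where x: "x \<notin> (\<lambda>i. l (i, 0) / l (i, N)) ` {..<s}"
      using ex_new_if_finite[OF infinite_UNIV_char_0[where 'a = 'k]] by blast
    have "l (i, N) * x - l (i, 0) \<noteq> 0" if "i < s" for i
    proof
      assume "l (i, N) * x - l (i, 0) = 0"
      then have "x = l (i, 0) / l (i, N)" using last[OF that] by (simp add: field_simps)
      then show False using x that by blast
    qed
    then have "h (\<lambda>j. if j = 0 then x else 1) \<noteq> 0" using assms(1) by (simp add: h_def)
    then have "H \<noteq> 0" using H(2) by auto
    then show ?thesis using H(1) by blast
  qed
  then have "\<exists>d. \<exists>f\<in>?I. f \<noteq> 0 \<and> total_degree f = d" by blast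
  then have "\<exists>f\<in>?I. f \<noteq> 0 \<and> total_degree f = alpha ?I"
    unfolding alpha_def by (rule LeastI_ex)
  then obtain f where f: "f \<in> ?I" "f \<noteq> 0" "total_degree f = alpha ?I" by blast
  have sym: "f \<in> symbolic_power N s (param_point N l) 1"
    using f(1) by (simp only: symbolic_power_def points_ideal_def ideal_power_1[OF ideal_point_ideal])
  show ?thesis
  proof (rule ccontr)
    assume "\<not> e \<le> alpha ?I"
    then have lt: "total_degree f < e" using f(3) by simp
    let ?g = "hom_component (total_degree f) f"
    have "poly_eval ?g (\<lambda>j. l (i, j)) = 0" if "i < s" for i
      using vanish_imp_zero[OF symbolic_power_hom_component[OF sym that, of 1]] by simp
    then have "poly_eval ?g = (\<lambda>v. 0)"
      by (rule assms(2)[OF lt form_hom_component[OF symbolic_power_vars[OF sym]]])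
    then have "?g = 0" using poly_eval_eq_0_iff[of ?g] by simp
    moreover have "total_degree f \<in> monom_degree ` Poly_Mapping.keys f"
      unfolding total_degree_def using f(2) by (intro Max_in) auto
    ultimately show False using keys_hom_component[of "total_degree f" f] by auto
  qed
qed

lemma separated_points_param:
  assumes "\<And>q. q < s \<Longrightarrow> form N e (F q)"
    and "\<And>p q. p < s \<Longrightarrow> q < s \<Longrightarrow> F q (\<lambda>j. l (p, j)) = (if p = q then 1 else 0)"
  shows "separated_points N e s (\<lambda>i j. inverse (l (i, N)) * l (i, j)) (\<lambda>q v. l (q, N) ^ e * F q v)"
proof
  fix p q assume q: "q < s"
  show "inverse (l (q, N)) * l (q, N) = 1" using last[OF q] by simp
  show "form N e (\<lambda>v. l (q, N) ^ e * F q v)" by (intro form_cmult assms q)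
  assume "p < s"
  then show "l (q, N) ^ e * F q (\<lambda>j. inverse (l (p, N)) * l (p, j)) = (if p = q then 1 else 0)"
    using q last by (simp add: form_scale[OF assms(1)[OF q]] assms(2) flip: power_mult_distrib)
qed

lemma high_degree_in_power:
  assumes F: "\<And>q. q < s \<Longrightarrow> form N e (F q)"
    "\<And>p q. p < s \<Longrightarrow> q < s \<Longrightarrow> F q (\<lambda>j. l (p, j)) = (if p = q then 1 else 0)"
    and f: "form N d f" "\<And>i c. i < s \<Longrightarrow> c \<noteq> 0 \<Longrightarrow> vanish t (\<lambda>j. c * l (i, j)) f"
    and "m \<le> t" "m * Suc e \<le> d"
  shows "f \<in> power_image N s l m"
proof -
  interpret separated_points N e s "\<lambda>i j. inverse (l (i, N)) * l (i, j)" "\<lambda>q v. l (q, N) ^ e * F q v"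
    by (rule separated_points_param[OF F])
  have "ideal_pow m d f"
    by (rule symbolic_power_degree[OF f(1) vanish_mono[OF f(2) \<open>m \<le> t\<close>] \<open>m * Suc e \<le> d\<close>])
      (use last in auto)
  then show ?thesis
  proof (induction rule: ideal_pow.induct)
    case (mult h k d f)
    have "h (\<lambda>j. l (i, j)) = 0" if i: "i < s" for i
    proof -
      have "h (\<lambda>j. inverse (l (i, N)) * l (i, j)) = 0"
        using mult.hyps(1) i by (simp add: vanishing_def)
      then show ?thesis
        using last[OF i] by (simp add: form_scale[OF vanishing_form[OF mult.hyps(1)]])
    qed
    then show ?case by (rule power_image_mult[OF vanishing_form[OF mult.hyps(1)] _ mult.IH])
  qed (auto intro: power_image_0 power_image_zero power_image_add)
qed

end

text \<open>A form whose order at \<open>p\<close> equals its degree is a cone with vertex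
  \<open>p\<close>. On a line in direction \<open>p\<close> its values are a polynomial
  \<open>r\<close> in the parameter \<open>y\<close>, and by homogeneity also a polynomial in
  \<open>1 / y\<close>, so \<open>r\<close> is constant.\<close>

lemma form_translation_invariant:
  fixes f :: "(nat \<Rightarrow> 'k::field_char_0) \<Rightarrow> 'k"
  assumes f: "form N d f" and van: "vanish d p f"
  shows "f (\<lambda>i. z i + a * p i) = f z"
proof -
  obtain q where q: "\<And>x. f (\<lambda>i. poly [:p i, z i:] x) = x ^ d * poly q x"
    using vanishD[OF van, of "\<lambda>i. [:p i, z i:]"] by auto
  obtain r where r: "\<And>y. f (\<lambda>i. poly [:z i, p i:] y) = poly r y"
    using polyfn_arc[OF form_polyfn[OF f], of "\<lambda>i. [:z i, p i:]"] by blast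
  have "poly r (inverse x) = poly q x" if x: "x \<noteq> 0" for x
  proof -
    have "f (\<lambda>i. x * (z i + inverse x * p i)) = x ^ d * f (\<lambda>i. z i + inverse x * p i)"
      by (rule form_scale[OF f])
    moreover have "(\<lambda>i. x * (z i + inverse x * p i)) = (\<lambda>i. poly [:p i, z i:] x)"
      using x by (auto simp: algebra_simps)
    ultimately show ?thesis using q[of x] r[of "inverse x"] x by simp
  qed
  \<comment> \<open>At 0 the left side is the leading coefficient of \<open>r\<close>, while the
    right side is 0 unless \<open>degree r = 0\<close>.\<close>
  then have "reflect_poly r = monom 1 (degree r) * q"
    by (intro poly_eqI_cofinite[of 0]) (simp add: poly_reflect_poly_nz poly_monom)
  then have "poly (reflect_poly r) 0 = 0 ^ degree r * poly q 0" by (simp add: poly_monom)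
  then have "degree r = 0"
    by (cases "degree r = 0") (auto simp: power_0_left)
  then obtain b where "r = [:b:]" by (rule degree_eq_zeroE)
  then show ?thesis using r[of a] r[of 0] by simp
qed

text \<open>Two points in the plane are the exceptional case: the line through them occurs in degree
  \<open>2m - 1 < 2m\<close>.\<close>

lemma two_points:
  fixes l :: "nat \<times> nat \<Rightarrow> 'k::field_char_0"
  assumes last: "\<And>i. i < 2 \<Longrightarrow> l (i, N) \<noteq> 0"
    and F: "\<And>q. q < 2 \<Longrightarrow> form N 1 (F q)"
    "\<And>p q. p < 2 \<Longrightarrow> q < 2 \<Longrightarrow> F q (\<lambda>j. l (p, j)) = (if p = q then 1 else 0)"
    and f: "form N d f" "\<And>i. i < 2 \<Longrightarrow> vanish d (\<lambda>j. l (i, j)) f"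
  shows "f \<in> power_image N 2 l d"
proof -
  \<comment> \<open>\<open>L\<close> projects along the span of the two points. By the cone property
    \<open>f v = f (L v)\<close>, and the \<open>L j\<close> are linear forms in the ideal, which
    puts \<open>f\<close> in its \<open>d\<close>-th power.\<close>
  define L where "L = (\<lambda>j v. (v j + (- F 0 v) * l (0, j)) + (- F 1 v) * l (1, j))"
  have L: "form N 1 (L j)" if "j \<le> N" for j
  proof -
    have "form N 1 (\<lambda>v. v j + - l (0, j) * F 0 v + - l (1, j) * F 1 v)"
      by (intro form.add form_cmult form_var F that) auto
    then show ?thesis by (simp add: L_def mult.commute)
  qed
  have L0: "L j (\<lambda>j. l (i, j)) = 0" if "i < 2" for i j
    using that F(2)[of i 0] F(2)[of i 1] by (auto simp: L_def less_2_cases_iff)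
  have "f v = f (\<lambda>j. L j v)" for v
  proof -
    have "f (\<lambda>j. L j v) = f (\<lambda>j. v j + (- F 0 v) * l (0, j))"
      unfolding L_def by (rule form_translation_invariant[OF f(1) f(2)]) simp
    also have "\<dots> = f v"
      by (rule form_translation_invariant[OF f(1) f(2)]) simp
    finally show ?thesis by simp
  qed
  moreover have "(\<lambda>v. f (\<lambda>j. L j v)) \<in> power_image N 2 l d"
    using f(1)
  proof (induction rule: form.induct)
    case (zero d)
    show ?case by (rule power_image_zero) (use last in auto)
  next
    case (const c)
    show ?case by (rule power_image_0[OF _ _ form.const]) (use last in auto)
  next
    case (add d f g)
    then show ?case by (intro power_image_add) (use last in auto)
  next
    case (mult i d f)
    show ?case by (rule power_image_mult[OF _ _ L[OF mult.hyps(1)] _ mult.IH]) (use last L0 in auto)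
  qed
  ultimately show ?thesis by presburger
qed

text \<open>All numerical work is collected in \<open>bound\<close>. It starts at
  \<open>m = 2\<close> because \<open>m = 1\<close> compares the ideal with itself, and it speaks of
  any \<open>a \<ge> e\<close> because \<alpha>(I) enters through this estimate alone. Its second
  alternative is the degree in which the line through two points occurs.\<close>

lemma very_general_containment:
  assumes "0 < N" "0 < s" "s \<le> (e + N) choose N" "0 < e \<Longrightarrow> (e - 1 + N) choose N \<le> s"
    and w: "waldschmidt_ge TYPE('k::field_char_0) N c s"
    and bound: "\<And>m a d. 2 \<le> m \<Longrightarrow> e \<le> a \<Longrightarrow> beta N a \<le> real m \<Longrightarrow> d < m * Suc e \<Longrightarrow>
      real d < c * real (N * m - N + 1) \<or> N = 2 \<and> s = 2 \<and> e = 1 \<and> d = 2 * m - 1"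
  shows "very_general_points N s (\<lambda>P :: nat \<Rightarrow> (nat \<Rightarrow> 'k) set.
    \<forall>m::nat. real m \<ge> beta N (alpha (points_ideal N s P)) \<longrightarrow>
      symbolic_power N s P (N * m - N + 1) \<subseteq> ideal_power N (points_ideal N s P) m)"
proof -
  define A where "A = (\<lambda>l :: nat \<times> nat \<Rightarrow> 'k. \<forall>i<s. l (i, N) \<noteq> 0)"
  define B where "B = (\<lambda>l :: nat \<times> nat \<Rightarrow> 'k. \<exists>F. \<forall>q<s. form N e (F q) \<and>
    (\<forall>p<s. F q (\<lambda>j. l (p, j)) = (if p = q then 1 else 0)))"
  define C where "C = (\<lambda>t d (l :: nat \<times> nat \<Rightarrow> 'k). \<forall>f :: (nat \<Rightarrow> 'k) \<Rightarrow> 'k. form N d f \<longrightarrow>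
    (\<forall>i<s. vanish t (\<lambda>j. l (i, j)) f) \<longrightarrow> (\<forall>v. f v = 0))"
  \<comment> \<open>The conditions are numbered by pairs. For order 0 no degree satisfies
    \<open>d < c t\<close>, so that row is free for \<open>A\<close>, \<open>B\<close> and, shifted
    by 2, the conditions behind the estimate of \<alpha>(I).\<close>
  define \<Phi> where "\<Phi> = (\<lambda>k. case prod_decode k of
      (0, d) \<Rightarrow> (if d = 0 then A else if d = 1 then B else if d - 2 < e then C 1 (d - 2) else (\<lambda>l. True))
    | (Suc t, d) \<Rightarrow> (if real d < c * real (Suc t) then C (Suc t) d else (\<lambda>l. True)))"
  have C_e: "general ({..<s} \<times> {..N}) (C 1 d)" if d: "d < e" for d
  proof -
    obtain P :: "nat \<Rightarrow> nat \<Rightarrow> 'k" where P: "\<forall>f. poly_deg_le N (e - 1) f \<longrightarrow>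
        (\<forall>i<(e - 1 + N) choose N. f (P i) = 0) \<longrightarrow> (\<forall>v. f v = 0)"
      using unisolvent_points by blast
    show ?thesis
      unfolding C_def
    proof (rule general_no_form[where P = P])
      fix f v assume f: "poly_deg_le N d f" "\<And>i. i < s \<Longrightarrow> vanish 1 (P i) f"
      have "f (P i) = 0" if "i < (e - 1 + N) choose N" for i
        using that assms(4) d f(2)[of i] by (intro vanish_imp_zero[of 1]) auto
      moreover have "poly_deg_le N (e - 1) f"
        by (rule poly_deg_le_mono[OF _ f(1)]) (use d in simp)
      ultimately show "f v = 0" using P by blast
    qed
  qed
  have C_w: "general ({..<s} \<times> {..N}) (C t d)" if "real d < c * real t" for t d
  proof -
    obtain P :: "nat \<Rightarrow> nat \<Rightarrow> 'k" where P: "forces_zero N c s t P"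
      using w unfolding waldschmidt_ge_def by blast
    show ?thesis
      unfolding C_def by (rule general_no_form[where P = P]) (use forces_zeroD[OF P order_refl that] in blast)
  qed
  show ?thesis
  proof (rule very_general_pointsI[where \<Phi> = \<Phi>])
    show "general ({..<s} \<times> {..N}) (\<Phi> k)" for k
      using general_last_coordinate[of s N, where 'k = 'k, folded A_def] general_True
        general_separators[OF assms(3), where 'k = 'k, folded B_def] C_e C_w
      by (auto simp: \<Phi>_def split: prod.splits nat.splits)
    fix l assume \<Phi>: "\<And>k. \<Phi> k l"
    have "A l" using \<Phi>[of "prod_encode (0, 0)"] by (simp add: \<Phi>_def)
    then have last: "\<And>i. i < s \<Longrightarrow> l (i, N) \<noteq> 0" by (simp add: A_def)
    have "B l" using \<Phi>[of "prod_encode (0, 1)"] by (simp add: \<Phi>_def)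
    then obtain F where F: "\<And>q. q < s \<Longrightarrow> form N e (F q)"
      "\<And>p q. p < s \<Longrightarrow> q < s \<Longrightarrow> F q (\<lambda>j. l (p, j)) = (if p = q then 1 else 0)"
      unfolding B_def by blast
    have Ce: "C 1 d l" if "d < e" for d
      using \<Phi>[of "prod_encode (0, d + 2)"] that by (simp add: \<Phi>_def)
    have Cw: "C t d l" if "real d < c * real t" for t d
      using \<Phi>[of "prod_encode (t, d)"] that by (cases t) (auto simp: \<Phi>_def)
    have "e \<le> alpha (points_ideal N s (param_point N l))"
    proof (rule alpha_ge[of s l N, OF assms(2) last assms(1)])
      fix d and f :: "(nat \<Rightarrow> 'k) \<Rightarrow> 'k"
      assume d: "d < e" and f: "form N d f" "\<And>i. i < s \<Longrightarrow> f (\<lambda>j. l (i, j)) = 0"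
      have "\<forall>i<s. vanish 1 (\<lambda>j. l (i, j)) f" by (intro allI impI vanish_1I form_polyfn[OF f(1)] f(2))
      then show "f = (\<lambda>v. 0)" using Ce[OF d] f(1) unfolding C_def by blast
    qed
    note alpha = this
    have proj: "param_point N l i \<in> proj_space N" if "i < s" for i
      using last[OF that] by (auto simp: param_point_def proj_point_in_proj_space_iff)
    have inj: "inj_on (param_point N l) {..<s}"
    proof (rule inj_onI, rule ccontr)
      fix p q assume pq: "p \<in> {..<s}" "q \<in> {..<s}" "param_point N l p = param_point N l q" "p \<noteq> q"
      then have p: "p < s" and q: "q < s" by auto
      define v where "v = restrict (\<lambda>j. l (q, j)) {..N}"
      have v: "v j = l (q, j)" if "j \<le> N" for j using that by (simp add: v_def)
      then have "\<exists>c. c \<noteq> 0 \<and> (\<forall>j\<le>N. v j = c * l (q, j))" by (intro exI[of _ 1]) simp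
      then have "v \<in> param_point N l q"
        unfolding mem_param_point[of l q N, OF last[OF q]] by (simp add: v_def affine_space_def)
      then have "v \<in> param_point N l p" using pq(3) by simp
      then obtain b where b: "b \<noteq> 0" "\<forall>j\<le>N. v j = b * l (p, j)"
        unfolding mem_param_point[of l p N, OF last[OF p]] by blast
      have "F p (\<lambda>j. l (q, j)) = F p (\<lambda>j. b * l (p, j))"
        using b(2) v by (intro form_cong[OF F(1)[OF p]]) auto
      also have "\<dots> = b ^ e" using F(2)[OF p p] by (simp add: form_scale[OF F(1)[OF p]])
      finally show False using F(2)[OF q p] pq(4) b(1) by simp
    qed
    have "symbolic_power N s (param_point N l) (N * m - N + 1)
        \<subseteq> ideal_power N (points_ideal N s (param_point N l)) m"
      if m: "beta N (alpha (points_ideal N s (param_point N l))) \<le> real m" for m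
    proof -
      have "1 \<le> beta N (alpha (points_ideal N s (param_point N l)))" by (simp add: beta_def)
      then have "1 \<le> m" using m by simp
      then consider "m = 1" | "2 \<le> m" by linarith
      then show ?thesis
      proof cases
        case 1
        have "symbolic_power N s (param_point N l) 1 = points_ideal N s (param_point N l)"
          by (simp only: symbolic_power_def points_ideal_def ideal_power_1[OF ideal_point_ideal])
        moreover have "ideal_power N (points_ideal N s (param_point N l)) 1 = points_ideal N s (param_point N l)"
          by (rule ideal_power_1[OF ideal_points_ideal[OF assms(2)]])
        ultimately show ?thesis using 1 by simp
      next
        case 2
        let ?t = "N * m - N + 1"
        have t: "m \<le> ?t"
        proof -
          have "m - 1 \<le> N * (m - 1)" using assms(1) by simp
          then show ?thesis using 2 by (simp add: diff_mult_distrib2)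
        qed
        show ?thesis
        proof (rule symbolic_power_subsetI[of s l N, OF assms(2) last])
          fix d and f :: "(nat \<Rightarrow> 'k) \<Rightarrow> 'k"
          assume f: "form N d f" "\<And>i c. i < s \<Longrightarrow> c \<noteq> 0 \<Longrightarrow> vanish ?t (\<lambda>j. c * l (i, j)) f"
          have van: "vanish ?t (\<lambda>j. l (i, j)) f" if "i < s" for i
            using f(2)[OF that, of 1] by simp
          show "f \<in> power_image N s l m"
          proof (cases "m * Suc e \<le> d")
            case True
            show ?thesis
              by (rule high_degree_in_power[of s l N, OF assms(2) last F f t True])
          next
            case False
            then consider "real d < c * real ?t" | "N = 2" "s = 2" "e = 1" "d = 2 * m - 1"
              using bound[OF 2 alpha m, of d] by auto
            then show ?thesis
            proof cases
              case 1
              then have "f = (\<lambda>v. 0)" using Cw[OF 1] f(1) van unfolding C_def by blast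
              then show ?thesis using power_image_zero[of s l N, OF assms(2) last] by simp
            next
              case 2
              then have "?t = d" using \<open>2 \<le> m\<close> by simp
              then have "f \<in> power_image N 2 l d"
                using last F f van 2 by (intro two_points[of l N F]) auto
              moreover have "power_image N 2 l d \<subseteq> power_image N 2 l m"
                using last 2 \<open>2 \<le> m\<close> by (intro power_image_antimono) auto
              ultimately show ?thesis using 2 by auto
            qed
          qed
        qed
      qed
    qed
    then show "(\<forall>i<s. param_point N l i \<in> proj_space N) \<and> inj_on (param_point N l) {..<s} \<and>
      (\<forall>m. beta N (alpha (points_ideal N s (param_point N l))) \<le> real m \<longrightarrow>
        symbolic_power N s (param_point N l) (N * m - N + 1)
        \<subseteq> ideal_power N (points_ideal N s (param_point N l)) m)"
      using proj inj by blast
  qed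
qed

section \<open>Numerical bounds for the constants\<close>

lemma beta_bound:
  fixes N m e a :: nat
  assumes "4 \<le> N" "e \<le> a" "beta N a \<le> real m" "0 < e"
  shows "real (m * Suc e) < real (e - 1 + N) / real N * real (N * m - N + 1)"
proof -
  define n x M where "n = real N" and "x = real e" and "M = real m"
  have n: "4 \<le> n" using assms(1) by (simp add: n_def)
  have x: "0 < x" using assms(4) by (simp add: x_def)
  have "2 * (n - 1) * (x + n - 1) / ((n - 2) * n) \<le> 2 * (n - 1) * (real a + n - 1) / ((n - 2) * n)"
    using n assms(2) by (intro divide_right_mono mult_left_mono) (auto simp: x_def)
  then have "2 * (n - 1) * (x + n - 1) / ((n - 2) * n) \<le> M"
    using assms(1,3) by (simp add: beta_def n_def M_def)
  moreover have "0 < (n - 2) * n" using n by simp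
  ultimately have "2 * ((n - 1) * (x + n - 1)) \<le> M * ((n - 2) * n)"
    by (simp only: pos_divide_le_eq mult.assoc)
  moreover have "0 < (n - 1) * (x + n - 1)" using n x by (intro mult_pos_pos) auto
  \<comment> \<open>This is the claim with denominators cleared. As \<beta> contains twice the left
    side, there is room for strictness.\<close>
  ultimately have "(n - 1) * (x + n - 1) < M * ((n - 2) * n)" by linarith
  then have "n * (M * (x + 1)) < (x - 1 + n) * (n * M - n + 1)"
    by (simp add: algebra_simps)
  then have "M * (x + 1) < (x - 1 + n) / n * (n * M - n + 1)"
    using n by (simp add: field_simps)
  moreover have "1 \<le> m"
  proof -
    have "1 \<le> beta N a" by (simp add: beta_def)
    then show ?thesis using assms(3) by simp
  qed
  then have "N \<le> N * m" by simp
  then have "real (N * m - N + 1) = n * M - n + 1"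
    by (simp add: of_nat_diff n_def M_def)
  moreover have "real (e - 1 + N) = x - 1 + n" using assms(4) by (simp add: x_def n_def of_nat_diff)
  moreover have "real (m * Suc e) = M * (x + 1)" by (simp add: M_def x_def algebra_simps)
  ultimately show ?thesis by (simp only: n_def)
qed

lemma choose_2_times: "2 * (n choose 2) = n * (n - 1)"
proof -
  have "even (n * (n - 1))" by (cases n) simp_all
  then show ?thesis unfolding choose_two by (rule even_two_times_div_two)
qed

lemma choose_3_times: "6 * (Suc n choose 3) = Suc n * n * (n - 1)"
proof -
  have "3 * (Suc n choose 3) = Suc n * (n choose 2)"
    using Suc_times_binomial[of 2 n] by (simp add: eval_nat_numeral)
  then have "6 * (Suc n choose 3) = Suc n * (2 * (n choose 2))" by simp
  then show ?thesis by (simp only: choose_2_times mult.assoc)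
qed

text \<open>As \<open>2 m - 1 \<ge> 3 m / 2\<close> for \<open>m \<ge> 2\<close>, the constant
  \<open>c = 2 (e + 1) / 3\<close> suffices. It comes from \<open>\<delta> = 3\<close> and
  \<open>r = 2 (e + 1)\<close>, provided \<open>4 (e + 1)^2 \<le> 9 s\<close>. For the least
  \<open>s\<close> this reads \<open>(e - 2) (e - 5) \<ge> 0\<close>. It fails by 1 for
  \<open>e = 3\<close> and \<open>e = 4\<close>, where it would be \<open>64 \<le> 63\<close> and
  \<open>100 \<le> 99\<close>, and for \<open>e \<le> 2\<close> the least \<open>s\<close> violates
  \<open>r \<le> s\<close>. These cases exploit that \<open>d\<close> is at most
  \<open>m (e + 1) - 1\<close>.\<close>

lemma plane_bound:
  assumes "0 < e" "((e - 1 + 2) choose 2) < s" "s \<le> ((e + 2) choose 2)" "s \<noteq> 2"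
  obtains c where "waldschmidt_ge TYPE('k::field_char_0) 2 c s"
    "\<And>m d. 2 \<le> m \<Longrightarrow> d < m * Suc e \<Longrightarrow> real d < c * real (2 * m - 2 + 1)"
proof -
  have t: "real (2 * m - 2 + 1) = 2 * real m - 1" if "2 \<le> m" for m
    using that by (simp add: of_nat_diff)
  have bound: "real d \<le> real m * (real e + 1) - 1" if "d < m * Suc e" for d m
  proof -
    have "real (Suc d) \<le> real (m * Suc e)" using that by (simp only: of_nat_le_iff)
    then show ?thesis by (simp add: algebra_simps)
  qed
  have R: "Suc e choose 2 < s" using assms(1,2) by simp
  consider "e = 1" | "e = 2" | "e = 3" | "e = 4" | "5 \<le> e" using assms(1) by linarith
  then show thesis
  proof cases
    case 1
    then have "s = 3" using R assms(3,4) by (simp add: choose_two)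
    have "waldschmidt_ge TYPE('k) 2 (3 / 2) s"
      using waldschmidt_ge_simplex[of 1 1, where 'k = 'k] \<open>s = 3\<close>
      by (simp add: eval_nat_numeral)
    moreover have "real d < 3 / 2 * real (2 * m - 2 + 1)" if "2 \<le> m" "d < m * Suc e" for m d
      using bound[OF that(2)] that(1) t 1 by simp
    ultimately show thesis by (rule that)
  next
    case 2
    then have "4 \<le> s" using R by (simp add: choose_two)
    then have "waldschmidt_ge TYPE('k) 2 2 s"
      by (intro waldschmidt_ge_mono[OF waldschmidt_ge_curve[of 1 4 2 2]]) auto
    moreover have "real d < 2 * real (2 * m - 2 + 1)" if "2 \<le> m" "d < m * Suc e" for m d
      using bound[OF that(2)] that(1) t 2 by simp
    ultimately show thesis by (rule that)
  next
    case 3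
    then have "7 \<le> s" using R by (simp add: choose_two)
    then have "waldschmidt_ge TYPE('k) 2 (5 / 2) s"
      by (intro waldschmidt_ge_mono[OF waldschmidt_ge_curve[of 2 7 5 "5 / 2"]]) auto
    moreover have "real d < 5 / 2 * real (2 * m - 2 + 1)" if "2 \<le> m" "d < m * Suc e" for m d
      using bound[OF that(2)] that(1) t 3 by simp
    ultimately show thesis by (rule that)
  next
    case 4
    then have "11 \<le> s" using R by (simp add: choose_two)
    \<comment> \<open>For \<open>\<delta> = 3\<close>, \<open>r = 10\<close> and
      \<open>n = 11\<close> the smaller of the two bounds is
      \<open>n \<delta> / r = 33 / 10\<close>.\<close>
    then have "waldschmidt_ge TYPE('k) 2 (33 / 10) s"
      by (intro waldschmidt_ge_mono[OF waldschmidt_ge_curve[of 3 11 10 "33 / 10"]]) auto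
    moreover have "real d < 33 / 10 * real (2 * m - 2 + 1)" if "2 \<le> m" "d < m * Suc e" for m d
      using bound[OF that(2)] that(1) t 4 by simp
    ultimately show thesis by (rule that)
  next
    case 5
    define c where "c = 2 * real (Suc e) / 3"
    have s2: "Suc e * e + 2 \<le> 2 * s" using R choose_2_times[of "Suc e"] by simp
    obtain k where k: "e = 5 + k" using 5 le_Suc_ex by blast
    have r: "2 * Suc e \<le> s" using s2 by (simp add: k algebra_simps)
    have sq: "4 * (Suc e * Suc e) \<le> 9 * s" using s2 by (simp add: k algebra_simps)
    have "waldschmidt_ge TYPE('k) 2 c s"
    proof (rule waldschmidt_ge_curve[of 3 s "2 * Suc e"])
      have "4 * (real (Suc e) * real (Suc e)) \<le> 9 * real s"
        using sq by (metis of_nat_le_iff of_nat_mult of_nat_numeral)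
      then show "c * real (2 * Suc e) \<le> real s * real 3" by (simp add: c_def field_simps)
    qed (use r in \<open>auto simp: c_def\<close>)
    moreover have "real d < c * real (2 * m - 2 + 1)" if m: "2 \<le> m" "d < m * Suc e" for m d
    proof -
      have "real (Suc e) * (3 * real m) \<le> real (Suc e) * (2 * (2 * real m - 1))"
        using m(1) by (intro mult_left_mono) auto
      then have "real m * (real e + 1) \<le> c * (2 * real m - 1)" by (simp add: c_def field_simps)
      then show ?thesis using bound[OF m(2)] t[OF m(1)] by simp
    qed
    ultimately show thesis by (rule that)
  qed
qed

text \<open>As \<open>3 m - 2 \<ge> 2 m\<close> for \<open>m \<ge> 2\<close>, the constant
  \<open>c = (e + 1) / 2\<close> suffices. It takes \<open>c\<close> parallel planes, rounded up,
  with about \<open>c^2\<close> points in each: \<open>k\<close> planes of \<open>k^2\<close> points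
  for \<open>c = k\<close>, and \<open>j + 1\<close> planes of \<open>j^2 + j + 1\<close> points,
  the least integer above \<open>c^2\<close>, for \<open>c = j + 1/2\<close>. For
  \<open>j = 1\<close> these would be 6 points while \<open>s\<close> may be 5, so
  \<open>e = 2\<close> uses a simplex of 4 points; its constant \<open>4 / 3\<close> is enough
  because \<open>d \<le> 3 m - 1\<close>.\<close>

lemma space_bound:
  assumes "0 < e" "((e - 1 + 3) choose 3) < s"
  obtains c where "waldschmidt_ge TYPE('k::field_char_0) 3 c s"
    "\<And>m d. 2 \<le> m \<Longrightarrow> d < m * Suc e \<Longrightarrow> real d < c * real (3 * m - 3 + 1)"
proof -
  have t: "real (3 * m - 3 + 1) = 3 * real m - 2" if "2 \<le> m" for m
    using that by (simp add: of_nat_diff)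
  have bound: "real d \<le> real m * (real e + 1) - 1" if "d < m * Suc e" for d m
  proof -
    have "real (Suc d) \<le> real (m * Suc e)" using that by (simp only: of_nat_le_iff)
    then show ?thesis by (simp add: algebra_simps)
  qed
  have "(e - 1 + 3) = Suc (Suc e)" using assms(1) by simp
  then have s6: "Suc (Suc e) * Suc e * e + 6 \<le> 6 * s"
    using assms(2) choose_3_times[of "Suc e"] by simp
  have parallel: "waldschmidt_ge TYPE('k) 3 c s"
    if "waldschmidt_ge TYPE('k) 2 c n" "c \<le> real k" "k * n \<le> s" for c k n
    using waldschmidt_ge_mono[OF waldschmidt_ge_parallel[OF that(1) order_refl that(2)] order_refl that(3)]
    by (simp add: eval_nat_numeral)
  have "(\<exists>k. Suc e = 2 * k) \<or> (\<exists>j. Suc e = 2 * j + 1)" by presburger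
  then consider k where "Suc e = 2 * k" "1 \<le> k" | "e = 2" | j where "Suc e = 2 * j + 1" "2 \<le> j"
    using assms(1) by fastforce
  then show thesis
  proof cases
    case 1
    have "6 * (k * (k * k)) \<le> 6 * s"
    proof -
      obtain i where i: "k = Suc i" using 1(2) by (cases k) auto
      then have "e = 2 * i + 1" using 1(1) by simp
      then show ?thesis using s6 by (simp add: i algebra_simps)
    qed
    then have "waldschmidt_ge TYPE('k) 3 (real k) s"
      using 1(2) by (intro parallel[of "real k" "k * k" k] waldschmidt_ge_curve[of 1 "k * k" k]) auto
    moreover have "real d < real k * real (3 * m - 3 + 1)" if m: "2 \<le> m" "d < m * Suc e" for m d
    proof -
      have "real k * (2 * real m) \<le> real k * (3 * real m - 2)"
        using m(1) by (intro mult_left_mono) auto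
      moreover have "real e + 1 = 2 * real k" using 1(1) by linarith
      ultimately have "real m * (real e + 1) \<le> real k * (3 * real m - 2)"
        by (simp add: algebra_simps)
      then show ?thesis using bound[OF m(2)] t[OF m(1)] by simp
    qed
    ultimately show thesis by (rule that)
  next
    case 2
    then have "4 \<le> s" using s6 by simp
    then have "waldschmidt_ge TYPE('k) 3 (4 / 3) s"
      using waldschmidt_ge_mono[OF waldschmidt_ge_simplex[of 2 1, where 'k = 'k] order_refl, of s]
      by (simp add: eval_nat_numeral)
    moreover have "real d < 4 / 3 * real (3 * m - 3 + 1)" if "2 \<le> m" "d < m * Suc e" for m d
      using bound[OF that(2)] that(1) t 2 by simp
    ultimately show thesis by (rule that)
  next
    case 3
    define c where "c = (2 * real j + 1) / 2"
    define n where "n = j * j + j + 1"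
    obtain i where i: "j = 2 + i" using 3(2) le_Suc_ex by blast
    have e: "e = 2 * j" using 3(1) by simp
    have "6 * (Suc j * n) \<le> 6 * s" using s6 by (simp add: e n_def i algebra_simps)
    moreover have "waldschmidt_ge TYPE('k) 2 c n"
    proof (rule waldschmidt_ge_curve[of 2 n "2 * j + 1"])
      show "c * real (2 * j + 1) \<le> real n * real 2"
        by (simp add: c_def n_def algebra_simps)
    qed (auto simp: c_def n_def i)
    ultimately have "waldschmidt_ge TYPE('k) 3 c s"
      by (intro parallel[of c n "Suc j"]) (auto simp: c_def)
    moreover have "real d < c * real (3 * m - 3 + 1)" if m: "2 \<le> m" "d < m * Suc e" for m d
    proof -
      have "(2 * real j + 1) * (2 * real m) \<le> (2 * real j + 1) * (3 * real m - 2)"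
        using m(1) by (intro mult_left_mono) auto
      then have "real m * (real e + 1) \<le> c * (3 * real m - 2)" by (simp add: c_def e field_simps)
      then show ?thesis using bound[OF m(2)] t[OF m(1)] by simp
    qed
    ultimately show thesis by (rule that)
  qed
qed

theorem theorem2p2:
  fixes N s :: nat
  assumes "N \<ge> 2" and "s \<ge> 1"
  shows "very_general_points N s
    (\<lambda>P :: nat \<Rightarrow> (nat \<Rightarrow> 'k::field_char_0) set.
      \<forall>m::nat. real m \<ge> beta N (alpha (points_ideal N s P)) \<longrightarrow>
        symbolic_power N s P (N * m - N + 1) \<subseteq> ideal_power N (points_ideal N s P) m)"
proof -
  define e where "e = (LEAST e. s \<le> (e + N) choose N)"
  have "Suc s \<le> (s + N) choose N"
  proof -
    have "Suc s = (s + 1) choose s" by simp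
    also have "\<dots> \<le> (s + N) choose s" using assms(1) by (intro binomial_right_mono) auto
    also have "\<dots> = (s + N) choose N" by (subst binomial_symmetric) auto
    finally show ?thesis .
  qed
  then have "\<exists>e. s \<le> (e + N) choose N" by (intro exI[of _ s]) simp
  then have e1: "s \<le> (e + N) choose N" unfolding e_def by (rule LeastI_ex)
  have e2: "(e - 1 + N) choose N < s" if "0 < e"
    using not_less_Least[of "e - 1" "\<lambda>e. s \<le> (e + N) choose N"] that by (simp add: e_def[symmetric])
  have pos: "0 < N" "0 < s" using assms by auto
  have point: "real d < 1 * real (N * m - N + 1)" if m: "2 \<le> m" "d < m" for m d
  proof -
    have "m - 1 \<le> N * (m - 1)" using pos(1) by simp
    then have "d < N * m - N + 1" using m by (simp add: diff_mult_distrib2)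
    then show ?thesis by simp
  qed
  have w1: "waldschmidt_ge TYPE('k) N 1 s"
    using waldschmidt_ge_mono[OF waldschmidt_ge_point order_refl, of s] assms(2) by simp
  note main = very_general_containment[OF pos e1 order.strict_implies_order[OF e2]]
  consider "e = 0" | "0 < e" "4 \<le> N" | "0 < e" "N = 3" | "0 < e" "N = 2" "s \<noteq> 2" | "0 < e" "N = 2" "s = 2"
    using assms(1) by linarith
  then show ?thesis
  proof cases
    case 1
    \<comment> \<open>\<open>e = 0\<close> means a single point, and \<open>c = 1\<close> excludes
      all \<open>d < m\<close>.\<close>
    show ?thesis by (rule main[OF _ w1]) (use point 1 in auto)
  next
    case 2
    obtain N' where N': "N = Suc N'" using pos(1) by (cases N) auto
    have w: "waldschmidt_ge TYPE('k) N (real (e - 1 + N) / real N) s"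
      using waldschmidt_ge_mono[OF waldschmidt_ge_simplex[of N' "e - 1"] order_refl, of s] e2[OF 2(1)]
      unfolding N' by simp
    show ?thesis
    proof (rule main[OF _ w])
      fix m a d assume *: "2 \<le> m" "e \<le> a" "beta N a \<le> real m" "d < m * Suc e"
      have "real d < real (m * Suc e)" using *(4) by (simp only: of_nat_less_iff)
      also have "\<dots> < real (e - 1 + N) / real N * real (N * m - N + 1)"
        by (rule beta_bound[OF 2(2) *(2,3) 2(1)])
      finally show "real d < real (e - 1 + N) / real N * real (N * m - N + 1)
          \<or> N = 2 \<and> s = 2 \<and> e = 1 \<and> d = 2 * m - 1" ..
    qed
  next
    case 3
    have "(e - 1 + 3) choose 3 < s" using e2 3 by simp
    from space_bound[OF 3(1) this] obtain c where c: "waldschmidt_ge TYPE('k) 3 c s"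
      "\<And>m d. 2 \<le> m \<Longrightarrow> d < m * Suc e \<Longrightarrow> real d < c * real (3 * m - 3 + 1)" by blast
    show ?thesis by (rule main[of c]) (use c 3(2) in auto)
  next
    case 4
    have "(e - 1 + 2) choose 2 < s" "s \<le> (e + 2) choose 2" using e2 e1 4 by simp_all
    from plane_bound[OF 4(1) this 4(3)] obtain c where c: "waldschmidt_ge TYPE('k) 2 c s"
      "\<And>m d. 2 \<le> m \<Longrightarrow> d < m * Suc e \<Longrightarrow> real d < c * real (2 * m - 2 + 1)" by blast
    show ?thesis by (rule main[of c]) (use c 4(2) in auto)
  next
    case 5
    have "Suc e choose 2 < 2" using e2[OF 5(1)] 5 by simp
    then have "Suc e * e < 4" using choose_2_times[of "Suc e"] by simp
    then have "e = 1"
    proof -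
      have "e < 2"
      proof (rule ccontr)
        assume "\<not> e < 2"
        then have "3 * 2 \<le> Suc e * e" by (intro mult_le_mono) auto
        then show False using \<open>Suc e * e < 4\<close> by simp
      qed
      then show ?thesis using 5(1) by simp
    qed
    \<comment> \<open>The order is \<open>2 m - 1\<close>, so \<open>c = 1\<close> excludes
      \<open>d < 2 m - 1\<close>, and \<open>d < 2 m\<close> leaves only the exceptional
      degree.\<close>
    show ?thesis by (rule main[OF _ w1]) (use 5 \<open>e = 1\<close> in auto)
  qed
qed

end
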